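(* Let $P$ be any one of the following group properties: Bergman's property, property FB$_{\mathrm r}$, property FH, or property FW. Let $G$ and $H$ be two groups with $G$ non-trivial, and let $X$ be a set on which $H$ acts. Then the wreath product $G\wr_X H$ has property $P$ if and only if $G$ and $H$ have property $P$ and $X$ is finite.
   Context: Wreath product: $\bigoplus_X G$ is the group (with componentwise multiplication) of functions $\varphi\colon X\to G$ with $\varphi(x)=1$ for all but finitely many $x$. The group $H$ acts on it by $(h.\varphi)(x)=\varphi(h^{-1}.x)$, and $G\wr_X H:=(\bigoplus_X G)\rtimes H$. Connected graphs are non-empty and simple, and carry the shortest-path metric on their vertex set. For vertices $u,v$ of a connected graph, $[u,v]$ is the set of vertices lying on some shortest path between $u$ and $v$. A connected graph is median if for any three vertices $u,v,w$ the intersection $[u,v]\cap[v,w]\cap[u,w]$ consists of exactly one vertex. A group has: - Bergman's property if any action by (bijective) isometries on a metric space has bounded orbits; - property FB$_{\mathrm r}$ if any action by affine isometries on a reflexive real Banach space has bounded orbits; - property FH if any action by affine isometries on a real Hilbert space has bounded orbits; - property FW if any action by graph isomorphisms on a connected median graph has bounded orbits.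
   Formalization: X is assumed non-empty (for X empty the claim fails: G = Z, H trivial), and each property P is tested on spaces and graphs inside an arbitrary ambient set that is infinite, as large as its set of countable sequences, and at least as large as G, H and X. *)

theory Defs
  imports
    "HOL-Library.Equipollence"
    "HOL-Algebra.Group_Action"
    "HOL-Algebra.Product_Groups"
    "HOL-Algebra.Module"
    "HOL-Analysis.Abstract_Metric_Spaces"
begin

section \<open>Wreath products\<close>

definition semidirect_product ::
  "('n, 'x) monoid_scheme \<Rightarrow> ('h, 'y) monoid_scheme \<Rightarrow> ('h \<Rightarrow> 'n \<Rightarrow> 'n) \<Rightarrow> ('n \<times> 'h) monoid"
  where
  "semidirect_product N H \<alpha> =
    \<lparr>carrier = carrier N \<times> carrier H,
     monoid.mult = (\<lambda>(n, h) (n', h'). (n \<otimes>\<^bsub>N\<^esub> \<alpha> h n', h \<otimes>\<^bsub>H\<^esub> h')),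
     one = (\<one>\<^bsub>N\<^esub>, \<one>\<^bsub>H\<^esub>)\<rparr>"

definition shift_action ::
  "('h, 'y) monoid_scheme \<Rightarrow> 'x set \<Rightarrow> ('h \<Rightarrow> 'x \<Rightarrow> 'x) \<Rightarrow> 'h \<Rightarrow> ('x \<Rightarrow> 'g) \<Rightarrow> 'x \<Rightarrow> 'g"
  where "shift_action H X \<theta> h f = (\<lambda>x\<in>X. f (\<theta> (inv\<^bsub>H\<^esub> h) x))"

definition wreath_product ::
  "('g, 'x) monoid_scheme \<Rightarrow> ('h, 'y) monoid_scheme \<Rightarrow> 'p set \<Rightarrow> ('h \<Rightarrow> 'p \<Rightarrow> 'p)
    \<Rightarrow> (('p \<Rightarrow> 'g) \<times> 'h) monoid"
  where
  "wreath_product G H X \<theta> =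
    semidirect_product (sum_group X (\<lambda>_. G)) H (shift_action H X \<theta>)"


section \<open>Isometric actions and Bergman's property\<close>

text \<open>
  A property of the form ``every action on a space of a certain kind has bounded orbits''
  ranges over spaces of arbitrary cardinality, whereas HOL cannot quantify over types inside
  a formula. The properties below therefore carry a type parameter \<open>'u\<close>, which plays the role
  of a universe: the spaces are those whose underlying set is an arbitrary subset of \<open>'u\<close>.
  A group with an unbounded orbit on some space already has one on the substructure generated
  by this orbit (the orbit itself, a countably generated extension of it inside a median graph,
  or the closed linear span of the orbit of the origin), whose cardinality is at most that of
  the countable sequences in the disjoint union of the group and the natural numbers. Hence
  the parameter is immaterial as soon as \<open>'u\<close> is infinite, closed under countable sequences
  (up to equipollence) and at least as large as the group.
\<close>

definition isometric_action ::
  "('k, 'x) monoid_scheme \<Rightarrow> 'u set \<Rightarrow> ('u \<Rightarrow> 'u \<Rightarrow> real) \<Rightarrow> ('k \<Rightarrow> 'u \<Rightarrow> 'u) \<Rightarrow> bool"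
  where
  "isometric_action K M d \<phi> \<longleftrightarrow>
    group_action K M \<phi> \<and>
    (\<forall>g\<in>carrier K. \<forall>x\<in>M. \<forall>y\<in>M. d (\<phi> g x) (\<phi> g y) = d x y)"

definition bounded_orbits ::
  "('k, 'x) monoid_scheme \<Rightarrow> 'u set \<Rightarrow> ('u \<Rightarrow> 'u \<Rightarrow> real) \<Rightarrow> ('k \<Rightarrow> 'u \<Rightarrow> 'u) \<Rightarrow> bool"
  where
  "bounded_orbits K M d \<phi> \<longleftrightarrow> (\<forall>x\<in>M. Metric_space.mbounded M d (orbit K \<phi> x))"

definition bergman_property :: "'u itself \<Rightarrow> ('k, 'x) monoid_scheme \<Rightarrow> bool"
  where
  "bergman_property (_ :: 'u itself) K \<longleftrightarrow>
    (\<forall>(M :: 'u set) d \<phi>.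
      Metric_space M d \<and> isometric_action K M d \<phi> \<longrightarrow> bounded_orbits K M d \<phi>)"


section \<open>Median graphs and property FW\<close>

definition simple_graph :: "'u set \<Rightarrow> ('u \<times> 'u) set \<Rightarrow> bool"
  where "simple_graph V E \<longleftrightarrow> E \<subseteq> V \<times> V \<and> sym E \<and> irrefl E"

text \<open>Vertices of a walk may repeat; walks of minimal length are automatically paths.\<close>

definition walks :: "'u set \<Rightarrow> ('u \<times> 'u) set \<Rightarrow> 'u \<Rightarrow> 'u \<Rightarrow> 'u list set"
  where
  "walks V E u v =
    {p. p \<noteq> [] \<and> set p \<subseteq> V \<and> hd p = u \<and> last p = v \<and> successively (\<lambda>a b. (a, b) \<in> E) p}"

definition connected_graph :: "'u set \<Rightarrow> ('u \<times> 'u) set \<Rightarrow> bool"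
  where
  "connected_graph V E \<longleftrightarrow>
    simple_graph V E \<and> V \<noteq> {} \<and> (\<forall>u\<in>V. \<forall>v\<in>V. walks V E u v \<noteq> {})"

definition graph_dist :: "'u set \<Rightarrow> ('u \<times> 'u) set \<Rightarrow> 'u \<Rightarrow> 'u \<Rightarrow> nat"
  where "graph_dist V E u v = (LEAST n. \<exists>p\<in>walks V E u v. length p = Suc n)"

definition shortest_paths :: "'u set \<Rightarrow> ('u \<times> 'u) set \<Rightarrow> 'u \<Rightarrow> 'u \<Rightarrow> 'u list set"
  where "shortest_paths V E u v = {p \<in> walks V E u v. length p = Suc (graph_dist V E u v)}"

definition graph_interval :: "'u set \<Rightarrow> ('u \<times> 'u) set \<Rightarrow> 'u \<Rightarrow> 'u \<Rightarrow> 'u set"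
  where "graph_interval V E u v = {x. \<exists>p\<in>shortest_paths V E u v. x \<in> set p}"

definition median_graph :: "'u set \<Rightarrow> ('u \<times> 'u) set \<Rightarrow> bool"
  where
  "median_graph V E \<longleftrightarrow>
    connected_graph V E \<and>
    (\<forall>u\<in>V. \<forall>v\<in>V. \<forall>w\<in>V.
      \<exists>!x. x \<in> graph_interval V E u v \<inter> graph_interval V E v w \<inter> graph_interval V E u w)"

definition graph_action ::
  "('k, 'x) monoid_scheme \<Rightarrow> 'u set \<Rightarrow> ('u \<times> 'u) set \<Rightarrow> ('k \<Rightarrow> 'u \<Rightarrow> 'u) \<Rightarrow> bool"
  where
  "graph_action K V E \<phi> \<longleftrightarrow>
    group_action K V \<phi> \<and>
    (\<forall>g\<in>carrier K. \<forall>u\<in>V. \<forall>v\<in>V. (\<phi> g u, \<phi> g v) \<in> E \<longleftrightarrow> (u, v) \<in> E)"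

definition property_FW :: "'u itself \<Rightarrow> ('k, 'x) monoid_scheme \<Rightarrow> bool"
  where
  "property_FW (_ :: 'u itself) K \<longleftrightarrow>
    (\<forall>(V :: 'u set) E \<phi>.
      median_graph V E \<and> graph_action K V E \<phi> \<longrightarrow>
      bounded_orbits K V (\<lambda>u v. real (graph_dist V E u v)) \<phi>)"


section \<open>Banach and Hilbert spaces on a carrier set\<close>

definition real_ring :: "real ring"
  where "real_ring = \<lparr>carrier = UNIV, monoid.mult = (*), one = 1, ring.zero = 0, add = (+)\<rparr>"

definition normed_space :: "(real, 'u, 'x) module_scheme \<Rightarrow> ('u \<Rightarrow> real) \<Rightarrow> bool"
  where
  "normed_space V N \<longleftrightarrow>
    Module.module real_ring V \<and>
    (\<forall>x\<in>carrier V. N x = 0 \<longleftrightarrow> x = \<zero>\<^bsub>V\<^esub>) \<and>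
    (\<forall>a. \<forall>x\<in>carrier V. N (a \<odot>\<^bsub>V\<^esub> x) = \<bar>a\<bar> * N x) \<and>
    (\<forall>x\<in>carrier V. \<forall>y\<in>carrier V. N (x \<oplus>\<^bsub>V\<^esub> y) \<le> N x + N y)"

text \<open>
  The locale \<^locale>\<open>Metric_space\<close> requires symmetry and non-negativity also outside the
  carrier, hence the case distinction.
\<close>

definition norm_dist :: "(real, 'u, 'x) module_scheme \<Rightarrow> ('u \<Rightarrow> real) \<Rightarrow> 'u \<Rightarrow> 'u \<Rightarrow> real"
  where
  "norm_dist V N x y =
    (if x \<in> carrier V \<and> y \<in> carrier V then N (x \<ominus>\<^bsub>V\<^esub> y) else 0)"

definition banach_space :: "(real, 'u, 'x) module_scheme \<Rightarrow> ('u \<Rightarrow> real) \<Rightarrow> bool"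
  where
  "banach_space V N \<longleftrightarrow>
    normed_space V N \<and> Metric_space.mcomplete (carrier V) (norm_dist V N)"

definition inner_product_space ::
  "(real, 'u, 'x) module_scheme \<Rightarrow> ('u \<Rightarrow> 'u \<Rightarrow> real) \<Rightarrow> bool"
  where
  "inner_product_space V ip \<longleftrightarrow>
    Module.module real_ring V \<and>
    (\<forall>x\<in>carrier V. \<forall>y\<in>carrier V. ip x y = ip y x) \<and>
    (\<forall>x\<in>carrier V. \<forall>y\<in>carrier V. \<forall>z\<in>carrier V. ip (x \<oplus>\<^bsub>V\<^esub> y) z = ip x z + ip y z) \<and>
    (\<forall>a. \<forall>x\<in>carrier V. \<forall>y\<in>carrier V. ip (a \<odot>\<^bsub>V\<^esub> x) y = a * ip x y) \<and>
    (\<forall>x\<in>carrier V. x \<noteq> \<zero>\<^bsub>V\<^esub> \<longrightarrow> ip x x > 0)"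

definition inner_norm :: "('u \<Rightarrow> 'u \<Rightarrow> real) \<Rightarrow> 'u \<Rightarrow> real"
  where "inner_norm ip x = sqrt (ip x x)"

definition hilbert_space :: "(real, 'u, 'x) module_scheme \<Rightarrow> ('u \<Rightarrow> 'u \<Rightarrow> real) \<Rightarrow> bool"
  where
  "hilbert_space V ip \<longleftrightarrow> inner_product_space V ip \<and> banach_space V (inner_norm ip)"


subsection \<open>Reflexivity\<close>

text \<open>
  Functionals are normalised to be \<open>0\<close> outside the carrier. The ring multiplication and unit
  are fields of the record type that play no role for modules.
\<close>

definition dual_space ::
  "(real, 'u, 'x) module_scheme \<Rightarrow> ('u \<Rightarrow> real) \<Rightarrow> (real, 'u \<Rightarrow> real) module"
  where
  "dual_space V N =
    \<lparr>carrier =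
       {f. (\<forall>x. x \<notin> carrier V \<longrightarrow> f x = 0) \<and>
           (\<forall>x\<in>carrier V. \<forall>y\<in>carrier V. f (x \<oplus>\<^bsub>V\<^esub> y) = f x + f y) \<and>
           (\<forall>a. \<forall>x\<in>carrier V. f (a \<odot>\<^bsub>V\<^esub> x) = a * f x) \<and>
           (\<exists>C. \<forall>x\<in>carrier V. \<bar>f x\<bar> \<le> C * N x)},
     monoid.mult = undefined, one = undefined,
     ring.zero = (\<lambda>_. 0), add = (\<lambda>f g x. f x + g x), smult = (\<lambda>a f x. a * f x)\<rparr>"

definition dual_norm ::
  "(real, 'u, 'x) module_scheme \<Rightarrow> ('u \<Rightarrow> real) \<Rightarrow> ('u \<Rightarrow> real) \<Rightarrow> real"
  where "dual_norm V N f = (SUP x\<in>{x \<in> carrier V. N x \<le> 1}. \<bar>f x\<bar>)"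

definition evaluation ::
  "(real, 'u, 'x) module_scheme \<Rightarrow> ('u \<Rightarrow> real) \<Rightarrow> 'u \<Rightarrow> ('u \<Rightarrow> real) \<Rightarrow> real"
  where "evaluation V N x f = (if f \<in> carrier (dual_space V N) then f x else 0)"

definition reflexive_space :: "(real, 'u, 'x) module_scheme \<Rightarrow> ('u \<Rightarrow> real) \<Rightarrow> bool"
  where
  "reflexive_space V N \<longleftrightarrow>
    evaluation V N ` carrier V = carrier (dual_space (dual_space V N) (dual_norm V N))"


section \<open>Affine isometric actions, properties FBr and FH\<close>

definition affine_map :: "(real, 'u, 'x) module_scheme \<Rightarrow> ('u \<Rightarrow> 'u) \<Rightarrow> bool"
  where
  "affine_map V f \<longleftrightarrow>
    (\<exists>L\<in>carrier V \<rightarrow> carrier V. \<exists>b\<in>carrier V.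
      (\<forall>x\<in>carrier V. \<forall>y\<in>carrier V. L (x \<oplus>\<^bsub>V\<^esub> y) = L x \<oplus>\<^bsub>V\<^esub> L y) \<and>
      (\<forall>a. \<forall>x\<in>carrier V. L (a \<odot>\<^bsub>V\<^esub> x) = a \<odot>\<^bsub>V\<^esub> L x) \<and>
      (\<forall>x\<in>carrier V. f x = L x \<oplus>\<^bsub>V\<^esub> b))"

definition affine_isometric_action ::
  "('k, 'x) monoid_scheme \<Rightarrow> (real, 'u, 'y) module_scheme \<Rightarrow> ('u \<Rightarrow> real) \<Rightarrow> ('k \<Rightarrow> 'u \<Rightarrow> 'u) \<Rightarrow> bool"
  where
  "affine_isometric_action K V N \<phi> \<longleftrightarrow>
    isometric_action K (carrier V) (norm_dist V N) \<phi> \<and>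
    (\<forall>g\<in>carrier K. affine_map V (\<phi> g))"

definition property_FBr :: "'u itself \<Rightarrow> ('k, 'x) monoid_scheme \<Rightarrow> bool"
  where
  "property_FBr (_ :: 'u itself) K \<longleftrightarrow>
    (\<forall>(V :: (real, 'u) module) N \<phi>.
      banach_space V N \<and> reflexive_space V N \<and> affine_isometric_action K V N \<phi> \<longrightarrow>
      bounded_orbits K (carrier V) (norm_dist V N) \<phi>)"

definition property_FH :: "'u itself \<Rightarrow> ('k, 'x) monoid_scheme \<Rightarrow> bool"
  where
  "property_FH (_ :: 'u itself) K \<longleftrightarrow>
    (\<forall>(V :: (real, 'u) module) ip \<phi>.
      hilbert_space V ip \<and> affine_isometric_action K V (inner_norm ip) \<phi> \<longrightarrow>
      bounded_orbits K (carrier V) (norm_dist V (inner_norm ip)) \<phi>)"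


section \<open>Basic facts\<close>

lemma group_wreath_product:
  assumes "group G" "group H" "group_action H X \<theta>"
  shows "group (wreath_product G H X \<theta>)"
proof -
  interpret G: group G by fact
  interpret H: group H by fact
  interpret A: group_action H X \<theta> by fact
  let ?N = "sum_group X (\<lambda>_. G)" and ?\<alpha> = "shift_action H X \<theta> :: 'c \<Rightarrow> ('e \<Rightarrow> 'a) \<Rightarrow> _"
  interpret N: group ?N using assms(1) by simp
  have cN: "carrier ?N = {x \<in> X \<rightarrow>\<^sub>E carrier G. finite {i \<in> X. x i \<noteq> \<one>\<^bsub>G\<^esub>}}"
    by (rule carrier_sum_group) (rule assms(1))
  have mem: "\<theta> h x \<in> X" if "h \<in> carrier H" "x \<in> X" for h x
    using A.element_image that by blast
  have closed: "?\<alpha> h f \<in> carrier ?N" if h: "h \<in> carrier H" and f: "f \<in> carrier ?N" for h f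
  proof -
    have "inj_on (\<theta> (inv\<^bsub>H\<^esub> h)) X" using A.inj_prop h by simp
    moreover have "finite {i \<in> X. f i \<noteq> \<one>\<^bsub>G\<^esub>}" using f cN by simp
    ultimately have "finite (\<theta> (inv\<^bsub>H\<^esub> h) -` {i \<in> X. f i \<noteq> \<one>\<^bsub>G\<^esub>} \<inter> X)"
      by (intro finite_vimage_IntI)
    then have "finite {i \<in> X. f (\<theta> (inv\<^bsub>H\<^esub> h) i) \<noteq> \<one>\<^bsub>G\<^esub>}"
      by (rule rev_finite_subset) (use mem h in auto)
    moreover have "?\<alpha> h f \<in> X \<rightarrow>\<^sub>E carrier G"
      using f h mem unfolding cN shift_action_def by (auto simp: PiE_iff)
    ultimately show ?thesis
      unfolding cN by (auto simp: shift_action_def cong: conj_cong)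
  qed
  have hom: "?\<alpha> h (f \<otimes>\<^bsub>?N\<^esub> f') = ?\<alpha> h f \<otimes>\<^bsub>?N\<^esub> ?\<alpha> h f'" if "h \<in> carrier H" for h f f'
    using mem that by (auto simp: shift_action_def fun_eq_iff)
  have comp: "?\<alpha> (h \<otimes>\<^bsub>H\<^esub> h') f = ?\<alpha> h (?\<alpha> h' f)"
    if "h \<in> carrier H" "h' \<in> carrier H" for h h' f
    using mem that A.composition_rule
    by (auto simp: shift_action_def fun_eq_iff H.inv_mult_group)
  have one: "?\<alpha> \<one>\<^bsub>H\<^esub> f = f" if "f \<in> carrier ?N" for f
    using that A.id_eq_one unfolding cN
    by (auto simp: shift_action_def fun_eq_iff PiE_iff extensional_def)
      (metis restrict_apply')
  have one': "?\<alpha> h \<one>\<^bsub>?N\<^esub> = \<one>\<^bsub>?N\<^esub>" if "h \<in> carrier H" for h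
    using mem that by (auto simp: shift_action_def fun_eq_iff)
  show ?thesis
  proof (rule groupI)
    fix x assume "x \<in> carrier (wreath_product G H X \<theta>)"
    then obtain n h where x: "x = (n, h)" "n \<in> carrier ?N" "h \<in> carrier H"
      by (auto simp: wreath_product_def semidirect_product_def)
    let ?y = "(?\<alpha> (inv\<^bsub>H\<^esub> h) (inv\<^bsub>?N\<^esub> n), inv\<^bsub>H\<^esub> h)"
    have "?\<alpha> (inv\<^bsub>H\<^esub> h) (inv\<^bsub>?N\<^esub> n) \<otimes>\<^bsub>?N\<^esub> ?\<alpha> (inv\<^bsub>H\<^esub> h) n = \<one>\<^bsub>?N\<^esub>"
      by (metis hom one' N.l_inv x(2,3) H.inv_closed)
    then show "\<exists>y\<in>carrier (wreath_product G H X \<theta>).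
        y \<otimes>\<^bsub>wreath_product G H X \<theta>\<^esub> x = \<one>\<^bsub>wreath_product G H X \<theta>\<^esub>"
      using x closed
      by (intro bexI[of _ ?y]) (auto simp: wreath_product_def semidirect_product_def simp del: mult_sum_group one_sum_group inv_sum_group)
  qed (auto simp: wreath_product_def semidirect_product_def hom comp closed N.m_assoc H.m_assoc one
        simp del: mult_sum_group one_sum_group)
qed

lemma Metric_space_graph_dist:
  assumes "connected_graph V E"
  shows "Metric_space V (\<lambda>u v. real (graph_dist V E u v))"
proof
  have E: "sym E" "E \<subseteq> V \<times> V" using assms by (auto simp: connected_graph_def simple_graph_def)
  have rev_walk: "rev p \<in> walks V E v u" if "p \<in> walks V E u v" for p u v
  proof -
    have "successively (\<lambda>a b. (b, a) \<in> E) p"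
      using that E(1) by (auto simp: walks_def sym_def elim!: successively_mono)
    then show ?thesis using that by (auto simp: walks_def hd_rev last_rev)
  qed
  have ex: "\<exists>p\<in>walks V E u v. length p = Suc (graph_dist V E u v)" if uv: "u \<in> V" "v \<in> V" for u v
  proof -
    have "walks V E u v \<noteq> {}" using assms uv by (simp add: connected_graph_def)
    then obtain p where "p \<in> walks V E u v" by blast
    moreover then have "length p = Suc (length p - 1)" by (cases p) (auto simp: walks_def)
    ultimately have "\<exists>n. \<exists>p\<in>walks V E u v. length p = Suc n" by blast
    then show ?thesis unfolding graph_dist_def by (rule LeastI_ex)
  qed
  have le: "graph_dist V E u v \<le> n" if "p \<in> walks V E u v" "length p = Suc n" for p u v n
    unfolding graph_dist_def using that by (intro Least_le) auto
  show "real (graph_dist V E u v) = real (graph_dist V E v u)" for u v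
    unfolding graph_dist_def using rev_walk by (metis length_rev)
  show "real (graph_dist V E u v) = 0 \<longleftrightarrow> u = v" if uv: "u \<in> V" "v \<in> V" for u v
  proof
    assume "real (graph_dist V E u v) = 0"
    then show "u = v" using ex[OF uv] by (auto simp: walks_def length_Suc_conv)
  next
    assume "u = v"
    then show "real (graph_dist V E u v) = 0" using le[of "[u]" u v 0] uv by (auto simp: walks_def)
  qed
  show "real (graph_dist V E u w) \<le> real (graph_dist V E u v) + real (graph_dist V E v w)"
    if uvw: "u \<in> V" "v \<in> V" "w \<in> V" for u v w
  proof -
    obtain p where p: "p \<in> walks V E u v" "length p = Suc (graph_dist V E u v)"
      using ex uvw by blast
    obtain q where q: "q \<in> walks V E v w" "length q = Suc (graph_dist V E v w)"
      using ex uvw by blast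
    obtain q' where q': "q = v # q'" using q by (cases q) (auto simp: walks_def)
    have "p @ q' \<in> walks V E u w"
      using p q unfolding walks_def q' by (cases q') (auto simp: successively_append_iff)
    moreover have "length (p @ q') = Suc (graph_dist V E u v + graph_dist V E v w)"
      using p q q' by simp
    ultimately show ?thesis using le by (metis of_nat_add of_nat_mono)
  qed
qed auto

lemma cring_real_ring: "cring real_ring"
proof (rule cringI)
  have "\<exists>y. y + x = 0" for x :: real by (rule exI[of _ "-x"]) simp
  then show "abelian_group real_ring" 
    by (intro abelian_groupI) (auto simp: real_ring_def)
  show "comm_monoid real_ring" by (intro comm_monoidI) (auto simp: real_ring_def)
qed (auto simp: real_ring_def algebra_simps)

lemma normed_space_minus_nonneg:
  assumes "normed_space V N" "x \<in> carrier V"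
  shows "N (\<ominus>\<^bsub>V\<^esub> x) = N x" "0 \<le> N x"
proof -
  interpret Module.module real_ring V using assms by (simp add: normed_space_def)
  have R: "carrier real_ring = UNIV" "\<one>\<^bsub>real_ring\<^esub> = 1" "\<ominus>\<^bsub>real_ring\<^esub> 1 = -1"
    using R.minus_equality[of "-1" 1] by (auto simp: real_ring_def)
  have "\<ominus>\<^bsub>V\<^esub> x = (-1) \<odot>\<^bsub>V\<^esub> x"
    using smult_l_minus[of 1 x] smult_one[of x] assms(2) R by simp
  then show minus: "N (\<ominus>\<^bsub>V\<^esub> x) = N x" using assms by (simp add: normed_space_def)
  have "N (x \<oplus>\<^bsub>V\<^esub> \<ominus>\<^bsub>V\<^esub> x) \<le> N x + N (\<ominus>\<^bsub>V\<^esub> x)" "N \<zero>\<^bsub>V\<^esub> = 0"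
    using assms by (auto simp: normed_space_def)
  then show "0 \<le> N x" using minus assms(2) by (simp add: M.r_neg)
qed

lemma Metric_space_norm_dist:
  assumes "normed_space V N"
  shows "Metric_space (carrier V) (norm_dist V N)"
proof -
  interpret Module.module real_ring V using assms by (simp add: normed_space_def)
  have N0: "N x = 0 \<longleftrightarrow> x = \<zero>\<^bsub>V\<^esub>" if "x \<in> carrier V" for x
    using assms that by (simp add: normed_space_def)
  have tri: "N (x \<oplus>\<^bsub>V\<^esub> y) \<le> N x + N y" if "x \<in> carrier V" "y \<in> carrier V" for x y
    using assms that by (simp add: normed_space_def)
  note minus = normed_space_minus_nonneg(1)[OF assms]
  note nonneg = normed_space_minus_nonneg(2)[OF assms]
  show ?thesis
  proof
    show "0 \<le> norm_dist V N x y" for x y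
      using nonneg by (auto simp: norm_dist_def)
    show "norm_dist V N x y = norm_dist V N y x" for x y
    proof (cases "x \<in> carrier V \<and> y \<in> carrier V")
      case True
      then have "y \<ominus>\<^bsub>V\<^esub> x = \<ominus>\<^bsub>V\<^esub> (x \<ominus>\<^bsub>V\<^esub> y)"
        by (simp add: a_minus_def M.minus_add M.a_comm)
      then show ?thesis using True minus[of "x \<ominus>\<^bsub>V\<^esub> y"] by (auto simp: norm_dist_def)
    qed (auto simp: norm_dist_def)
    show "norm_dist V N x y = 0 \<longleftrightarrow> x = y" if "x \<in> carrier V" "y \<in> carrier V" for x y
    proof -
      have "x = y" if "x \<ominus>\<^bsub>V\<^esub> y = \<zero>\<^bsub>V\<^esub>"
        using that M.minus_equality[of x "\<ominus>\<^bsub>V\<^esub> y"] \<open>x \<in> carrier V\<close> \<open>y \<in> carrier V\<close>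
        by (simp add: a_minus_def)
      moreover have "y \<ominus>\<^bsub>V\<^esub> y = \<zero>\<^bsub>V\<^esub>"
        using \<open>y \<in> carrier V\<close> by (simp add: a_minus_def M.r_neg)
      ultimately show ?thesis
        using that N0[of "x \<ominus>\<^bsub>V\<^esub> y"] by (auto simp: norm_dist_def)
    qed
    show "norm_dist V N x z \<le> norm_dist V N x y + norm_dist V N y z"
      if xyz: "x \<in> carrier V" "y \<in> carrier V" "z \<in> carrier V" for x y z
    proof -
      have "x \<ominus>\<^bsub>V\<^esub> z = (x \<ominus>\<^bsub>V\<^esub> y) \<oplus>\<^bsub>V\<^esub> (y \<ominus>\<^bsub>V\<^esub> z)"
        using xyz by (simp add: a_minus_def M.a_assoc M.r_neg1)
      then show ?thesis using xyz tri[of "x \<ominus>\<^bsub>V\<^esub> y" "y \<ominus>\<^bsub>V\<^esub> z"] by (simp add: norm_dist_def)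
    qed
  qed
qed

lemma normed_space_inner_norm:
  assumes I: "inner_product_space V ip"
  shows "normed_space V (inner_norm ip)"
proof -
  interpret Module.module real_ring V using I by (simp add: inner_product_space_def)
  have smult[simp]: "a \<odot>\<^bsub>V\<^esub> x \<in> carrier V" if "x \<in> carrier V" for a x
    by (rule smult_closed) (use that in \<open>auto simp: real_ring_def\<close>)
  have sym: "ip x y = ip y x" if "x \<in> carrier V" "y \<in> carrier V" for x y
    using I that by (simp add: inner_product_space_def)
  have addl: "ip (x \<oplus>\<^bsub>V\<^esub> y) z = ip x z + ip y z"
    if "x \<in> carrier V" "y \<in> carrier V" "z \<in> carrier V" for x y z
    using I that unfolding inner_product_space_def by blast
  have scl: "ip (a \<odot>\<^bsub>V\<^esub> x) y = a * ip x y" if "x \<in> carrier V" "y \<in> carrier V" for a x y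
    using I that unfolding inner_product_space_def by blast
  have addr: "ip z (x \<oplus>\<^bsub>V\<^esub> y) = ip z x + ip z y"
    if "x \<in> carrier V" "y \<in> carrier V" "z \<in> carrier V" for x y z
    using that addl[of x y z] sym[of z "x \<oplus>\<^bsub>V\<^esub> y"] sym[of z x] sym[of z y] by simp
  have scr: "ip y (a \<odot>\<^bsub>V\<^esub> x) = a * ip y x" if "x \<in> carrier V" "y \<in> carrier V" for a x y
    using that scl[of x y a] sym[of y "a \<odot>\<^bsub>V\<^esub> x"] sym[of y x] by simp
  have zero: "ip \<zero>\<^bsub>V\<^esub> \<zero>\<^bsub>V\<^esub> = 0" using addl[of "\<zero>\<^bsub>V\<^esub>" "\<zero>\<^bsub>V\<^esub>" "\<zero>\<^bsub>V\<^esub>"] by simp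
  have pos: "x \<noteq> \<zero>\<^bsub>V\<^esub> \<Longrightarrow> 0 < ip x x" if "x \<in> carrier V" for x
    using I that by (simp add: inner_product_space_def)
  have nn: "0 \<le> ip x x" if "x \<in> carrier V" for x
    using pos[OF that] zero by (cases "x = \<zero>\<^bsub>V\<^esub>") auto
  have cs: "ip x y \<le> inner_norm ip x * inner_norm ip y"
    if x: "x \<in> carrier V" and y: "y \<in> carrier V" for x y
  proof -
    let ?a = "ip y y" and ?b = "- ip x y"
    let ?w = "?a \<odot>\<^bsub>V\<^esub> x \<oplus>\<^bsub>V\<^esub> ?b \<odot>\<^bsub>V\<^esub> y"
    have "ip ?w ?w = ?a * (ip x x * ip y y - (ip x y)\<^sup>2)"
      using x y sym[of y x]
      by (simp add: addl addr scl scr power2_eq_square algebra_simps)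
    then have *: "0 \<le> ?a * (ip x x * ip y y - (ip x y)\<^sup>2)" using nn[of ?w] x y by simp
    have "(ip x y)\<^sup>2 \<le> ip x x * ip y y"
    proof (cases "y = \<zero>\<^bsub>V\<^esub>")
      case True
      have "ip x y = 0" using True addr[of "\<zero>\<^bsub>V\<^esub>" "\<zero>\<^bsub>V\<^esub>" x] x by simp
      then show ?thesis using nn x y by simp
    next
      case False
      then show ?thesis using * pos[OF y] by (simp add: zero_le_mult_iff)
    qed
    then show ?thesis
      unfolding inner_norm_def by (metis real_le_rsqrt real_sqrt_mult)
  qed
  have "inner_norm ip (x \<oplus>\<^bsub>V\<^esub> y) \<le> inner_norm ip x + inner_norm ip y"
    if x: "x \<in> carrier V" and y: "y \<in> carrier V" for x y
  proof -
    have "ip (x \<oplus>\<^bsub>V\<^esub> y) (x \<oplus>\<^bsub>V\<^esub> y) = ip x x + 2 * ip x y + ip y y"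
      using x y sym[of y x] by (simp add: addl addr)
    also have "\<dots> \<le> (inner_norm ip x + inner_norm ip y)\<^sup>2"
      using cs[OF x y] nn[OF x] nn[OF y] by (simp add: inner_norm_def power2_sum)
    finally show ?thesis
      unfolding inner_norm_def[of ip "x \<oplus>\<^bsub>V\<^esub> y"]
      by (intro real_le_lsqrt) (use nn x y in \<open>auto simp: inner_norm_def\<close>)
  qed
  moreover have "inner_norm ip (a \<odot>\<^bsub>V\<^esub> x) = \<bar>a\<bar> * inner_norm ip x" if "x \<in> carrier V" for a x
    using that by (simp add: inner_norm_def scl scr real_sqrt_mult flip: mult.assoc)
  moreover have "inner_norm ip x = 0 \<longleftrightarrow> x = \<zero>\<^bsub>V\<^esub>" if "x \<in> carrier V" for x
    using pos[OF that] zero by (cases "x = \<zero>\<^bsub>V\<^esub>") (auto simp: inner_norm_def)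
  ultimately show ?thesis using I by (simp add: normed_space_def inner_product_space_def)
qed

lemma abs_le_dual_norm:
  assumes V: "normed_space V N" and f: "f \<in> carrier (dual_space V N)" and x: "x \<in> carrier V"
  shows "\<bar>f x\<bar> \<le> dual_norm V N f * N x"
proof -
  interpret Module.module real_ring V using V by (simp add: normed_space_def)
  have scale: "N (a \<odot>\<^bsub>V\<^esub> x) = \<bar>a\<bar> * N x" "f (a \<odot>\<^bsub>V\<^esub> x) = a * f x" "a \<odot>\<^bsub>V\<^esub> x \<in> carrier V" for a
    using V f x by (auto simp: normed_space_def dual_space_def intro!: smult_closed simp: real_ring_def)
  obtain C where C: "\<And>y. y \<in> carrier V \<Longrightarrow> \<bar>f y\<bar> \<le> C * N y"
    using f unfolding dual_space_def by auto blast
  have Npos: "0 \<le> N y" if "y \<in> carrier V" for y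
    using normed_space_minus_nonneg(2)[OF V that] .
  show ?thesis
  proof (cases "N x = 0")
    case True
    then show ?thesis using C[OF x] by simp
  next
    case False
    then have pos: "N x > 0" using Npos[OF x] by simp
    have "\<bar>f y\<bar> \<le> \<bar>C\<bar>" if "y \<in> carrier V" "N y \<le> 1" for y
    proof -
      have "C * N y \<le> \<bar>C\<bar> * 1" using that Npos[of y] by (intro mult_mono) auto
      then show ?thesis using C[OF that(1)] by linarith
    qed
    then have "bdd_above ((\<lambda>y. \<bar>f y\<bar>) ` {y \<in> carrier V. N y \<le> 1})" by (intro bdd_aboveI2) auto
    then have "\<bar>f ((1 / N x) \<odot>\<^bsub>V\<^esub> x)\<bar> \<le> dual_norm V N f"
      unfolding dual_norm_def by (intro cSUP_upper) (use scale pos in auto)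
    then show ?thesis using scale pos by (simp add: abs_mult field_simps)
  qed
qed

lemma dual_norm_le:
  assumes "normed_space V N" and "\<And>x. x \<in> carrier V \<Longrightarrow> N x \<le> 1 \<Longrightarrow> \<bar>f x\<bar> \<le> C"
  shows "dual_norm V N f \<le> C"
proof -
  interpret Module.module real_ring V using assms by (simp add: normed_space_def)
  have "\<zero>\<^bsub>V\<^esub> \<in> {x \<in> carrier V. N x \<le> 1}"
    using assms(1) M.zero_closed by (auto simp: normed_space_def)
      (metis M.zero_closed zero_le_one)
  then show ?thesis unfolding dual_norm_def using assms(2) by (intro cSUP_least) auto
qed

lemma normed_space_dual:
  assumes V: "normed_space V N"
  shows "normed_space (dual_space V N) (dual_norm V N)"
proof -
  interpret Module.module real_ring V using V by (simp add: normed_space_def)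
  let ?D = "dual_space V N"
  have D: "f \<in> carrier ?D \<longleftrightarrow>
      (\<forall>x. x \<notin> carrier V \<longrightarrow> f x = 0) \<and>
      (\<forall>x\<in>carrier V. \<forall>y\<in>carrier V. f (x \<oplus>\<^bsub>V\<^esub> y) = f x + f y) \<and>
      (\<forall>a. \<forall>x\<in>carrier V. f (a \<odot>\<^bsub>V\<^esub> x) = a * f x) \<and>
      (\<exists>C. \<forall>x\<in>carrier V. \<bar>f x\<bar> \<le> C * N x)" for f
    by (simp add: dual_space_def)
  have ops: "\<zero>\<^bsub>?D\<^esub> = (\<lambda>_. 0)" "f \<oplus>\<^bsub>?D\<^esub> g = (\<lambda>x. f x + g x)" "a \<odot>\<^bsub>?D\<^esub> f = (\<lambda>x. a * f x)" for f g a
    by (simp_all add: dual_space_def)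
  have zero: "(\<lambda>_. 0) \<in> carrier ?D" by (auto simp: D intro!: exI[of _ 0])
  have add: "(\<lambda>x. f x + g x) \<in> carrier ?D" if fg: "f \<in> carrier ?D" "g \<in> carrier ?D" for f g
  proof -
    obtain A B where "\<forall>x\<in>carrier V. \<bar>f x\<bar> \<le> A * N x" "\<forall>x\<in>carrier V. \<bar>g x\<bar> \<le> B * N x"
      using fg unfolding D by blast
    then have "\<forall>x\<in>carrier V. \<bar>f x + g x\<bar> \<le> (A + B) * N x" by (fastforce simp: algebra_simps)
    then have "\<exists>C. \<forall>x\<in>carrier V. \<bar>f x + g x\<bar> \<le> C * N x" by blast
    then show ?thesis using fg unfolding D by (simp add: algebra_simps)
  qed
  have scale: "(\<lambda>x. a * f x) \<in> carrier ?D" if f: "f \<in> carrier ?D" for f a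
  proof -
    obtain A where "\<forall>x\<in>carrier V. \<bar>f x\<bar> \<le> A * N x" using f unfolding D by blast
    then have "\<forall>x\<in>carrier V. \<bar>a * f x\<bar> \<le> (\<bar>a\<bar> * A) * N x"
      by (auto simp: abs_mult mult.assoc intro!: mult_left_mono)
    then have "\<exists>C. \<forall>x\<in>carrier V. \<bar>a * f x\<bar> \<le> C * N x" by blast
    then show ?thesis using f unfolding D by (simp add: algebra_simps)
  qed
  have ab: "abelian_group ?D"
  proof (rule abelian_groupI)
    show "\<exists>g\<in>carrier ?D. g \<oplus>\<^bsub>?D\<^esub> f = \<zero>\<^bsub>?D\<^esub>" if "f \<in> carrier ?D" for f
      using scale[OF that, of "-1"] by (intro bexI[of _ "\<lambda>x. -1 * f x"]) (auto simp: ops)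
  qed (auto simp: ops zero add fun_eq_iff)
  have "Module.module real_ring ?D"
    by (rule Module.moduleI[OF cring_real_ring ab])
      (auto simp: ops scale real_ring_def fun_eq_iff algebra_simps)
  moreover have le: "dual_norm V N f \<le> C"
    if "\<And>x. x \<in> carrier V \<Longrightarrow> N x \<le> 1 \<Longrightarrow> \<bar>f x\<bar> \<le> C" for f C
    using dual_norm_le[OF V] that by blast
  note ub = abs_le_dual_norm[OF V]
  have nn: "0 \<le> N x" if "x \<in> carrier V" for x
    using normed_space_minus_nonneg(2)[OF V that] .
  have dn: "0 \<le> dual_norm V N f" if f: "f \<in> carrier ?D" for f
  proof (cases "\<exists>x\<in>carrier V. N x \<noteq> 0")
    case True
    then obtain x where x: "x \<in> carrier V" "N x > 0" using nn by force
    then have "0 \<le> dual_norm V N f * N x" using ub[OF f x(1)] by linarith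
    then show ?thesis using x(2) by (simp add: zero_le_mult_iff)
  next
    case False
    then have "carrier V = {\<zero>\<^bsub>V\<^esub>}" "N \<zero>\<^bsub>V\<^esub> = 0" using V by (auto simp: normed_space_def)
    then have "{x \<in> carrier V. N x \<le> 1} = {\<zero>\<^bsub>V\<^esub>}" by auto
    then show ?thesis by (simp add: dual_norm_def)
  qed
  have le1: "\<bar>f x\<bar> \<le> dual_norm V N f" if "f \<in> carrier ?D" "x \<in> carrier V" "N x \<le> 1" for f x
    using ub[OF that(1,2)] mult_left_mono[OF that(3) dn[OF that(1)]] by linarith
  have hom_le: "dual_norm V N (\<lambda>x. a * f x) \<le> \<bar>a\<bar> * dual_norm V N f" if "f \<in> carrier ?D" for a f
    by (rule le) (use le1 that in \<open>auto simp: abs_mult intro: mult_left_mono\<close>)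
  have zero_iff: "dual_norm V N f = 0 \<longleftrightarrow> f = \<zero>\<^bsub>?D\<^esub>" if f: "f \<in> carrier ?D" for f
  proof
    assume "dual_norm V N f = 0"
    then have "f x = 0" for x using ub[OF f, of x] f by (cases "x \<in> carrier V") (auto simp: D)
    then show "f = \<zero>\<^bsub>?D\<^esub>" by (simp add: ops fun_eq_iff)
  next
    assume "f = \<zero>\<^bsub>?D\<^esub>"
    then show "dual_norm V N f = 0" using dn[OF f] le[of f 0] by (simp add: ops)
  qed
  have hom: "dual_norm V N (\<lambda>x. a * f x) = \<bar>a\<bar> * dual_norm V N f" if f: "f \<in> carrier ?D" for a f
  proof (cases "a = 0")
    case True
    then show ?thesis using zero_iff[OF zero] by (simp add: ops)
  next
    case False
    have "dual_norm V N (\<lambda>x. inverse a * (a * f x)) \<le> \<bar>inverse a\<bar> * dual_norm V N (\<lambda>x. a * f x)"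
      by (rule hom_le) (rule scale[OF f])
    then have "\<bar>a\<bar> * dual_norm V N f \<le> dual_norm V N (\<lambda>x. a * f x)"
      using False by (simp add: field_simps)
    then show ?thesis using hom_le[OF f, of a] by simp
  qed
  have "dual_norm V N (\<lambda>x. f x + g x) \<le> dual_norm V N f + dual_norm V N g"
    if "f \<in> carrier ?D" "g \<in> carrier ?D" for f g
    by (rule le) (use le1[OF that(1)] le1[OF that(2)] in \<open>fastforce intro: order_trans[OF abs_triangle_ineq]\<close>)
  ultimately show ?thesis
    using zero_iff hom by (simp add: normed_space_def ops)
qed

lemma evaluation_in_bidual:
  assumes V: "normed_space V N" and x: "x \<in> carrier V"
  shows "evaluation V N x \<in> carrier (dual_space (dual_space V N) (dual_norm V N))"
proof -
  interpret D: Module.module real_ring "dual_space V N"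
    using normed_space_dual[OF V] by (simp add: normed_space_def)
  let ?D = "dual_space V N"
  have cl: "a \<odot>\<^bsub>?D\<^esub> f \<in> carrier ?D" if "f \<in> carrier ?D" for a f
    by (rule D.smult_closed) (use that in \<open>auto simp: real_ring_def\<close>)
  have ops: "f \<oplus>\<^bsub>?D\<^esub> g = (\<lambda>x. f x + g x)" "a \<odot>\<^bsub>?D\<^esub> f = (\<lambda>x. a * f x)" for f g a
    by (simp_all add: dual_space_def)
  have ev: "evaluation V N x f = f x" if "f \<in> carrier ?D" for f
    using that by (simp add: evaluation_def)
  have "\<bar>evaluation V N x f\<bar> \<le> N x * dual_norm V N f" if "f \<in> carrier ?D" for f
    using abs_le_dual_norm[OF V that x] ev[OF that] by (simp add: mult.commute)
  moreover have "evaluation V N x (f \<oplus>\<^bsub>?D\<^esub> g) = evaluation V N x f + evaluation V N x g"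
    if "f \<in> carrier ?D" "g \<in> carrier ?D" for f g
    using ev[OF that(1)] ev[OF that(2)] ev[OF D.M.add.m_closed[OF that]] by (simp add: ops)
  moreover have "evaluation V N x (a \<odot>\<^bsub>?D\<^esub> f) = a * evaluation V N x f"
    if "f \<in> carrier ?D" for a f
    using ev[OF that] ev[OF cl[OF that]] by (simp add: ops)
  moreover have "evaluation V N x f = 0" if "f \<notin> carrier ?D" for f
    using that by (simp add: evaluation_def)
  ultimately show ?thesis
    unfolding dual_space_def[of "dual_space V N"] by auto
qed

text \<open>Every triple of types embeds into a universe closed under countable sequences.\<close>

lemma universe_exists:
  fixes A :: "'a set" and B :: "'b set" and C :: "'c set"
  defines "U \<equiv> UNIV :: (nat \<Rightarrow> 'a + 'b + 'c) set"
  shows "infinite U" "(UNIV :: (nat \<Rightarrow> nat \<Rightarrow> 'a + 'b + 'c) set) \<lesssim> U"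
    "A \<lesssim> U" "B \<lesssim> U" "C \<lesssim> U"
proof -
  define c where "c = (\<lambda>(i :: nat) (n :: nat). if n = i then Inl undefined else Inr (Inl undefined) :: 'a + 'b + 'c)"
  have "inj c" by (auto simp: c_def inj_on_def fun_eq_iff split: if_splits)
  then show "infinite U" unfolding U_def by (metis finite_imageD finite_subset infinite_UNIV_nat subset_UNIV)
  have "inj (\<lambda>(f :: nat \<Rightarrow> nat \<Rightarrow> 'a + 'b + 'c) n. f (fst (prod_decode n)) (snd (prod_decode n)))"
    by (rule injI) (metis (no_types, lifting) ext fst_conv prod_encode_inverse snd_conv)
  then show "(UNIV :: (nat \<Rightarrow> nat \<Rightarrow> 'a + 'b + 'c) set) \<lesssim> U"
    by (auto simp: lepoll_def U_def)
  show "A \<lesssim> U" unfolding lepoll_def U_def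
    by (rule exI[of _ "\<lambda>x _. Inl x"]) (auto simp: inj_on_def fun_eq_iff)
  show "B \<lesssim> U" unfolding lepoll_def U_def
    by (rule exI[of _ "\<lambda>x _. Inr (Inl x)"]) (auto simp: inj_on_def fun_eq_iff)
  show "C \<lesssim> U" unfolding lepoll_def U_def
    by (rule exI[of _ "\<lambda>x _. Inr (Inr x)"]) (auto simp: inj_on_def fun_eq_iff)
qed

end

theory Submission
  imports Defs "HOL-Analysis.Infinite_Sum" "HOL-Analysis.L2_Norm"
begin

text \<open>
  \<^bold>\<open>From the factors to the wreath product.\<close> If \<open>X\<close> is finite, the wreath product is a product of
  finitely many subsets, namely one copy of \<open>G\<close> for each point of \<open>X\<close> and the acting group \<open>H\<close>. A
  product of boundedly many isometries moves a point by at most the sum of their displacements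
  (\<open>displacement_le_sum_lamps\<close>), so an isometric action is bounded as soon as it is bounded on each of
  these subgroups (\<open>bounded_orbits_wreath\<close>). Restricting an action to a subgroup does not change the
  space, so this argument is the same for all four properties.

  \<^bold>\<open>From the wreath product to \<open>H\<close>.\<close> \<open>H\<close> is a quotient, and actions pull back along the
  projection with the same orbits.

  \<^bold>\<open>From the wreath product to \<open>G\<close>.\<close> An action of \<open>G\<close> on a space \<open>V\<close> induces an action of the wreath
  product on functions from \<open>X\<close> to \<open>V\<close> (\<open>wreath_action\<close>): the lamps act pointwise and \<open>H\<close> permutes the
  coordinates. What remains is to choose, in each category, a space of such functions that stays in
  the category and on which the action is isometric: the product with the sum metric for metric
  spaces, the weak power for median graphs (\<open>median_weak_power\<close>), and the square-summable functions
  for normed spaces (\<open>banach_space_L2\<close>, \<open>hilbert_space_L2\<close>, \<open>reflexive_L2\<close>). One lamp moves a constant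
  function exactly as far as it moves its value, so bounded orbits for the wreath product give
  bounded orbits for \<open>G\<close>.

  \<^bold>\<open>Finiteness of \<open>X\<close>.\<close> The last two constructions also make sense for infinite \<open>X\<close>. Switching on
  the same lamp \<open>g\<close> at \<open>k\<close> points moves the base point by \<open>k\<close>, respectively \<open>sqrt k\<close>, times the
  displacement that \<open>g\<close> causes in \<open>V\<close>. So the orbit of the base point is unbounded as soon as some
  element of \<open>G\<close> moves the base point of \<open>V\<close>, and for a non-trivial \<open>G\<close> such a \<open>V\<close> always exists: a star
  whose leaves are the elements of \<open>G\<close> (\<open>graph_action_star\<close>), or the square-summable functions on
  \<open>G\<close> with an affine version of the regular representation (\<open>regular_affine_action\<close>). This settles FW and
  FH. The other two cases follow because Bergman's property implies FW (\<open>bergman_imp_FW\<close>), and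
  \<open>FB\<^sub>r\<close> implies FH since Hilbert spaces are reflexive (\<open>property_FBr_imp_FH\<close>).

  The constructed spaces consist of functions, while the properties speak about subsets of the
  universe \<open>'u\<close>. All these functions are constant off a countable set, hence there are no more of
  them than elements of \<open>'u\<close> (\<open>countable_support_lepoll\<close>), and the structure is moved along an injection.
\<close>

section \<open>Actions and bounded orbits\<close>

lemma group_action_closed:
  assumes "group_action K M \<phi>" "g \<in> carrier K" "x \<in> M"
  shows "\<phi> g x \<in> M"
  using group_action.element_image[OF assms(1,2,3) refl] .

lemma group_action_one:
  assumes "group_action K M \<phi>" "x \<in> M"
  shows "\<phi> \<one>\<^bsub>K\<^esub> x = x"
  using group_action.id_eq_one[OF assms(1)] assms(2) by (metis restrict_apply')

lemma group_action_group: "group_action K M \<phi> \<Longrightarrow> group K"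
  using group_action.group_hom group_hom.axioms(1) by blast

lemma group_action_inv:
  assumes "group_action K M \<phi>" "g \<in> carrier K" "x \<in> M"
  shows "\<phi> (inv\<^bsub>K\<^esub> g) (\<phi> g x) = x" "\<phi> g (\<phi> (inv\<^bsub>K\<^esub> g) x) = x"
proof -
  interpret group K using group_action_group assms(1) by blast
  show "\<phi> (inv\<^bsub>K\<^esub> g) (\<phi> g x) = x" "\<phi> g (\<phi> (inv\<^bsub>K\<^esub> g) x) = x"
    using group_action.composition_rule[OF assms(1) assms(3)] group_action_one[OF assms(1,3)] assms(2)
    by (metis inv_closed l_inv, metis inv_closed r_inv)
qed

lemma group_action_bij:
  assumes "group_action K M \<phi>" "g \<in> carrier K"
  shows "bij_betw (\<phi> g) M M"
  using group_action.bij_prop0[OF assms] by (simp add: Bij_def)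

lemma group_actionI:
  assumes K: "group K"
    and ext: "\<And>g. g \<in> carrier K \<Longrightarrow> \<phi> g \<in> extensional M"
    and cl: "\<And>g x. g \<in> carrier K \<Longrightarrow> x \<in> M \<Longrightarrow> \<phi> g x \<in> M"
    and one: "\<And>x. x \<in> M \<Longrightarrow> \<phi> \<one>\<^bsub>K\<^esub> x = x"
    and mult: "\<And>g h x. g \<in> carrier K \<Longrightarrow> h \<in> carrier K \<Longrightarrow> x \<in> M \<Longrightarrow> \<phi> (g \<otimes>\<^bsub>K\<^esub> h) x = \<phi> g (\<phi> h x)"
  shows "group_action K M \<phi>"
proof -
  interpret group K by (rule K)
  have bij: "\<phi> g \<in> Bij M" if g: "g \<in> carrier K" for g
  proof -
    have "bij_betw (\<phi> g) M M"
      by (rule bij_betw_byWitness[of _ "\<phi> (inv\<^bsub>K\<^esub> g)"])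
        (use g cl one mult[of g "inv\<^bsub>K\<^esub> g"] mult[of "inv\<^bsub>K\<^esub> g" g] in \<open>auto simp: image_subset_iff\<close>)
    then show ?thesis using ext[OF g] by (simp add: Bij_def)
  qed
  show ?thesis
  proof (intro group_action.intro group_hom.intro group_hom_axioms.intro homI)
    show "group K" by (rule K)
    show "group (BijGroup M)" by (rule group_BijGroup)
    show "\<phi> g \<in> carrier (BijGroup M)" if "g \<in> carrier K" for g
      using bij[OF that] by (simp add: BijGroup_def)
    show "\<phi> (g \<otimes>\<^bsub>K\<^esub> h) = \<phi> g \<otimes>\<^bsub>BijGroup M\<^esub> \<phi> h" if gh: "g \<in> carrier K" "h \<in> carrier K" for g h
    proof (rule extensionalityI)
      show "\<phi> (g \<otimes>\<^bsub>K\<^esub> h) \<in> extensional M" using ext gh by blast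
      show "\<phi> g \<otimes>\<^bsub>BijGroup M\<^esub> \<phi> h \<in> extensional M"
        using bij gh by (simp add: BijGroup_def)
      show "\<phi> (g \<otimes>\<^bsub>K\<^esub> h) x = (\<phi> g \<otimes>\<^bsub>BijGroup M\<^esub> \<phi> h) x" if "x \<in> M" for x
        using bij gh that mult by (simp add: BijGroup_def compose_eq)
    qed
  qed
qed

lemma group_action_pullback:
  assumes "group_action K M \<phi>" "group L" "f \<in> hom L K"
  shows "group_action L M (\<lambda>g. \<phi> (f g))"
proof -
  have "group_hom L K f"
    using assms group_action_group by (auto intro!: group_hom.intro group_hom_axioms.intro)
  moreover have "\<phi> \<in> hom K (BijGroup M)"
    using group_action.group_hom[OF assms(1)] by (rule group_hom.homh)
  ultimately show ?thesis
    using hom_compose[OF assms(3), of \<phi>] assms(2) group_BijGroup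
    by (auto intro!: group_action.intro group_hom.intro group_hom_axioms.intro simp: comp_def)
qed

lemma isometric_action_pullback:
  assumes "isometric_action K M d \<phi>" "group L" "f \<in> hom L K"
  shows "isometric_action L M d (\<lambda>g. \<phi> (f g))"
  using assms group_action_pullback[OF _ assms(2,3)]
  unfolding isometric_action_def hom_def by blast

text \<open>Displacement of a single point is all that matters, since an orbit lies in the ball
  around its base point whose radius is the largest displacement.\<close>

lemma bounded_orbits_iff:
  assumes "Metric_space M d" "group_action K M \<phi>"
  shows "bounded_orbits K M d \<phi> \<longleftrightarrow> (\<forall>x\<in>M. \<exists>B. \<forall>g\<in>carrier K. d x (\<phi> g x) \<le> B)"
proof -
  interpret Metric_space M d by fact
  have "mbounded (orbit K \<phi> x) \<longleftrightarrow> (\<exists>B. \<forall>g\<in>carrier K. d x (\<phi> g x) \<le> B)" if x: "x \<in> M" for x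
  proof
    assume "mbounded (orbit K \<phi> x)"
    then obtain B where "\<forall>y\<in>orbit K \<phi> x. \<forall>z\<in>orbit K \<phi> x. d y z \<le> B" by (auto simp: mbounded_alt)
    moreover have "x \<in> orbit K \<phi> x" using group_action.orbit_refl[OF assms(2) x] .
    ultimately show "\<exists>B. \<forall>g\<in>carrier K. d x (\<phi> g x) \<le> B" by (auto simp: orbit_def)
  next
    assume "\<exists>B. \<forall>g\<in>carrier K. d x (\<phi> g x) \<le> B"
    then obtain B where "\<forall>g\<in>carrier K. d x (\<phi> g x) \<le> B" by blast
    then have "orbit K \<phi> x \<subseteq> mcball x B"
      using x group_action_closed[OF assms(2)] by (auto simp: orbit_def)
    then show "mbounded (orbit K \<phi> x)" unfolding mbounded_def by blast
  qed
  then show ?thesis by (simp add: bounded_orbits_def)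
qed

lemma bounded_orbits_surj_pullback:
  assumes "f ` carrier L = carrier K" "bounded_orbits L M d (\<lambda>g. \<phi> (f g))"
  shows "bounded_orbits K M d \<phi>"
proof -
  have "orbit L (\<lambda>g. \<phi> (f g)) x = orbit K \<phi> x" for x
    unfolding orbit_def assms(1)[symmetric] by auto
  then show ?thesis using assms(2) by (simp add: bounded_orbits_def)
qed

section \<open>The wreath product and its action on functions\<close>

text \<open>The formula makes sense for every action of the lamp group on a set of values; each of the
  spaces used below is a set of functions with values in a given space on which this action
  restricts.\<close>

definition wreath_action ::
  "('h, 'b) monoid_scheme \<Rightarrow> 'x set \<Rightarrow> ('h \<Rightarrow> 'x \<Rightarrow> 'x) \<Rightarrow> ('g \<Rightarrow> 'v \<Rightarrow> 'v)
    \<Rightarrow> ('x \<Rightarrow> 'g) \<times> 'h \<Rightarrow> ('x \<Rightarrow> 'v) \<Rightarrow> 'x \<Rightarrow> 'v"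
  where "wreath_action H X \<theta> \<phi> w f = (\<lambda>x\<in>X. \<phi> (fst w x) (f (\<theta> (inv\<^bsub>H\<^esub> (snd w)) x)))"

text \<open>The lamp \<open>g\<close> at the points of \<open>S\<close>, as an element of the direct sum.\<close>

definition lamps :: "('g, 'a) monoid_scheme \<Rightarrow> 'x set \<Rightarrow> 'x set \<Rightarrow> 'g \<Rightarrow> 'x \<Rightarrow> 'g"
  where "lamps G X S g = (\<lambda>x\<in>X. if x \<in> S then g else \<one>\<^bsub>G\<^esub>)"

locale wreath =
  fixes G :: "('g, 'a) monoid_scheme" and H :: "('h, 'b) monoid_scheme"
    and X :: "'x set" and \<theta> :: "'h \<Rightarrow> 'x \<Rightarrow> 'x"
  assumes G: "group G" and H: "group H" and \<theta>: "group_action H X \<theta>"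
begin

abbreviation W where "W \<equiv> wreath_product G H X \<theta>"
abbreviation act where "act \<equiv> wreath_action H X \<theta>"

sublocale G: group G by (rule G)
sublocale H: group H by (rule H)
sublocale W: group W by (rule group_wreath_product[OF G H \<theta>])

lemma theta_closed [simp]: "h \<in> carrier H \<Longrightarrow> x \<in> X \<Longrightarrow> \<theta> h x \<in> X"
  using group_action_closed[OF \<theta>] .

lemma carrier_W:
  "(n, h) \<in> carrier W \<longleftrightarrow>
    n \<in> X \<rightarrow>\<^sub>E carrier G \<and> finite {x \<in> X. n x \<noteq> \<one>\<^bsub>G\<^esub>} \<and> h \<in> carrier H"
  using carrier_sum_group[of X "\<lambda>_. G"] G
  by (auto simp: wreath_product_def semidirect_product_def)

lemma mult_W:
  "(n, h) \<otimes>\<^bsub>W\<^esub> (n', h') =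
    ((\<lambda>x\<in>X. n x \<otimes>\<^bsub>G\<^esub> shift_action H X \<theta> h n' x), h \<otimes>\<^bsub>H\<^esub> h')"
  by (simp add: wreath_product_def semidirect_product_def)

lemma one_W: "\<one>\<^bsub>W\<^esub> = ((\<lambda>x\<in>X. \<one>\<^bsub>G\<^esub>), \<one>\<^bsub>H\<^esub>)"
  by (simp add: wreath_product_def semidirect_product_def)

lemma shift_one:
  assumes "n \<in> extensional X" shows "shift_action H X \<theta> \<one>\<^bsub>H\<^esub> n = n"
  by (rule extensionalityI[of _ X])
    (use assms group_action_one[OF \<theta>] in \<open>auto simp: shift_action_def\<close>)

lemma lamps_in_W:
  assumes "finite S" "g \<in> carrier G"
  shows "(lamps G X S g, \<one>\<^bsub>H\<^esub>) \<in> carrier W"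
  using assms by (auto simp: carrier_W lamps_def elim!: rev_finite_subset)

lemma lamps_hom:
  assumes "finite S"
  shows "(\<lambda>g. (lamps G X S g, \<one>\<^bsub>H\<^esub>)) \<in> hom G W"
proof (rule homI)
  show "(lamps G X S g, \<one>\<^bsub>H\<^esub>) \<in> carrier W" if "g \<in> carrier G" for g
    using lamps_in_W assms that .
  show "(lamps G X S (g \<otimes>\<^bsub>G\<^esub> h), \<one>\<^bsub>H\<^esub>) = (lamps G X S g, \<one>\<^bsub>H\<^esub>) \<otimes>\<^bsub>W\<^esub> (lamps G X S h, \<one>\<^bsub>H\<^esub>)" for g h
    using shift_one[of "lamps G X S h"] by (simp add: mult_W) (auto simp: lamps_def fun_eq_iff)
qed

lemma snd_hom: "snd \<in> hom W H" and snd_surj: "snd ` carrier W = carrier H"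
proof -
  show "snd \<in> hom W H" by (rule homI) (auto simp: carrier_W mult_W)
  have "h \<in> snd ` carrier W" if "h \<in> carrier H" for h
    by (rule image_eqI[of _ _ "(\<lambda>x\<in>X. \<one>\<^bsub>G\<^esub>, h)"]) (use that in \<open>auto simp: carrier_W\<close>)
  then show "snd ` carrier W = carrier H" by (auto simp: carrier_W)
qed

lemma base_hom: "(\<lambda>h. (\<lambda>x\<in>X. \<one>\<^bsub>G\<^esub>, h)) \<in> hom H W"
  by (rule homI) (auto simp: carrier_W mult_W shift_action_def fun_eq_iff)

text \<open>Every element is a product of one lamp at each point of its support and an element of the
  acting group, so its displacement is at most the sum of theirs.\<close>

lemma displacement_le_sum_lamps:
  assumes "Metric_space M d" and A: "isometric_action W M d \<psi>" and X: "finite X" and p: "p \<in> M"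
    and w: "(n, h) \<in> carrier W"
  shows "d p (\<psi> (n, h) p) \<le>
    (\<Sum>x\<in>X. d p (\<psi> (lamps G X {x} (n x), \<one>\<^bsub>H\<^esub>) p)) + d p (\<psi> (\<lambda>x\<in>X. \<one>\<^bsub>G\<^esub>, h) p)"
proof -
  interpret Metric_space M d by fact
  have ga: "group_action W M \<psi>" using A by (simp add: isometric_action_def)
  note cl = group_action_closed[OF ga]
  have step: "d p (\<psi> (v \<otimes>\<^bsub>W\<^esub> w) p) \<le> d p (\<psi> v p) + d p (\<psi> w p)"
    if "v \<in> carrier W" "w \<in> carrier W" for v w
  proof -
    have "d p (\<psi> (v \<otimes>\<^bsub>W\<^esub> w) p) \<le> d p (\<psi> v p) + d (\<psi> v p) (\<psi> v (\<psi> w p))"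
      using triangle[of p "\<psi> v p" "\<psi> v (\<psi> w p)"] that p cl
        group_action.composition_rule[OF ga p that] by simp
    also have "d (\<psi> v p) (\<psi> v (\<psi> w p)) = d p (\<psi> w p)"
      using A that p cl by (simp add: isometric_action_def)
    finally show ?thesis .
  qed
  let ?r = "\<lambda>S. (\<lambda>x\<in>X. if x \<in> S then n x else \<one>\<^bsub>G\<^esub>)"
  have nG: "n x \<in> carrier G" if "x \<in> X" for x using w that by (auto simp: carrier_W)
  have rW: "(?r S, \<one>\<^bsub>H\<^esub>) \<in> carrier W" for S
    using nG X by (auto simp: carrier_W)
  have lW: "(lamps G X {x} (n x), \<one>\<^bsub>H\<^esub>) \<in> carrier W" if "x \<in> X" for x
    by (rule lamps_in_W) (use nG that in auto)
  have hW: "(\<lambda>x\<in>X. \<one>\<^bsub>G\<^esub>, h) \<in> carrier W" using w by (auto simp: carrier_W)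
  have "d p (\<psi> (?r S, \<one>\<^bsub>H\<^esub>) p) \<le> (\<Sum>x\<in>S. d p (\<psi> (lamps G X {x} (n x), \<one>\<^bsub>H\<^esub>) p))"
    if "finite S" "S \<subseteq> X" for S
    using that
  proof (induction S)
    case empty
    have "\<psi> (?r {}, \<one>\<^bsub>H\<^esub>) p = p" using group_action_one[OF ga p] by (simp add: one_W)
    then have "d p (\<psi> (?r {}, \<one>\<^bsub>H\<^esub>) p) = 0" by (simp only: mdist_zero[OF p])
    then show ?case by (simp only: sum.empty)
  next
    case (insert x S)
    have "(?r (insert x S), \<one>\<^bsub>H\<^esub>) = (lamps G X {x} (n x), \<one>\<^bsub>H\<^esub>) \<otimes>\<^bsub>W\<^esub> (?r S, \<one>\<^bsub>H\<^esub>)"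
      using insert nG by (subst mult_W) (auto simp: shift_one lamps_def fun_eq_iff)
    then have "d p (\<psi> (?r (insert x S), \<one>\<^bsub>H\<^esub>) p) \<le>
        d p (\<psi> (lamps G X {x} (n x), \<one>\<^bsub>H\<^esub>) p) + d p (\<psi> (?r S, \<one>\<^bsub>H\<^esub>) p)"
      using step[OF lW rW, of x S] insert.prems by (simp only: insert_subset)
    moreover have "S \<subseteq> X" using insert.prems by simp
    note insert.IH[OF this]
    ultimately show ?case unfolding sum.insert[OF insert.hyps] by linarith
  qed
  from this[OF X subset_refl]
  have "d p (\<psi> (?r X, \<one>\<^bsub>H\<^esub>) p) \<le> (\<Sum>x\<in>X. d p (\<psi> (lamps G X {x} (n x), \<one>\<^bsub>H\<^esub>) p))" .
  moreover have "(n, h) = (?r X, \<one>\<^bsub>H\<^esub>) \<otimes>\<^bsub>W\<^esub> (\<lambda>x\<in>X. \<one>\<^bsub>G\<^esub>, h)"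
    using w by (subst mult_W) (auto simp: shift_one shift_action_def fun_eq_iff carrier_W PiE_iff extensional_def)
  ultimately show ?thesis using step[OF rW hW, of X] by simp
qed

lemma bounded_orbits_wreath:
  assumes M: "Metric_space M d" and A: "isometric_action W M d \<psi>" and X: "finite X"
    and bG: "\<And>x. x \<in> X \<Longrightarrow> bounded_orbits G M d (\<lambda>g. \<psi> (lamps G X {x} g, \<one>\<^bsub>H\<^esub>))"
    and bH: "bounded_orbits H M d (\<lambda>h. \<psi> (\<lambda>x\<in>X. \<one>\<^bsub>G\<^esub>, h))"
  shows "bounded_orbits W M d \<psi>"
proof -
  have ga: "group_action W M \<psi>" using A by (simp add: isometric_action_def)
  have gG: "group_action G M (\<lambda>g. \<psi> (lamps G X {x} g, \<one>\<^bsub>H\<^esub>))" for x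
    by (rule group_action_pullback[OF ga G lamps_hom]) simp
  have gH: "group_action H M (\<lambda>h. \<psi> (\<lambda>x\<in>X. \<one>\<^bsub>G\<^esub>, h))"
    by (rule group_action_pullback[OF ga H base_hom])
  show ?thesis unfolding bounded_orbits_iff[OF M ga]
  proof
    fix p assume p: "p \<in> M"
    have "\<forall>x\<in>X. \<exists>B. \<forall>g\<in>carrier G. d p (\<psi> (lamps G X {x} g, \<one>\<^bsub>H\<^esub>) p) \<le> B"
      using bG p unfolding bounded_orbits_iff[OF M gG] by blast
    then obtain B where B: "\<And>x g. x \<in> X \<Longrightarrow> g \<in> carrier G \<Longrightarrow> d p (\<psi> (lamps G X {x} g, \<one>\<^bsub>H\<^esub>) p) \<le> B x"
      by metis
    obtain C where C: "\<And>h. h \<in> carrier H \<Longrightarrow> d p (\<psi> (\<lambda>x\<in>X. \<one>\<^bsub>G\<^esub>, h) p) \<le> C"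
      using bH p unfolding bounded_orbits_iff[OF M gH] by blast
    have "d p (\<psi> w p) \<le> (\<Sum>x\<in>X. B x) + C" if w: "w \<in> carrier W" for w
    proof -
      obtain n h where nh: "w = (n, h)" by (cases w)
      have "n x \<in> carrier G" if "x \<in> X" for x using w that by (auto simp: carrier_W nh)
      then have "(\<Sum>x\<in>X. d p (\<psi> (lamps G X {x} (n x), \<one>\<^bsub>H\<^esub>) p)) \<le> (\<Sum>x\<in>X. B x)"
        using B by (intro sum_mono) auto
      moreover have "d p (\<psi> (\<lambda>x\<in>X. \<one>\<^bsub>G\<^esub>, h) p) \<le> C" using C w by (auto simp: carrier_W nh)
      ultimately show ?thesis
        using displacement_le_sum_lamps[OF M A X p w[unfolded nh]] by (simp add: nh)
    qed
    then show "\<exists>B. \<forall>w\<in>carrier W. d p (\<psi> w p) \<le> B" by blast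
  qed
qed

lemma act_closed:
  assumes "group_action G V \<phi>" "w \<in> carrier W" "f \<in> X \<rightarrow>\<^sub>E V"
  shows "act \<phi> w f \<in> X \<rightarrow>\<^sub>E V"
  using assms group_action_closed[OF assms(1)]
  by (cases w) (auto simp: wreath_action_def carrier_W PiE_iff)

lemma group_action_wreath:
  assumes \<phi>: "group_action G V \<phi>" and F: "F \<subseteq> X \<rightarrow>\<^sub>E V"
    and inv: "\<And>w f. w \<in> carrier W \<Longrightarrow> f \<in> F \<Longrightarrow> act \<phi> w f \<in> F"
  shows "group_action W F (\<lambda>w. restrict (act \<phi> w) F)"
proof (rule group_actionI)
  show "group W" by (rule W.group_axioms)
  have FX: "f x \<in> V" if "f \<in> F" "x \<in> X" for f x using F that by auto
  have ext: "f \<in> extensional X" if "f \<in> F" for f using F that by (auto simp: PiE_iff)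
  show "restrict (act \<phi> w) F \<in> extensional F" for w by simp
  show "restrict (act \<phi> w) F f \<in> F" if "w \<in> carrier W" "f \<in> F" for w f
    using inv that by simp
  show "restrict (act \<phi> \<one>\<^bsub>W\<^esub>) F f = f" if "f \<in> F" for f
    using that FX[OF that] group_action_one[OF \<phi>] group_action_one[OF \<theta>]
    by (intro extensionalityI[of _ X]) (auto simp: one_W wreath_action_def ext)
  show "restrict (act \<phi> (v \<otimes>\<^bsub>W\<^esub> w)) F f = restrict (act \<phi> v) F (restrict (act \<phi> w) F f)"
    if vw: "v \<in> carrier W" "w \<in> carrier W" and f: "f \<in> F" for v w f
  proof -
    obtain n h n' h' where nh: "v = (n, h)" "w = (n', h')" by (cases v, cases w) auto
    have H': "h \<in> carrier H" "h' \<in> carrier H" and N: "n x \<in> carrier G" "n' x \<in> carrier G" if "x \<in> X" for x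
      using vw that by (auto simp: nh carrier_W)
    have "act \<phi> (v \<otimes>\<^bsub>W\<^esub> w) f x = act \<phi> v (act \<phi> w f) x" if x: "x \<in> X" for x
      using H'[OF x] x N FX[OF f]
      by (simp add: nh mult_W wreath_action_def shift_action_def H.inv_mult_group
        group_action.composition_rule[OF \<theta>] group_action.composition_rule[OF \<phi>])
    then have "act \<phi> (v \<otimes>\<^bsub>W\<^esub> w) f = act \<phi> v (act \<phi> w f)"
      by (auto simp: wreath_action_def fun_eq_iff)
    then show ?thesis using vw f inv by simp
  qed
qed

lemma theta_bij: "h \<in> carrier H \<Longrightarrow> bij_betw (\<theta> (inv\<^bsub>H\<^esub> h)) X X"
  using group_action_bij[OF \<theta>] by simp

text \<open>Besides the permuted support only the finitely many points with a lamp switched on matter. This is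
  what makes the weak power invariant.\<close>

lemma finite_act_neq:
  assumes \<phi>: "group_action G V \<phi>" and w: "w \<in> carrier W" and f: "f \<in> X \<rightarrow>\<^sub>E V" and v: "v \<in> V"
    and fin: "finite {x \<in> X. f x \<noteq> v}"
  shows "finite {x \<in> X. act \<phi> w f x \<noteq> v}"
proof -
  obtain n h where w': "w = (n, h)" by (cases w)
  have h: "h \<in> carrier H" and n: "finite {x \<in> X. n x \<noteq> \<one>\<^bsub>G\<^esub>}" using w by (auto simp: w' carrier_W)
  have "finite (\<theta> (inv\<^bsub>H\<^esub> h) -` {x \<in> X. f x \<noteq> v} \<inter> X)"
    by (rule finite_vimage_IntI) (use fin theta_bij[OF h] in \<open>auto simp: bij_betw_def\<close>)
  moreover have "{x \<in> X. act \<phi> w f x \<noteq> v} \<subseteq>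
      {x \<in> X. n x \<noteq> \<one>\<^bsub>G\<^esub>} \<union> (\<theta> (inv\<^bsub>H\<^esub> h) -` {x \<in> X. f x \<noteq> v} \<inter> X)"
    using group_action_one[OF \<phi> v] h by (auto simp: wreath_action_def w')
  ultimately show ?thesis using n by (meson finite_UnI finite_subset)
qed

text \<open>Lamps switched on at \<open>S\<close> move a constant function at exactly the points of \<open>S\<close>.\<close>

lemma act_lamps_const:
  assumes "group_action G V \<phi>" "v \<in> V" "x \<in> X"
  shows "act \<phi> (lamps G X S g, \<one>\<^bsub>H\<^esub>) (\<lambda>x\<in>X. v) x = (if x \<in> S then \<phi> g v else v)"
  using assms group_action_one[OF assms(1)] by (simp add: wreath_action_def lamps_def)

end

section \<open>Transport of spaces along injections\<close>

definition conj_action :: "('v \<Rightarrow> 'u) \<Rightarrow> 'v set \<Rightarrow> ('k \<Rightarrow> 'v \<Rightarrow> 'v) \<Rightarrow> 'k \<Rightarrow> 'u \<Rightarrow> 'u"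
  where "conj_action f M \<phi> g = (\<lambda>y\<in>f ` M. f (\<phi> g (inv_into M f y)))"

lemma conj_action_image [simp]:
  "inj_on f M \<Longrightarrow> x \<in> M \<Longrightarrow> conj_action f M \<phi> g (f x) = f (\<phi> g x)"
  by (simp add: conj_action_def)

lemma group_action_conj:
  assumes "group_action K M \<phi>" "inj_on f M"
  shows "group_action K (f ` M) (conj_action f M \<phi>)"
proof (rule group_actionI)
  show "conj_action f M \<phi> g \<in> extensional (f ` M)" for g by (simp add: conj_action_def)
qed (use assms group_action_group[OF assms(1)] group_action_closed[OF assms(1)]
    group_action_one[OF assms(1)] group_action.composition_rule[OF assms(1)] in auto)

lemma isometric_action_conj:
  assumes A: "isometric_action K M d \<phi>" and f: "inj_on f M"
    and d': "\<And>x y. x \<in> M \<Longrightarrow> y \<in> M \<Longrightarrow> d' (f x) (f y) = d x y"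
  shows "isometric_action K (f ` M) d' (conj_action f M \<phi>)"
  using A f group_action_conj[OF _ f, of K \<phi>] group_action_closed[of K M \<phi>]
  by (auto simp: isometric_action_def d')

lemma bounded_orbits_conj:
  assumes M: "Metric_space M d" and M': "Metric_space (f ` M) d'"
    and A: "group_action K M \<phi>" and f: "inj_on f M"
    and d': "\<And>x y. x \<in> M \<Longrightarrow> y \<in> M \<Longrightarrow> d' (f x) (f y) = d x y"
    and b: "bounded_orbits K (f ` M) d' (conj_action f M \<phi>)"
  shows "bounded_orbits K M d \<phi>"
  using b f d' group_action_closed[OF A]
  unfolding bounded_orbits_iff[OF M A] bounded_orbits_iff[OF M' group_action_conj[OF A f]]
  by simp

text \<open>Closure of the universe under countable sequences makes room for the function spaces: a function that agrees with
  a constant off a countable set is determined by the sequence of the points of this set and of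
  its values there. Adding a point of \<open>X\<close> to the set makes it non-empty, hence enumerable.\<close>

lemma countable_support_lepoll:
  fixes V :: "'v set" and X :: "'x set"
  assumes seq: "(UNIV :: (nat \<Rightarrow> 'u) set) \<lesssim> (UNIV :: 'u set)"
    and V: "V \<lesssim> (UNIV :: 'u set)" and X: "X \<lesssim> (UNIV :: 'u set)"
  shows "{f \<in> X \<rightarrow>\<^sub>E V. countable {x \<in> X. f x \<noteq> v}} \<lesssim> (UNIV :: 'u set)"
proof (cases "X = {}")
  case True
  have "{f \<in> X \<rightarrow>\<^sub>E V. countable {x \<in> X. f x \<noteq> v}} \<lesssim> {undefined :: 'u}"
    unfolding lepoll_def by (rule exI[of _ "\<lambda>_. undefined"]) (auto simp: True)
  then show ?thesis using lepoll_trans subset_imp_lepoll subset_UNIV by blast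
next
  case False
  then obtain x0 where x0: "x0 \<in> X" by blast
  obtain eV :: "'v \<Rightarrow> 'u" where eV: "inj_on eV V" using V by (auto simp: lepoll_def)
  obtain eX :: "'x \<Rightarrow> 'u" where eX: "inj_on eX X" using X by (auto simp: lepoll_def)
  let ?T = "\<lambda>f. insert x0 {x \<in> X. f x \<noteq> v}"
  define s where "s f n = from_nat_into (?T f) n" for f :: "'x \<Rightarrow> 'v" and n
  define c where "c f n = (if even n then eX (s f (n div 2)) else eV (f (s f (n div 2))))"
    for f :: "'x \<Rightarrow> 'v" and n
  have "inj_on c {f \<in> X \<rightarrow>\<^sub>E V. countable {x \<in> X. f x \<noteq> v}}"
  proof (rule inj_onI; clarify)
    fix f g assume f: "f \<in> X \<rightarrow>\<^sub>E V" "countable {x \<in> X. f x \<noteq> v}"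
      and g: "g \<in> X \<rightarrow>\<^sub>E V" "countable {x \<in> X. g x \<noteq> v}" and eq: "c f = c g"
    have r: "range (s f) = ?T f" "range (s g) = ?T g"
      using f g unfolding s_def by (simp_all add: range_from_nat_into)
    have sX: "s f n \<in> X" "s g n \<in> X" for n
      using r x0 by (metis (no_types, lifting) insertE mem_Collect_eq rangeI)+
    have s: "s f n = s g n" for n
      using fun_cong[OF eq, of "2 * n"] sX eX by (simp add: c_def inj_on_eq_iff)
    have v: "f (s f n) = g (s f n)" for n
    proof -
      have "eV (f (s f n)) = eV (g (s f n))"
        using fun_cong[OF eq, of "2 * n + 1"] by (simp add: c_def s[symmetric])
      then show ?thesis using inj_onD[OF eV] PiE_mem[OF f(1) sX(1)] PiE_mem[OF g(1) sX(1)] by blast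
    qed
    have "f x = g x" if x: "x \<in> X" for x
    proof (cases "x \<in> range (s f)")
      case True
      then show ?thesis using v by auto
    next
      case False
      moreover then have "x \<notin> range (s g)" using s by auto
      ultimately show ?thesis using r x by auto
    qed
    then show "f = g" using f(1) g(1) by (rule PiE_ext[rotated 2])
  qed
  then have "{f \<in> X \<rightarrow>\<^sub>E V. countable {x \<in> X. f x \<noteq> v}} \<lesssim> (UNIV :: (nat \<Rightarrow> 'u) set)"
    by (auto simp: lepoll_def)
  then show ?thesis using seq by (rule lepoll_trans)
qed

section \<open>Shortest-path metrics\<close>

lemma walks_Cons:
  assumes "(u, v) \<in> E" "u \<in> V" "p \<in> walks V E v w"
  shows "u # p \<in> walks V E u w"
  using assms by (cases p) (auto simp: walks_def)

lemma graph_dist_le: "p \<in> walks V E u v \<Longrightarrow> length p = Suc n \<Longrightarrow> graph_dist V E u v \<le> n"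
  unfolding graph_dist_def by (rule Least_le) blast

lemma shortest_walk:
  assumes "walks V E u v \<noteq> {}"
  obtains p where "p \<in> walks V E u v" "length p = Suc (graph_dist V E u v)"
proof -
  obtain p where "p \<in> walks V E u v" using assms by blast
  moreover then have "length p = Suc (length p - 1)" by (cases p) (auto simp: walks_def)
  ultimately have "\<exists>n. \<exists>p\<in>walks V E u v. length p = Suc n" by blast
  then have "\<exists>p\<in>walks V E u v. length p = Suc (graph_dist V E u v)"
    unfolding graph_dist_def by (rule LeastI_ex)
  then show thesis using that by blast
qed

text \<open>The shortest-path metric is the only one that is \<open>1\<close>-Lipschitz along edges and decreases
  along some edge towards any other vertex. This criterion gives the distance in each of the
  graphs below without handling walks.\<close>

lemma graph_dist_eqI:
  fixes D :: "'u \<Rightarrow> 'u \<Rightarrow> nat"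
  assumes E: "E \<subseteq> V \<times> V"
    and zero: "\<And>u v. u \<in> V \<Longrightarrow> v \<in> V \<Longrightarrow> D u v = 0 \<longleftrightarrow> u = v"
    and lip: "\<And>u v w. (u, v) \<in> E \<Longrightarrow> w \<in> V \<Longrightarrow> D u w \<le> Suc (D v w)"
    and desc: "\<And>u w n. u \<in> V \<Longrightarrow> w \<in> V \<Longrightarrow> D u w = Suc n \<Longrightarrow> \<exists>v. (u, v) \<in> E \<and> D v w = n"
    and u: "u \<in> V" and w: "w \<in> V"
  shows "walks V E u w \<noteq> {}" "graph_dist V E u w = D u w"
proof -
  have "\<exists>p\<in>walks V E u w. length p = Suc (D u w)" using u
  proof (induction "D u w" arbitrary: u)
    case 0
    then have "[u] \<in> walks V E u w" using zero[OF 0(2) w] by (simp add: walks_def)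
    moreover have "length [u] = Suc (D u w)" using 0(1) by simp
    ultimately show ?case by blast
  next
    case (Suc n)
    obtain v where v: "(u, v) \<in> E" "D v w = n" using desc[OF Suc(3) w] Suc(2) by metis
    then obtain p where "p \<in> walks V E v w" "length p = Suc n" using Suc(1)[of v] E by auto
    then show ?case using walks_Cons[OF v(1) Suc(3)] Suc(2)
      by (intro bexI[of _ "u # p"]) auto
  qed
  then obtain p where p: "p \<in> walks V E u w" "length p = Suc (D u w)" by blast
  then show ne: "walks V E u w \<noteq> {}" by blast
  have le: "D u w \<le> n" if "q \<in> walks V E u w" "length q = Suc n" for q n u
    using that
  proof (induction n arbitrary: u q)
    case 0
    then have "u = w" by (auto simp: length_Suc_conv walks_def)
    then show ?case using zero[OF w w] by simp
  next
    case (Suc n)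
    then obtain a b r where q: "q = a # b # r" by (auto simp: length_Suc_conv)
    then have "a = u" "(u, b) \<in> E" "b # r \<in> walks V E b w"
      using Suc(2) by (auto simp: walks_def)
    then show ?case using Suc(1)[of "b # r" b] Suc(3) lip[of u b w] w q by fastforce
  qed
  obtain q where q: "q \<in> walks V E u w" "length q = Suc (graph_dist V E u w)"
    using shortest_walk[OF ne] .
  show "graph_dist V E u w = D u w"
    using le[OF q] graph_dist_le[OF p] by simp
qed

locale conn_graph =
  fixes V :: "'v set" and E
  assumes conn: "connected_graph V E"
begin

abbreviation D where "D \<equiv> graph_dist V E"

sublocale Metric_space V "\<lambda>u v. real (D u v)"
  by (rule Metric_space_graph_dist[OF conn])

lemma E_sub: "E \<subseteq> V \<times> V" and E_sym: "(u, v) \<in> E \<Longrightarrow> (v, u) \<in> E" and E_irrefl: "(u, u) \<notin> E"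
  using conn by (auto simp: connected_graph_def simple_graph_def sym_def irrefl_def)

lemma walks_ne: "u \<in> V \<Longrightarrow> v \<in> V \<Longrightarrow> walks V E u v \<noteq> {}"
  using conn by (simp add: connected_graph_def)

lemma D_zero: "u \<in> V \<Longrightarrow> v \<in> V \<Longrightarrow> D u v = 0 \<longleftrightarrow> u = v" using zero by simp

lemma D_triangle: "u \<in> V \<Longrightarrow> v \<in> V \<Longrightarrow> w \<in> V \<Longrightarrow> D u w \<le> D u v + D v w"
  using triangle[of u v w] by linarith

lemma D_edge: "(u, v) \<in> E \<Longrightarrow> D u v \<le> 1"
  using graph_dist_le[of "[u, v]" V E u v 1] E_sub by (auto simp: walks_def)

lemma D_lip: "(u, v) \<in> E \<Longrightarrow> w \<in> V \<Longrightarrow> D u w \<le> Suc (D v w)"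
  using D_edge[of u v] D_triangle[of u v w] E_sub by fastforce

lemma D_desc:
  assumes "u \<in> V" "w \<in> V" "D u w = Suc n"
  shows "\<exists>v. (u, v) \<in> E \<and> D v w = n"
proof -
  obtain p where p: "p \<in> walks V E u w" "length p = Suc (Suc n)"
    using shortest_walk[OF walks_ne[OF assms(1,2)]] assms(3) by metis
  then obtain a b r where q: "p = a # b # r" by (auto simp: length_Suc_conv)
  then have e: "(u, b) \<in> E" "b # r \<in> walks V E b w" using p by (auto simp: walks_def)
  then have "D b w \<le> n" using graph_dist_le[of "b # r" V E b w n] p q by simp
  moreover have "Suc n \<le> Suc (D b w)" using D_lip[OF e(1) assms(2)] assms(3) by simp
  ultimately show ?thesis using e by auto
qed

text \<open>Cutting a shortest path at a vertex, respectively concatenating two shortest paths, turns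
  membership in an interval into equality in the triangle inequality.\<close>

lemma interval_iff:
  assumes u: "u \<in> V" and v: "v \<in> V"
  shows "x \<in> graph_interval V E u v \<longleftrightarrow> x \<in> V \<and> D u x + D x v = D u v"
proof
  assume "x \<in> graph_interval V E u v"
  then obtain p where p: "p \<in> walks V E u v" "length p = Suc (D u v)" and x: "x \<in> set p"
    by (auto simp: graph_interval_def shortest_paths_def)
  then have xV: "x \<in> V" by (auto simp: walks_def)
  obtain ys zs where yz: "p = ys @ x # zs" using x by (auto simp: in_set_conv_decomp)
  have "ys @ [x] \<in> walks V E u x" "x # zs \<in> walks V E x v"
    using p(1) by (simp_all add: yz walks_def successively_append_iff hd_append split: if_splits)
  then have "D u x \<le> length ys" "D x v \<le> length zs"
    by (auto intro: graph_dist_le)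
  moreover have "D u v = length ys + length zs" using p yz by simp
  ultimately show "x \<in> V \<and> D u x + D x v = D u v" using D_triangle[OF u xV v] xV by simp
next
  assume x: "x \<in> V \<and> D u x + D x v = D u v"
  obtain p where p: "p \<in> walks V E u x" "length p = Suc (D u x)"
    using shortest_walk[OF walks_ne] u x by blast
  obtain q where q: "q \<in> walks V E x v" "length q = Suc (D x v)"
    using shortest_walk[OF walks_ne] v x by blast
  obtain q' where q': "q = x # q'" using q by (cases q) (auto simp: walks_def)
  have "p @ q' \<in> walks V E u v"
    using p q unfolding walks_def q' by (cases q') (auto simp: successively_append_iff)
  moreover have "length (p @ q') = Suc (D u v)" using p q q' x by simp
  moreover have "x \<in> set (p @ q')" using p by (auto simp: walks_def)
  ultimately show "x \<in> graph_interval V E u v"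
    unfolding graph_interval_def shortest_paths_def by blast
qed

end

text \<open>Equality in the triangle inequality replaces membership in the three intervals.\<close>

definition is_median :: "('u \<Rightarrow> 'u \<Rightarrow> nat) \<Rightarrow> 'u \<Rightarrow> 'u \<Rightarrow> 'u \<Rightarrow> 'u \<Rightarrow> bool"
  where "is_median D u v w m \<longleftrightarrow>
    D u m + D m v = D u v \<and> D v m + D m w = D v w \<and> D u m + D m w = D u w"

lemma median_graph_iff:
  "median_graph V E \<longleftrightarrow> connected_graph V E \<and>
    (\<forall>u\<in>V. \<forall>v\<in>V. \<forall>w\<in>V. \<exists>!m. m \<in> V \<and> is_median (graph_dist V E) u v w m)"
proof (cases "connected_graph V E")
  case True
  then interpret conn_graph V E by unfold_locales
  have "m \<in> graph_interval V E u v \<inter> graph_interval V E v w \<inter> graph_interval V E u w \<longleftrightarrow>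
      m \<in> V \<and> is_median D u v w m" if "u \<in> V" "v \<in> V" "w \<in> V" for u v w m
    using that by (auto simp: interval_iff is_median_def)
  then show ?thesis using True by (simp add: median_graph_def)
qed (simp add: median_graph_def)

text \<open>With the distance known from \<open>graph_dist_eqI\<close>, intervals and hence medians depend on it alone.\<close>

lemma median_graphI:
  fixes D :: "'u \<Rightarrow> 'u \<Rightarrow> nat"
  assumes "simple_graph V E" "V \<noteq> {}"
    and zero: "\<And>u v. u \<in> V \<Longrightarrow> v \<in> V \<Longrightarrow> D u v = 0 \<longleftrightarrow> u = v"
    and lip: "\<And>u v w. (u, v) \<in> E \<Longrightarrow> w \<in> V \<Longrightarrow> D u w \<le> Suc (D v w)"
    and desc: "\<And>u w n. u \<in> V \<Longrightarrow> w \<in> V \<Longrightarrow> D u w = Suc n \<Longrightarrow> \<exists>v. (u, v) \<in> E \<and> D v w = n"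
    and med: "\<And>u v w. u \<in> V \<Longrightarrow> v \<in> V \<Longrightarrow> w \<in> V \<Longrightarrow> \<exists>!m. m \<in> V \<and> is_median D u v w m"
  shows "median_graph V E" "\<And>u v. u \<in> V \<Longrightarrow> v \<in> V \<Longrightarrow> graph_dist V E u v = D u v"
proof -
  have E: "E \<subseteq> V \<times> V" using assms(1) by (simp add: simple_graph_def)
  note * = graph_dist_eqI[where D = D, OF E zero lip desc]
  show D: "graph_dist V E u v = D u v" if "u \<in> V" "v \<in> V" for u v
    by (rule *(2)) (use that in simp_all)
  have "walks V E u v \<noteq> {}" if "u \<in> V" "v \<in> V" for u v
    by (rule *(1)) (use that in simp_all)
  then have "connected_graph V E"
    using assms(1,2) by (simp add: connected_graph_def)
  moreover have "\<exists>!m. m \<in> V \<and> is_median (graph_dist V E) u v w m"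
    if "u \<in> V" "v \<in> V" "w \<in> V" for u v w
    using med[OF that] that by (simp add: is_median_def D cong: conj_cong)
  ultimately show "median_graph V E" by (simp add: median_graph_iff)
qed

text \<open>The pulled-back distance satisfies the characterisation of the shortest-path metric.\<close>

lemma graph_action_isometric:
  assumes C: "connected_graph V E" and A: "graph_action K V E \<phi>"
  shows "isometric_action K V (\<lambda>u v. real (graph_dist V E u v)) \<phi>"
proof -
  interpret conn_graph V E using C by unfold_locales
  have ga: "group_action K V \<phi>"
    and adj: "\<And>g u v. g \<in> carrier K \<Longrightarrow> u \<in> V \<Longrightarrow> v \<in> V \<Longrightarrow> (\<phi> g u, \<phi> g v) \<in> E \<longleftrightarrow> (u, v) \<in> E"
    using A by (auto simp: graph_action_def)
  note cl = group_action_closed[OF ga]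
  have "D u v = D (\<phi> g u) (\<phi> g v)" if g: "g \<in> carrier K" and uv: "u \<in> V" "v \<in> V" for g u v
  proof (rule graph_dist_eqI(2)[of E V "\<lambda>u v. D (\<phi> g u) (\<phi> g v)", OF E_sub _ _ _ uv])
    show "D (\<phi> g u) (\<phi> g v) = 0 \<longleftrightarrow> u = v" if "u \<in> V" "v \<in> V" for u v
      using that D_zero cl[OF g] group_action.inj_prop[OF ga g] by (simp add: inj_on_eq_iff)
    show "D (\<phi> g u) (\<phi> g w) \<le> Suc (D (\<phi> g v) (\<phi> g w))" if "(u, v) \<in> E" "w \<in> V" for u v w
      using D_lip[of "\<phi> g u" "\<phi> g v"] adj[OF g, of u v] that E_sub cl[OF g] by blast
    show "\<exists>v. (u, v) \<in> E \<and> D (\<phi> g v) (\<phi> g w) = n"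
      if uw: "u \<in> V" "w \<in> V" and d: "D (\<phi> g u) (\<phi> g w) = Suc n" for u w n
    proof -
      obtain v where v: "(\<phi> g u, v) \<in> E" "D v (\<phi> g w) = n"
        using D_desc[OF _ _ d] uw cl[OF g] by blast
      moreover obtain v' where "v' \<in> V" "v = \<phi> g v'"
        using group_action.surj_prop[OF ga g] v(1) E_sub by blast
      ultimately show ?thesis using adj[OF g] uw by blast
    qed
  qed
  then show ?thesis using ga by (simp add: isometric_action_def)
qed

lemma graph_actionI:
  assumes ga: "group_action K V \<phi>"
    and adj: "\<And>g u v. g \<in> carrier K \<Longrightarrow> u \<in> V \<Longrightarrow> v \<in> V \<Longrightarrow> (u, v) \<in> E \<Longrightarrow> (\<phi> g u, \<phi> g v) \<in> E"
  shows "graph_action K V E \<phi>"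
proof -
  interpret K: group K using group_action_group[OF ga] .
  have "(u, v) \<in> E" if g: "g \<in> carrier K" and uv: "u \<in> V" "v \<in> V" and e: "(\<phi> g u, \<phi> g v) \<in> E" for g u v
    using adj[OF K.inv_closed[OF g] _ _ e] group_action_closed[OF ga g] group_action_inv(1)[OF ga g] uv
    by simp
  then show ?thesis using ga adj by (auto simp: graph_action_def)
qed

text \<open>Moving edges, distances and the action along an injection into \<open>'u\<close> extends the reach of FW to
  graphs whose vertices are functions or options.\<close>

lemma property_FW_transfer:
  fixes V :: "'v set"
  assumes FW: "property_FW TYPE('u) K" and V: "V \<lesssim> (UNIV :: 'u set)"
    and med: "median_graph V E" and A: "graph_action K V E \<phi>"
  shows "bounded_orbits K V (\<lambda>u v. real (graph_dist V E u v)) \<phi>"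
proof -
  obtain f :: "'v \<Rightarrow> 'u" where f: "inj_on f V" using V by (auto simp: lepoll_def)
  have C: "connected_graph V E" using med by (simp add: median_graph_iff)
  interpret conn_graph V E using C by unfold_locales
  let ?V = "f ` V" and ?E = "map_prod f f ` E" and ?i = "inv_into V f"
  let ?D = "\<lambda>a b. D (?i a) (?i b)"
  have E': "(a, b) \<in> ?E \<longleftrightarrow> a \<in> ?V \<and> b \<in> ?V \<and> (?i a, ?i b) \<in> E" for a b
    using E_sub f by (force simp: image_iff)
  have m: "\<exists>!m. m \<in> V \<and> is_median D u v w m" if "u \<in> V" "v \<in> V" "w \<in> V" for u v w
    using med that by (simp add: median_graph_iff)
  have med': "median_graph ?V ?E" and D': "\<And>a b. a \<in> ?V \<Longrightarrow> b \<in> ?V \<Longrightarrow> graph_dist ?V ?E a b = ?D a b"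
  proof -
    have 1: "simple_graph ?V ?E"
      unfolding simple_graph_def sym_def irrefl_def using E' E_sym E_irrefl by (meson SigmaI subrelI)
    have 2: "?V \<noteq> {}" using C by (auto simp: connected_graph_def)
    have 3: "?D a b = 0 \<longleftrightarrow> a = b" if "a \<in> ?V" "b \<in> ?V" for a b
      using that f D_zero by auto
    have 4: "?D a c \<le> Suc (?D b c)" if "(a, b) \<in> ?E" "c \<in> ?V" for a b c
      using that D_lip inv_into_into[of _ f V] unfolding E' by blast
    have 5: "\<exists>b. (a, b) \<in> ?E \<and> ?D b c = n" if ac: "a \<in> ?V" "c \<in> ?V" "?D a c = Suc n" for a c n
    proof -
      obtain v where v: "(?i a, v) \<in> E" "D v (?i c) = n"
        using D_desc[OF _ _ ac(3)] ac inv_into_into[of _ f V] by blast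
      then have "v \<in> V" using E_sub by blast
      then show ?thesis using v ac f E' by (intro exI[of _ "f v"]) auto
    qed
    have 6: "\<exists>!m. m \<in> ?V \<and> is_median ?D a b c m" if V': "a \<in> ?V" "b \<in> ?V" "c \<in> ?V" for a b c
    proof -
      obtain u v w where abc: "a = f u" "b = f v" "c = f w" "u \<in> V" "v \<in> V" "w \<in> V" using V' by blast
      have "is_median ?D a b c (f m) \<longleftrightarrow> is_median D u v w m" if "m \<in> V" for m
        using that abc f by (simp add: is_median_def)
      then show ?thesis using m[OF abc(4-6)] by blast
    qed
    show "median_graph ?V ?E" by (rule median_graphI(1)[where D = ?D]; fact)
    show "graph_dist ?V ?E a b = ?D a b" if "a \<in> ?V" "b \<in> ?V" for a b
      by (rule median_graphI(2)[where D = ?D]; fact)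
  qed
  have ga: "group_action K V \<phi>" using A by (simp add: graph_action_def)
  have "graph_action K ?V ?E (conj_action f V \<phi>)"
    using A f group_action_closed[OF ga] group_action_conj[OF ga f]
    by (auto simp: graph_action_def E' simp del: map_prod_imageI)
  then have "bounded_orbits K ?V (\<lambda>u v. real (graph_dist ?V ?E u v)) (conj_action f V \<phi>)"
    using FW med' by (simp add: property_FW_def)
  moreover have "Metric_space ?V (\<lambda>u v. real (graph_dist ?V ?E u v))"
    using med' by (intro Metric_space_graph_dist) (simp add: median_graph_iff)
  ultimately show ?thesis
    by (intro bounded_orbits_conj[OF Metric_space_axioms _ ga f]) (use D' f in auto)
qed

section \<open>Weak powers of median graphs\<close>

text \<open>A weak power consists of the functions that differ from a constant at finitely many points.
  The graph on it changes one coordinate at a time, along an edge of the factor; intervals and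
  medians are then computed coordinatewise.\<close>

definition weak_power :: "'x set \<Rightarrow> 'v set \<Rightarrow> 'v \<Rightarrow> ('x \<Rightarrow> 'v) set"
  where "weak_power X V v = {f \<in> X \<rightarrow>\<^sub>E V. finite {x \<in> X. f x \<noteq> v}}"

definition weak_power_edges ::
  "'x set \<Rightarrow> 'v set \<Rightarrow> ('v \<times> 'v) set \<Rightarrow> 'v \<Rightarrow> (('x \<Rightarrow> 'v) \<times> ('x \<Rightarrow> 'v)) set"
  where "weak_power_edges X V E v =
    {(f, g). f \<in> weak_power X V v \<and> g \<in> weak_power X V v \<and>
      (\<exists>x\<in>X. (f x, g x) \<in> E \<and> (\<forall>y\<in>X - {x}. f y = g y))}"

text \<open>Summing over the points of difference keeps the sum finite when \<open>X\<close> is infinite.\<close>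

definition sum_dist :: "'x set \<Rightarrow> ('v \<Rightarrow> 'v \<Rightarrow> 'n::comm_monoid_add) \<Rightarrow> ('x \<Rightarrow> 'v) \<Rightarrow> ('x \<Rightarrow> 'v) \<Rightarrow> 'n"
  where "sum_dist X d f g = (\<Sum>x\<in>{x \<in> X. f x \<noteq> g x}. d (f x) (g x))"

lemma sum_dist_eq:
  assumes "\<And>x. x \<in> X \<Longrightarrow> d (f x) (f x) = 0" "finite S" "{x \<in> X. f x \<noteq> g x} \<subseteq> S" "S \<subseteq> X"
  shows "sum_dist X d f g = (\<Sum>x\<in>S. d (f x) (g x))"
  unfolding sum_dist_def
  by (rule sum.mono_neutral_left) (use assms in \<open>auto\<close>, metis assms(1) subsetD)

lemma weak_power_lepoll:
  assumes "(UNIV :: (nat \<Rightarrow> 'u) set) \<lesssim> (UNIV :: 'u set)"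
    and "V \<lesssim> (UNIV :: 'u set)" "X \<lesssim> (UNIV :: 'u set)"
  shows "weak_power X V v \<lesssim> (UNIV :: 'u set)"
  using countable_support_lepoll[OF assms, of v]
  by (rule lepoll_trans[OF subset_imp_lepoll, rotated]) (auto simp: weak_power_def countable_finite)

context conn_graph
begin

context
  fixes X :: "'x set" and v :: 'v
  assumes v: "v \<in> V"
begin

abbreviation "P \<equiv> weak_power X V v"
abbreviation "EP \<equiv> weak_power_edges X V E v"
abbreviation "DP \<equiv> sum_dist X D"

lemma P_mem: "f \<in> P \<Longrightarrow> x \<in> X \<Longrightarrow> f x \<in> V" by (auto simp: weak_power_def)

lemma P_ext: "f \<in> P \<Longrightarrow> g \<in> P \<Longrightarrow> (\<And>x. x \<in> X \<Longrightarrow> f x = g x) \<Longrightarrow> f = g"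
  by (auto simp: weak_power_def intro: PiE_ext)

lemma P_upd:
  assumes "f \<in> P" "x \<in> X" "a \<in> V" shows "f(x := a) \<in> P"
proof -
  have "finite (insert x {y \<in> X. f y \<noteq> v})" using assms by (simp add: weak_power_def)
  then have "finite {y \<in> X. (f(x := a)) y \<noteq> v}" by (rule rev_finite_subset) auto
  then show ?thesis using assms by (auto simp: weak_power_def PiE_iff extensional_def)
qed

lemma DP_eq:
  assumes "f \<in> P" "finite S" "{x \<in> X. f x \<noteq> g x} \<subseteq> S" "S \<subseteq> X"
  shows "DP f g = (\<Sum>x\<in>S. D (f x) (g x))"
  by (rule sum_dist_eq) (use assms P_mem D_zero in auto)

text \<open>A common finite support turns the distances between several elements into sums over one set,
  which can be added and compared term by term.\<close>

lemma P_finite: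
  assumes "F \<subseteq> P" "finite F"
  obtains S where "finite S" "S \<subseteq> X" "\<And>f x. f \<in> F \<Longrightarrow> x \<in> X \<Longrightarrow> x \<notin> S \<Longrightarrow> f x = v"
proof -
  have "finite (\<Union>f\<in>F. {x \<in> X. f x \<noteq> v})" using assms by (auto simp: weak_power_def)
  then show thesis by (rule that) auto
qed

lemma DP_common:
  assumes "F \<subseteq> P" "finite F"
  obtains S where "finite S" "S \<subseteq> X" "\<And>f x. f \<in> F \<Longrightarrow> x \<in> X \<Longrightarrow> x \<notin> S \<Longrightarrow> f x = v"
    "\<And>f g. f \<in> F \<Longrightarrow> g \<in> F \<Longrightarrow> DP f g = (\<Sum>x\<in>S. D (f x) (g x))"
proof -
  obtain S where S: "finite S" "S \<subseteq> X" and *: "\<And>f x. f \<in> F \<Longrightarrow> x \<in> X \<Longrightarrow> x \<notin> S \<Longrightarrow> f x = v"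
    using P_finite[OF assms] by blast
  have "DP f g = (\<Sum>x\<in>S. D (f x) (g x))" if "f \<in> F" "g \<in> F" for f g
    using S assms * that by (intro DP_eq) (auto, metis)
  then show thesis using that S * by blast
qed

text \<open>The triangle inequality holds in each coordinate, so equality of the sums forces equality in every
  coordinate: intervals are products of intervals.\<close>

lemma DP_between:
  assumes "f \<in> P" "g \<in> P" "m \<in> P"
  shows "DP f m + DP m g = DP f g \<longleftrightarrow> (\<forall>x\<in>X. D (f x) (m x) + D (m x) (g x) = D (f x) (g x))"
proof -
  obtain S where S: "finite S" "S \<subseteq> X" "\<And>h x. h \<in> {f, g, m} \<Longrightarrow> x \<in> X \<Longrightarrow> x \<notin> S \<Longrightarrow> h x = v"
    and DP: "\<And>f' g'. f' \<in> {f, g, m} \<Longrightarrow> g' \<in> {f, g, m} \<Longrightarrow> DP f' g' = (\<Sum>x\<in>S. D (f' x) (g' x))"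
    by (rule DP_common[of "{f, g, m}"]) (use assms in simp_all)
  have le: "D (f x) (g x) \<le> D (f x) (m x) + D (m x) (g x)" if "x \<in> S" for x
    using D_triangle P_mem assms S(2) that by blast
  have out: "D (f x) (m x) + D (m x) (g x) = D (f x) (g x)" if "x \<in> X" "x \<notin> S" for x
    using S(3)[OF _ that, of f] S(3)[OF _ that, of g] S(3)[OF _ that, of m] D_zero[OF v v] by simp
  have "DP f m + DP m g = DP f g \<longleftrightarrow>
      (\<Sum>x\<in>S. D (f x) (m x) + D (m x) (g x)) = (\<Sum>x\<in>S. D (f x) (g x))"
    by (simp add: DP sum.distrib)
  also have "\<dots> \<longleftrightarrow> (\<forall>x\<in>S. D (f x) (m x) + D (m x) (g x) = D (f x) (g x))"
  proof
    assume eq: "(\<Sum>x\<in>S. D (f x) (m x) + D (m x) (g x)) = (\<Sum>x\<in>S. D (f x) (g x))"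
    show "\<forall>x\<in>S. D (f x) (m x) + D (m x) (g x) = D (f x) (g x)"
      using sum_mono_inv[OF eq[symmetric] le _ S(1)] by simp
  qed simp
  also have "\<dots> \<longleftrightarrow> (\<forall>x\<in>X. D (f x) (m x) + D (m x) (g x) = D (f x) (g x))"
    using out S(2) by blast
  finally show ?thesis .
qed

text \<open>The coordinatewise median is again finitely supported, since the median of three equal vertices is
  that vertex.\<close>

lemma median_weak_power:
  assumes med: "median_graph V E"
  shows "median_graph P EP" "\<And>f g. f \<in> P \<Longrightarrow> g \<in> P \<Longrightarrow> graph_dist P EP f g = DP f g"
proof -
  have m: "\<exists>!m. m \<in> V \<and> is_median D a b c m" if "a \<in> V" "b \<in> V" "c \<in> V" for a b c
    using med that by (simp add: median_graph_iff)
  have 1: "simple_graph P EP"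
    using E_sym E_irrefl by (auto simp: simple_graph_def weak_power_edges_def sym_def irrefl_def) metis
  have "(\<lambda>x\<in>X. v) \<in> P" using v by (simp add: weak_power_def)
  then have 2: "P \<noteq> {}" by blast
  have 3: "DP f g = 0 \<longleftrightarrow> f = g" if fg: "f \<in> P" "g \<in> P" for f g
  proof -
    obtain S where S: "finite S" "S \<subseteq> X" "\<And>h x. h \<in> {f, g} \<Longrightarrow> x \<in> X \<Longrightarrow> x \<notin> S \<Longrightarrow> h x = v"
      and DP': "\<And>f' g'. f' \<in> {f, g} \<Longrightarrow> g' \<in> {f, g} \<Longrightarrow> DP f' g' = (\<Sum>x\<in>S. D (f' x) (g' x))"
      by (rule DP_common[of "{f, g}"]) (use fg in simp_all)
    have DP: "DP f g = (\<Sum>x\<in>S. D (f x) (g x))" by (rule DP') simp_all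
    have "DP f g = 0 \<longleftrightarrow> (\<forall>x\<in>S. f x = g x)"
      using S(1,2) P_mem fg D_zero by (auto simp: DP sum_eq_0_iff subset_iff)
    also have "\<dots> \<longleftrightarrow> (\<forall>x\<in>X. f x = g x)"
      using S by (metis insertCI subsetD)
    finally show ?thesis using P_ext[OF fg] by auto
  qed
  have 4: "DP f h \<le> Suc (DP g h)" if fg: "(f, g) \<in> EP" and h: "h \<in> P" for f g h
  proof -
    obtain x where x: "x \<in> X" "(f x, g x) \<in> E" "\<forall>y\<in>X - {x}. f y = g y" and P: "f \<in> P" "g \<in> P"
      using fg by (auto simp: weak_power_edges_def)
    obtain S where S: "finite S" "S \<subseteq> X" "\<And>k x. k \<in> {f, g, h} \<Longrightarrow> x \<in> X \<Longrightarrow> x \<notin> S \<Longrightarrow> k x = v"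
      and DP: "\<And>f' g'. f' \<in> {f, g, h} \<Longrightarrow> g' \<in> {f, g, h} \<Longrightarrow> DP f' g' = (\<Sum>x\<in>S. D (f' x) (g' x))"
      by (rule DP_common[of "{f, g, h}"]) (use P h in simp_all)
    have xS: "x \<in> S" using S(3)[of f x] S(3)[of g x] x E_irrefl by force
    have "(\<Sum>y\<in>S - {x}. D (f y) (h y)) = (\<Sum>y\<in>S - {x}. D (g y) (h y))"
      using x S by (intro sum.cong) auto
    moreover have "D (f x) (h x) \<le> Suc (D (g x) (h x))" using D_lip x P_mem[OF h] by blast
    ultimately show ?thesis using S(1) xS by (simp add: DP sum.remove[of S x])
  qed
  have 5: "\<exists>g. (f, g) \<in> EP \<and> DP g h = n" if fh: "f \<in> P" "h \<in> P" and n: "DP f h = Suc n" for f h n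
  proof -
    obtain S where S: "finite S" "S \<subseteq> X" "\<And>k x. k \<in> {f, h} \<Longrightarrow> x \<in> X \<Longrightarrow> x \<notin> S \<Longrightarrow> k x = v"
      and DP': "\<And>f' g'. f' \<in> {f, h} \<Longrightarrow> g' \<in> {f, h} \<Longrightarrow> DP f' g' = (\<Sum>x\<in>S. D (f' x) (g' x))"
      by (rule DP_common[of "{f, h}"]) (use fh in simp_all)
    have DP: "DP f h = (\<Sum>x\<in>S. D (f x) (h x))" by (rule DP') simp_all
    obtain x k where x: "x \<in> S" "D (f x) (h x) = Suc k"
    proof -
      have "\<exists>x\<in>S. D (f x) (h x) \<noteq> 0"
        using n sum.neutral[of S "\<lambda>x. D (f x) (h x)"] unfolding DP by (intro ccontr[of "\<exists>x\<in>S. _ x"]) simp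
      then show thesis using that not0_implies_Suc by blast
    qed
    have xX: "x \<in> X" using x S by blast
    obtain a where a: "(f x, a) \<in> E" "D a (h x) = k"
      using D_desc[OF P_mem[OF fh(1) xX] P_mem[OF fh(2) xX] x(2)] by blast
    then have aV: "a \<in> V" using E_sub by blast
    let ?g = "f(x := a)"
    have gP: "?g \<in> P" using P_upd[OF fh(1) xX aV] .
    have "DP ?g h = (\<Sum>x\<in>S. D (?g x) (h x))"
    proof (rule DP_eq[OF gP S(1) _ S(2)])
      have "f y = h y" if "y \<in> X" "y \<notin> S" for y
        using S(3)[OF _ that, of f] S(3)[OF _ that, of h] by simp
      then show "{y \<in> X. ?g y \<noteq> h y} \<subseteq> S" using x(1) by auto
    qed
    also have "\<dots> = k + (\<Sum>y\<in>S - {x}. D (f y) (h y))"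
      using S(1) x(1) a by (simp add: sum.remove[of S x])
    also have "\<dots> = n" using n S(1) x by (simp add: DP sum.remove[of S x])
    finally show ?thesis using a fh gP xX
      by (intro exI[of _ ?g]) (auto simp: weak_power_edges_def)
  qed
  have 6: "\<exists>!m. m \<in> P \<and> is_median DP f g h m" if P: "f \<in> P" "g \<in> P" "h \<in> P" for f g h
  proof -
    have iff: "is_median DP f g h m \<longleftrightarrow> (\<forall>x\<in>X. is_median D (f x) (g x) (h x) (m x))" if "m \<in> P" for m
      using DP_between P that by (auto simp: is_median_def)
    define m where "m = (\<lambda>x\<in>X. THE a. a \<in> V \<and> is_median D (f x) (g x) (h x) a)"
    have mx: "m x \<in> V" "is_median D (f x) (g x) (h x) (m x)" if "x \<in> X" for x
      using theI'[OF m[OF P_mem[OF P(1) that] P_mem[OF P(2) that] P_mem[OF P(3) that]]] that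
      by (auto simp: m_def)
    obtain S where S: "finite S" "S \<subseteq> X" "\<And>k x. k \<in> {f, g, h} \<Longrightarrow> x \<in> X \<Longrightarrow> x \<notin> S \<Longrightarrow> k x = v"
      by (rule P_finite[of "{f, g, h}"]) (use P in simp_all)
    have "m x = v" if "x \<in> X" "x \<notin> S" for x
    proof -
      have "f x = v" "g x = v" "h x = v" by (rule S(3)[OF _ that]; simp)+
      then have "D v (m x) + D (m x) v = D v v"
        using mx(2)[OF that(1)] by (simp add: is_median_def)
      then have "D v (m x) = 0" using D_zero[OF v v] by simp
      then show ?thesis using D_zero[OF v mx(1)[OF that(1)]] by simp
    qed
    then have "finite {x \<in> X. m x \<noteq> v}" using S(1) by (auto intro: rev_finite_subset)
    then have mP: "m \<in> P" using mx by (auto simp: weak_power_def m_def)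
    show ?thesis
    proof (rule ex1I[of _ m])
      show "m \<in> P \<and> is_median DP f g h m" using mP mx iff by blast
      show "m' = m" if m': "m' \<in> P \<and> is_median DP f g h m'" for m'
      proof (rule P_ext)
        fix x assume x: "x \<in> X"
        have "is_median D (f x) (g x) (h x) (m' x)" using iff m' x by blast
        then show "m' x = m x"
          using m[OF P_mem[OF P(1) x] P_mem[OF P(2) x] P_mem[OF P(3) x]] mx[OF x] m' P_mem x by blast
      qed (use m' mP in auto)
    qed
  qed
  show "median_graph P EP" by (rule median_graphI(1)[where D = DP]; fact)
  show "graph_dist P EP f g = DP f g" if "f \<in> P" "g \<in> P" for f g
    by (rule median_graphI(2)[where D = DP]; fact)
qed

end

end

text \<open>Left translation permutes the leaves of a star on the elements of a group. The complete graph
  on these elements would not do, because three vertices of a triangle have no median; in the star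
  the centre is the median of three distinct leaves.\<close>

definition star :: "'g set \<Rightarrow> 'g option set"
  where "star A = insert None (Some ` A)"

definition star_edges :: "'g set \<Rightarrow> ('g option \<times> 'g option) set"
  where "star_edges A = {None} \<times> Some ` A \<union> Some ` A \<times> {None}"

lemma median_star: "median_graph (star A) (star_edges A)"
  and star_dist: "u \<in> star A \<Longrightarrow> v \<in> star A \<Longrightarrow> u \<noteq> v \<Longrightarrow> graph_dist (star A) (star_edges A) u v \<noteq> 0"
proof -
  define D :: "'a option \<Rightarrow> 'a option \<Rightarrow> nat"
    where "D u v = (if u = v then 0 else if u = None \<or> v = None then 1 else 2)" for u v
  have 1: "simple_graph (star A) (star_edges A)"
    by (auto simp: simple_graph_def star_def star_edges_def sym_def irrefl_def)
  have 2: "star A \<noteq> {}" by (simp add: star_def)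
  have 3: "D u v = 0 \<longleftrightarrow> u = v" if "u \<in> star A" "v \<in> star A" for u v by (simp add: D_def)
  have 4: "D u w \<le> Suc (D v w)" if "(u, v) \<in> star_edges A" "w \<in> star A" for u v w
    using that by (auto simp: D_def star_edges_def)
  have 5: "\<exists>v. (u, v) \<in> star_edges A \<and> D v w = n"
    if "u \<in> star A" "w \<in> star A" "D u w = Suc n" for u w n
    using that
    by (cases "u = None"; intro exI[of _ "if u = None then w else None"])
      (auto simp: D_def star_def star_edges_def split: if_splits)
  have 6: "\<exists>!m. m \<in> star A \<and> is_median D u v w m"
    if "u \<in> star A" "v \<in> star A" "w \<in> star A" for u v w
    using that
    by (intro ex1I[of _ "if u = v \<or> u = w then u else if v = w then v else None"])
      (auto simp: is_median_def D_def star_def split: if_splits)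
  show "median_graph (star A) (star_edges A)" by (rule median_graphI(1)[where D = D]; fact)
  have "graph_dist (star A) (star_edges A) u v = D u v" if "u \<in> star A" "v \<in> star A" for u v
    by (rule median_graphI(2)[where D = D]; fact)
  then show "graph_dist (star A) (star_edges A) u v \<noteq> 0" if "u \<in> star A" "v \<in> star A" "u \<noteq> v" for u v
    using that by (simp add: D_def)
qed

lemma graph_action_star:
  assumes "group G"
  shows "graph_action G (star (carrier G)) (star_edges (carrier G))
    (\<lambda>g. \<lambda>u\<in>star (carrier G). map_option (\<lambda>a. g \<otimes>\<^bsub>G\<^esub> a) u)"
proof -
  interpret group G by fact
  show ?thesis
  proof (rule graph_actionI[OF group_actionI])
    show "group G" by fact
  qed (auto simp: star_def star_edges_def m_assoc)
qed

lemma star_lepoll: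
  assumes inf: "infinite (UNIV :: 'u set)" and A: "A \<lesssim> (UNIV :: 'u set)"
  shows "star A \<lesssim> (UNIV :: 'u set)"
proof -
  have "star A \<lesssim> insert None (Some ` (UNIV :: 'u set))"
  proof -
    obtain e :: "'a \<Rightarrow> 'u" where e: "inj_on e A" using A by (auto simp: lepoll_def)
    have "inj_on (map_option e) (star A)"
      using e by (auto simp: star_def inj_on_def)
    then show ?thesis unfolding lepoll_def by (intro exI[of _ "map_option e"]) (auto simp: star_def)
  qed
  also have "insert None (Some ` (UNIV :: 'u set)) \<approx> Some ` (UNIV :: 'u set)"
    by (rule infinite_insert_eqpoll) (use inf in \<open>simp add: finite_image_iff\<close>)
  also have "Some ` (UNIV :: 'u set) \<approx> (UNIV :: 'u set)"
    by (rule inj_on_image_eqpoll_self) simp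
  finally show ?thesis .
qed

section \<open>Normed spaces on a carrier set\<close>

text \<open>The module axioms for scalars in \<open>real_ring\<close>, restated with the operations of the type
  \<open>real\<close>.\<close>

locale real_space =
  fixes V :: "(real, 'v, 'y) module_scheme" (structure)
  assumes module: "Module.module real_ring V"
begin

sublocale Mod: Module.module real_ring V by (rule module)

lemma scalars: "carrier real_ring = UNIV" "\<one>\<^bsub>real_ring\<^esub> = 1" "\<zero>\<^bsub>real_ring\<^esub> = 0"
  "a \<oplus>\<^bsub>real_ring\<^esub> b = a + b" "a \<otimes>\<^bsub>real_ring\<^esub> b = a * b"
  by (simp_all add: real_ring_def)

lemma smult_closed [simp, intro]: "x \<in> carrier V \<Longrightarrow> a \<odot>\<^bsub>V\<^esub> x \<in> carrier V"
  using Mod.smult_closed[of a x] by (simp add: scalars)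

lemma smult_one [simp]: "x \<in> carrier V \<Longrightarrow> 1 \<odot>\<^bsub>V\<^esub> x = x"
  using Mod.smult_one[of x] by (simp add: scalars)

lemma smult_zero [simp]: "x \<in> carrier V \<Longrightarrow> 0 \<odot>\<^bsub>V\<^esub> x = \<zero>\<^bsub>V\<^esub>"
  using Mod.smult_l_null[of x] by (simp add: scalars)

lemma smult_zero_right [simp]: "a \<odot>\<^bsub>V\<^esub> \<zero>\<^bsub>V\<^esub> = \<zero>\<^bsub>V\<^esub>"
  using Mod.smult_r_null[of a] by (simp add: scalars)

lemma smult_smult: "x \<in> carrier V \<Longrightarrow> a \<odot>\<^bsub>V\<^esub> (b \<odot>\<^bsub>V\<^esub> x) = (a * b) \<odot>\<^bsub>V\<^esub> x"
  using Mod.smult_assoc1[of a b x] by (simp add: scalars)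

lemma smult_add: "x \<in> carrier V \<Longrightarrow> y \<in> carrier V \<Longrightarrow>
    a \<odot>\<^bsub>V\<^esub> (x \<oplus>\<^bsub>V\<^esub> y) = a \<odot>\<^bsub>V\<^esub> x \<oplus>\<^bsub>V\<^esub> a \<odot>\<^bsub>V\<^esub> y"
  using Mod.smult_r_distr[of a x y] by (simp add: scalars)

lemma add_smult: "x \<in> carrier V \<Longrightarrow> (a + b) \<odot>\<^bsub>V\<^esub> x = a \<odot>\<^bsub>V\<^esub> x \<oplus>\<^bsub>V\<^esub> b \<odot>\<^bsub>V\<^esub> x"
  using Mod.smult_l_distr[of a b x] by (simp add: scalars)

lemmas add_ac = Mod.M.a_assoc Mod.M.a_comm Mod.M.a_lcomm

lemma minus_eq: "x \<in> carrier V \<Longrightarrow> y \<in> carrier V \<Longrightarrow> x \<ominus>\<^bsub>V\<^esub> y = x \<oplus>\<^bsub>V\<^esub> (-1) \<odot>\<^bsub>V\<^esub> y"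
proof -
  assume y: "y \<in> carrier V"
  have "(-1) \<odot>\<^bsub>V\<^esub> y \<oplus>\<^bsub>V\<^esub> y = \<zero>\<^bsub>V\<^esub>" using add_smult[OF y, of "-1" 1] y by simp
  then have "\<ominus>\<^bsub>V\<^esub> y = (-1) \<odot>\<^bsub>V\<^esub> y" using y by (intro Mod.M.minus_equality) auto
  then show ?thesis by (simp add: a_minus_def)
qed

lemma minus_closed [simp, intro]: "x \<in> carrier V \<Longrightarrow> y \<in> carrier V \<Longrightarrow> x \<ominus>\<^bsub>V\<^esub> y \<in> carrier V"
  by (simp add: minus_eq)

lemma add_minus_cancel [simp]: "x \<in> carrier V \<Longrightarrow> y \<in> carrier V \<Longrightarrow> x \<oplus>\<^bsub>V\<^esub> (-1) \<odot>\<^bsub>V\<^esub> y \<oplus>\<^bsub>V\<^esub> y = x"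
  using add_smult[of y "-1" 1] by (simp add: Mod.M.a_assoc)

lemma minus_add_cancel [simp]: "x \<in> carrier V \<Longrightarrow> y \<in> carrier V \<Longrightarrow> (x \<ominus>\<^bsub>V\<^esub> y) \<oplus>\<^bsub>V\<^esub> y = x"
  by (simp add: minus_eq)

lemma minus_self [simp]: "x \<in> carrier V \<Longrightarrow> x \<ominus>\<^bsub>V\<^esub> x = \<zero>\<^bsub>V\<^esub>"
  using add_smult[of x 1 "-1"] by (simp add: minus_eq)

lemma minus_minus_cancel [simp]:
  assumes "x \<in> carrier V" "y \<in> carrier V" shows "x \<ominus>\<^bsub>V\<^esub> (x \<ominus>\<^bsub>V\<^esub> y) = y"
proof -
  have "x \<ominus>\<^bsub>V\<^esub> (x \<ominus>\<^bsub>V\<^esub> y) = x \<oplus>\<^bsub>V\<^esub> (-1) \<odot>\<^bsub>V\<^esub> x \<oplus>\<^bsub>V\<^esub> y"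
    using assms by (simp add: minus_eq smult_add smult_smult Mod.M.a_assoc)
  also have "x \<oplus>\<^bsub>V\<^esub> (-1) \<odot>\<^bsub>V\<^esub> x = \<zero>\<^bsub>V\<^esub>" using add_smult[of x 1 "-1"] assms by simp
  also have "\<zero>\<^bsub>V\<^esub> \<oplus>\<^bsub>V\<^esub> y = y" using assms by simp
  finally show ?thesis .
qed

lemma minus_trans: "x \<in> carrier V \<Longrightarrow> y \<in> carrier V \<Longrightarrow> z \<in> carrier V \<Longrightarrow>
    x \<ominus>\<^bsub>V\<^esub> z = (x \<ominus>\<^bsub>V\<^esub> y) \<oplus>\<^bsub>V\<^esub> (y \<ominus>\<^bsub>V\<^esub> z)"
  by (simp add: minus_eq Mod.M.a_assoc[symmetric])

lemma minus_swap: "x \<in> carrier V \<Longrightarrow> y \<in> carrier V \<Longrightarrow> (-1) \<odot>\<^bsub>V\<^esub> (x \<ominus>\<^bsub>V\<^esub> y) = y \<ominus>\<^bsub>V\<^esub> x"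
  by (simp add: minus_eq smult_add smult_smult Mod.M.a_comm)

end

lemma real_spaceI:
  fixes V :: "(real, 'v, 'y) module_scheme"
  assumes "\<zero>\<^bsub>V\<^esub> \<in> carrier V"
    and "\<And>x y. x \<in> carrier V \<Longrightarrow> y \<in> carrier V \<Longrightarrow> x \<oplus>\<^bsub>V\<^esub> y \<in> carrier V"
    and "\<And>a x. x \<in> carrier V \<Longrightarrow> a \<odot>\<^bsub>V\<^esub> x \<in> carrier V"
    and "\<And>x y z. x \<in> carrier V \<Longrightarrow> y \<in> carrier V \<Longrightarrow> z \<in> carrier V \<Longrightarrow>
      x \<oplus>\<^bsub>V\<^esub> y \<oplus>\<^bsub>V\<^esub> z = x \<oplus>\<^bsub>V\<^esub> (y \<oplus>\<^bsub>V\<^esub> z)"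
    and "\<And>x y. x \<in> carrier V \<Longrightarrow> y \<in> carrier V \<Longrightarrow> x \<oplus>\<^bsub>V\<^esub> y = y \<oplus>\<^bsub>V\<^esub> x"
    and "\<And>x. x \<in> carrier V \<Longrightarrow> \<zero>\<^bsub>V\<^esub> \<oplus>\<^bsub>V\<^esub> x = x"
    and "\<And>a x y. x \<in> carrier V \<Longrightarrow> y \<in> carrier V \<Longrightarrow> a \<odot>\<^bsub>V\<^esub> (x \<oplus>\<^bsub>V\<^esub> y) = a \<odot>\<^bsub>V\<^esub> x \<oplus>\<^bsub>V\<^esub> a \<odot>\<^bsub>V\<^esub> y"
    and "\<And>a b x. x \<in> carrier V \<Longrightarrow> (a + b) \<odot>\<^bsub>V\<^esub> x = a \<odot>\<^bsub>V\<^esub> x \<oplus>\<^bsub>V\<^esub> b \<odot>\<^bsub>V\<^esub> x"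
    and "\<And>a b x. x \<in> carrier V \<Longrightarrow> (a * b) \<odot>\<^bsub>V\<^esub> x = a \<odot>\<^bsub>V\<^esub> (b \<odot>\<^bsub>V\<^esub> x)"
    and "\<And>x. x \<in> carrier V \<Longrightarrow> 1 \<odot>\<^bsub>V\<^esub> x = x"
    and "\<And>x. x \<in> carrier V \<Longrightarrow> 0 \<odot>\<^bsub>V\<^esub> x = \<zero>\<^bsub>V\<^esub>"
  shows "real_space V"
proof (rule real_space.intro)
  have "abelian_group V"
  proof (rule abelian_groupI)
    show "\<exists>y\<in>carrier V. y \<oplus>\<^bsub>V\<^esub> x = \<zero>\<^bsub>V\<^esub>" if "x \<in> carrier V" for x
      using that assms(8)[OF that, of "-1" 1] assms(10,11)[OF that] assms(3)[OF that, of "-1"]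
      by (intro bexI[of _ "(-1) \<odot>\<^bsub>V\<^esub> x"]) auto
  qed (use assms in auto)
  then show "Module.module real_ring V"
    by (rule Module.moduleI[OF cring_real_ring]) (use assms in \<open>auto simp: real_ring_def\<close>)
qed

context real_space
begin

text \<open>Affinity without reference to a linear part: this version can be checked coordinatewise.\<close>

lemma affine_map_iff:
  "affine_map V f \<longleftrightarrow>
    (\<forall>x\<in>carrier V. f x \<in> carrier V) \<and>
    (\<forall>x\<in>carrier V. \<forall>y\<in>carrier V. f (x \<oplus>\<^bsub>V\<^esub> y) \<oplus>\<^bsub>V\<^esub> f \<zero>\<^bsub>V\<^esub> = f x \<oplus>\<^bsub>V\<^esub> f y) \<and>
    (\<forall>a. \<forall>x\<in>carrier V. f (a \<odot>\<^bsub>V\<^esub> x) \<oplus>\<^bsub>V\<^esub> a \<odot>\<^bsub>V\<^esub> f \<zero>\<^bsub>V\<^esub> = a \<odot>\<^bsub>V\<^esub> f x \<oplus>\<^bsub>V\<^esub> f \<zero>\<^bsub>V\<^esub>)"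
    (is "_ \<longleftrightarrow> ?C \<and> ?A \<and> ?S")
proof
  assume "affine_map V f"
  then obtain L b where L: "\<And>x. x \<in> carrier V \<Longrightarrow> L x \<in> carrier V" and b: "b \<in> carrier V"
    and add: "\<And>x y. x \<in> carrier V \<Longrightarrow> y \<in> carrier V \<Longrightarrow> L (x \<oplus>\<^bsub>V\<^esub> y) = L x \<oplus>\<^bsub>V\<^esub> L y"
    and smult: "\<And>a x. x \<in> carrier V \<Longrightarrow> L (a \<odot>\<^bsub>V\<^esub> x) = a \<odot>\<^bsub>V\<^esub> L x"
    and f: "\<And>x. x \<in> carrier V \<Longrightarrow> f x = L x \<oplus>\<^bsub>V\<^esub> b"
    unfolding affine_map_def by blast
  have L0: "L \<zero>\<^bsub>V\<^esub> = \<zero>\<^bsub>V\<^esub>" using smult[of "\<zero>\<^bsub>V\<^esub>" 0] L by simp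
  have ?C using L b f by simp
  moreover have ?A using L b by (simp add: f add L0 add_ac)
  moreover have ?S using L b by (simp add: f smult L0 smult_add add_ac)
  ultimately show "?C \<and> ?A \<and> ?S" by blast
next
  assume *: "?C \<and> ?A \<and> ?S"
  then have C: "\<And>x. x \<in> carrier V \<Longrightarrow> f x \<in> carrier V"
    and A: "\<And>x y. x \<in> carrier V \<Longrightarrow> y \<in> carrier V \<Longrightarrow> f (x \<oplus>\<^bsub>V\<^esub> y) \<oplus>\<^bsub>V\<^esub> f \<zero>\<^bsub>V\<^esub> = f x \<oplus>\<^bsub>V\<^esub> f y"
    and S: "\<And>a x. x \<in> carrier V \<Longrightarrow>
      f (a \<odot>\<^bsub>V\<^esub> x) \<oplus>\<^bsub>V\<^esub> a \<odot>\<^bsub>V\<^esub> f \<zero>\<^bsub>V\<^esub> = a \<odot>\<^bsub>V\<^esub> f x \<oplus>\<^bsub>V\<^esub> f \<zero>\<^bsub>V\<^esub>" by blast+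
  let ?b = "f \<zero>\<^bsub>V\<^esub>"
  have b: "?b \<in> carrier V" using C by simp
  let ?L = "\<lambda>x. f x \<ominus>\<^bsub>V\<^esub> ?b"
  have eq: "u = w" if "u \<oplus>\<^bsub>V\<^esub> t = w \<oplus>\<^bsub>V\<^esub> t" "u \<in> carrier V" "w \<in> carrier V" "t \<in> carrier V" for u w t
    using that by simp
  have add: "?L (x \<oplus>\<^bsub>V\<^esub> y) = ?L x \<oplus>\<^bsub>V\<^esub> ?L y" if x: "x \<in> carrier V" and y: "y \<in> carrier V" for x y
  proof (rule eq[of _ "?b \<oplus>\<^bsub>V\<^esub> ?b"])
    have "?L (x \<oplus>\<^bsub>V\<^esub> y) \<oplus>\<^bsub>V\<^esub> (?b \<oplus>\<^bsub>V\<^esub> ?b) = (?L (x \<oplus>\<^bsub>V\<^esub> y) \<oplus>\<^bsub>V\<^esub> ?b) \<oplus>\<^bsub>V\<^esub> ?b"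
      using x y b C by (subst Mod.M.a_assoc) auto
    also have "\<dots> = f x \<oplus>\<^bsub>V\<^esub> f y" using x y b C A by simp
    also have "\<dots> = (?L x \<oplus>\<^bsub>V\<^esub> ?b) \<oplus>\<^bsub>V\<^esub> (?L y \<oplus>\<^bsub>V\<^esub> ?b)" using x y b C by simp
    also have "\<dots> = (?L x \<oplus>\<^bsub>V\<^esub> ?L y) \<oplus>\<^bsub>V\<^esub> (?b \<oplus>\<^bsub>V\<^esub> ?b)"
      using minus_closed[OF C[OF x] b] minus_closed[OF C[OF y] b] b by (simp only: add_ac Mod.M.add.m_closed)
    finally show "?L (x \<oplus>\<^bsub>V\<^esub> y) \<oplus>\<^bsub>V\<^esub> (?b \<oplus>\<^bsub>V\<^esub> ?b) = (?L x \<oplus>\<^bsub>V\<^esub> ?L y) \<oplus>\<^bsub>V\<^esub> (?b \<oplus>\<^bsub>V\<^esub> ?b)" .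
  qed (use x y b C in auto)
  have smult: "?L (a \<odot>\<^bsub>V\<^esub> x) = a \<odot>\<^bsub>V\<^esub> ?L x" if x: "x \<in> carrier V" for a x
  proof (rule eq[of _ "?b \<oplus>\<^bsub>V\<^esub> a \<odot>\<^bsub>V\<^esub> ?b"])
    have "?L (a \<odot>\<^bsub>V\<^esub> x) \<oplus>\<^bsub>V\<^esub> (?b \<oplus>\<^bsub>V\<^esub> a \<odot>\<^bsub>V\<^esub> ?b) = (?L (a \<odot>\<^bsub>V\<^esub> x) \<oplus>\<^bsub>V\<^esub> ?b) \<oplus>\<^bsub>V\<^esub> a \<odot>\<^bsub>V\<^esub> ?b"
      using x b C by (subst Mod.M.a_assoc) auto
    also have "\<dots> = a \<odot>\<^bsub>V\<^esub> f x \<oplus>\<^bsub>V\<^esub> ?b" using x b C S by simp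
    also have "\<dots> = a \<odot>\<^bsub>V\<^esub> (?L x \<oplus>\<^bsub>V\<^esub> ?b) \<oplus>\<^bsub>V\<^esub> ?b" using x b C by simp
    also have "\<dots> = a \<odot>\<^bsub>V\<^esub> ?L x \<oplus>\<^bsub>V\<^esub> (?b \<oplus>\<^bsub>V\<^esub> a \<odot>\<^bsub>V\<^esub> ?b)"
      using minus_closed[OF C[OF x] b] b
      by (simp only: smult_add add_ac Mod.M.add.m_closed smult_closed)
    finally show "?L (a \<odot>\<^bsub>V\<^esub> x) \<oplus>\<^bsub>V\<^esub> (?b \<oplus>\<^bsub>V\<^esub> a \<odot>\<^bsub>V\<^esub> ?b) = a \<odot>\<^bsub>V\<^esub> ?L x \<oplus>\<^bsub>V\<^esub> (?b \<oplus>\<^bsub>V\<^esub> a \<odot>\<^bsub>V\<^esub> ?b)" .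
  qed (use x b C in auto)
  show "affine_map V f" unfolding affine_map_def
    by (intro bexI[of _ ?L] bexI[of _ ?b]) (use add smult b C in auto)
qed

end

locale real_normed = real_space V for V :: "(real, 'v, 'y) module_scheme" +
  fixes N :: "'v \<Rightarrow> real"
  assumes normed: "normed_space V N"
begin

lemma N_nonneg [simp]: "x \<in> carrier V \<Longrightarrow> 0 \<le> N x"
  using normed_space_minus_nonneg(2)[OF normed] .

lemma N_zero_iff: "x \<in> carrier V \<Longrightarrow> N x = 0 \<longleftrightarrow> x = \<zero>\<^bsub>V\<^esub>"
  using normed by (simp add: normed_space_def)

lemma N_zero [simp]: "N \<zero>\<^bsub>V\<^esub> = 0" using N_zero_iff by simp

lemma N_smult: "x \<in> carrier V \<Longrightarrow> N (a \<odot>\<^bsub>V\<^esub> x) = \<bar>a\<bar> * N x"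
  using normed by (simp add: normed_space_def)

lemma N_triangle: "x \<in> carrier V \<Longrightarrow> y \<in> carrier V \<Longrightarrow> N (x \<oplus>\<^bsub>V\<^esub> y) \<le> N x + N y"
  using normed by (simp add: normed_space_def)

lemma N_commute: "x \<in> carrier V \<Longrightarrow> y \<in> carrier V \<Longrightarrow> N (x \<ominus>\<^bsub>V\<^esub> y) = N (y \<ominus>\<^bsub>V\<^esub> x)"
  using N_smult[of "x \<ominus>\<^bsub>V\<^esub> y" "-1"] by (simp add: minus_swap)

lemma N_minus_triangle: "x \<in> carrier V \<Longrightarrow> y \<in> carrier V \<Longrightarrow> z \<in> carrier V \<Longrightarrow>
    N (x \<ominus>\<^bsub>V\<^esub> z) \<le> N (x \<ominus>\<^bsub>V\<^esub> y) + N (y \<ominus>\<^bsub>V\<^esub> z)"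
  using N_triangle[of "x \<ominus>\<^bsub>V\<^esub> y" "y \<ominus>\<^bsub>V\<^esub> z"] minus_trans[of x y z] by simp

sublocale Metric_space "carrier V" "norm_dist V N"
  by (rule Metric_space_norm_dist[OF normed])

lemma dist_eq: "x \<in> carrier V \<Longrightarrow> y \<in> carrier V \<Longrightarrow> norm_dist V N x y = N (x \<ominus>\<^bsub>V\<^esub> y)"
  by (simp add: norm_dist_def)

text \<open>Completeness in terms of the norm, away from the topology of \<^locale>\<open>Metric_space\<close>.\<close>

lemma banach_iff:
  "banach_space V N \<longleftrightarrow>
    (\<forall>\<sigma> :: nat \<Rightarrow> 'v. (\<forall>n. \<sigma> n \<in> carrier V) \<longrightarrow>
      (\<forall>e>0. \<exists>k. \<forall>m n. k \<le> m \<longrightarrow> k \<le> n \<longrightarrow> N (\<sigma> m \<ominus>\<^bsub>V\<^esub> \<sigma> n) < e) \<longrightarrow>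
      (\<exists>x\<in>carrier V. \<forall>e>0. \<exists>k. \<forall>n\<ge>k. N (\<sigma> n \<ominus>\<^bsub>V\<^esub> x) < e))"
proof -
  have "MCauchy \<sigma> \<longleftrightarrow> (\<forall>n. \<sigma> n \<in> carrier V) \<and>
      (\<forall>e>0. \<exists>k. \<forall>m n. k \<le> m \<longrightarrow> k \<le> n \<longrightarrow> N (\<sigma> m \<ominus>\<^bsub>V\<^esub> \<sigma> n) < e)" for \<sigma> :: "nat \<Rightarrow> 'v"
    unfolding MCauchy_def by (auto simp: dist_eq image_subset_iff)
  moreover have "(\<exists>x. limitin mtopology \<sigma> x sequentially) \<longleftrightarrow>
      (\<exists>x\<in>carrier V. \<forall>e>0. \<exists>k. \<forall>n\<ge>k. N (\<sigma> n \<ominus>\<^bsub>V\<^esub> x) < e)"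
    if "\<forall>n. \<sigma> n \<in> carrier V" for \<sigma> :: "nat \<Rightarrow> 'v"
    using that by (simp add: limit_metric_sequentially dist_eq Bex_def cong: conj_cong)
  ultimately show ?thesis
    using normed unfolding banach_space_def mcomplete_def by (simp add: imp_conjL)
qed

end

lemma real_normedI: "normed_space V N \<Longrightarrow> real_normed V N"
  by (simp add: real_normed.intro real_space.intro real_normed_axioms.intro normed_space_def)

section \<open>Square-summable functions\<close>

text \<open>The exponent \<open>2\<close> makes one construction serve both Hilbert and reflexive Banach spaces.\<close>

definition l2_space ::
  "'x set \<Rightarrow> (real, 'v, 'y) module_scheme \<Rightarrow> ('v \<Rightarrow> real) \<Rightarrow> (real, 'x \<Rightarrow> 'v) module"
  where "l2_space X V N =
    \<lparr>carrier = {f \<in> X \<rightarrow>\<^sub>E carrier V. (\<lambda>x. (N (f x))\<^sup>2) summable_on X},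
     monoid.mult = undefined, one = undefined,
     ring.zero = (\<lambda>x\<in>X. \<zero>\<^bsub>V\<^esub>), add = (\<lambda>f g. \<lambda>x\<in>X. f x \<oplus>\<^bsub>V\<^esub> g x),
     module.smult = (\<lambda>a f. \<lambda>x\<in>X. a \<odot>\<^bsub>V\<^esub> f x)\<rparr>"

definition l2_norm :: "'x set \<Rightarrow> ('v \<Rightarrow> real) \<Rightarrow> ('x \<Rightarrow> 'v) \<Rightarrow> real"
  where "l2_norm X N f = sqrt (\<Sum>\<^sub>\<infinity>x\<in>X. (N (f x))\<^sup>2)"

context real_normed
begin

context
  fixes X :: "'x set"
begin

abbreviation "L2 \<equiv> l2_space X V N"
abbreviation "N2 \<equiv> l2_norm X N"

lemma L2_simps:
  "\<zero>\<^bsub>L2\<^esub> = (\<lambda>x\<in>X. \<zero>\<^bsub>V\<^esub>)" "f \<oplus>\<^bsub>L2\<^esub> g = (\<lambda>x\<in>X. f x \<oplus>\<^bsub>V\<^esub> g x)" "a \<odot>\<^bsub>L2\<^esub> f = (\<lambda>x\<in>X. a \<odot>\<^bsub>V\<^esub> f x)"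
  by (simp_all add: l2_space_def)

lemma L2_iff: "f \<in> carrier L2 \<longleftrightarrow> f \<in> X \<rightarrow>\<^sub>E carrier V \<and> (\<lambda>x. (N (f x))\<^sup>2) summable_on X"
  by (simp add: l2_space_def)

lemma L2_mem: "f \<in> carrier L2 \<Longrightarrow> x \<in> X \<Longrightarrow> f x \<in> carrier V"
  by (auto simp: L2_iff)

lemma L2_ext: "f \<in> carrier L2 \<Longrightarrow> g \<in> carrier L2 \<Longrightarrow> (\<And>x. x \<in> X \<Longrightarrow> f x = g x) \<Longrightarrow> f = g"
  unfolding L2_iff by (blast intro: PiE_ext)

lemma N2_nonneg: "0 \<le> N2 f"
  by (simp add: l2_norm_def infsum_nonneg)

lemma L2_set_le_N2: "f \<in> carrier L2 \<Longrightarrow> finite F \<Longrightarrow> F \<subseteq> X \<Longrightarrow> L2_set (\<lambda>x. N (f x)) F \<le> N2 f"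
  unfolding L2_set_def l2_norm_def L2_iff
  by (intro real_sqrt_le_mono finite_sum_le_infsum) auto

lemma N_le_N2: "f \<in> carrier L2 \<Longrightarrow> x \<in> X \<Longrightarrow> N (f x) \<le> N2 f"
  using L2_set_le_N2[of f "{x}"] L2_mem[of f x] by (simp add: L2_set_def)

text \<open>All bounds on infinite sums are obtained from uniform bounds on finite partial sums.\<close>

lemma L2I:
  assumes f: "f \<in> X \<rightarrow>\<^sub>E carrier V" and le: "\<And>F. finite F \<Longrightarrow> F \<subseteq> X \<Longrightarrow> L2_set (\<lambda>x. N (f x)) F \<le> C"
  shows "f \<in> carrier L2" "N2 f \<le> C"
proof -
  have sq: "(\<Sum>x\<in>F. (N (f x))\<^sup>2) \<le> C\<^sup>2" if "finite F" "F \<subseteq> X" for F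
    using power_mono[OF le[OF that], of 2] by (simp add: L2_set_def sum_nonneg)
  have S: "(\<lambda>x. (N (f x))\<^sup>2) summable_on X"
    by (rule nonneg_bdd_above_summable_on) (use sq in \<open>auto intro!: bdd_aboveI2\<close>)
  then show "f \<in> carrier L2" using f by (simp add: L2_iff)
  have "0 \<le> C" using le[of "{}"] by simp
  moreover have "(\<Sum>\<^sub>\<infinity>x\<in>X. (N (f x))\<^sup>2) \<le> C\<^sup>2" by (rule infsum_le_finite_sums[OF S sq])
  ultimately show "N2 f \<le> C" unfolding l2_norm_def by (intro real_le_lsqrt infsum_nonneg) auto
qed

lemma L2_add:
  assumes f: "f \<in> carrier L2" and g: "g \<in> carrier L2"
  shows "f \<oplus>\<^bsub>L2\<^esub> g \<in> carrier L2" "N2 (f \<oplus>\<^bsub>L2\<^esub> g) \<le> N2 f + N2 g"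
proof -
  have le: "L2_set (\<lambda>x. N ((f \<oplus>\<^bsub>L2\<^esub> g) x)) F \<le> N2 f + N2 g" if F: "finite F" "F \<subseteq> X" for F
  proof -
    have "L2_set (\<lambda>x. N ((f \<oplus>\<^bsub>L2\<^esub> g) x)) F \<le> L2_set (\<lambda>x. N (f x) + N (g x)) F"
      using F L2_mem[OF f] L2_mem[OF g] N_triangle
      by (intro L2_set_mono) (auto simp: L2_simps subset_iff)
    also have "\<dots> \<le> L2_set (\<lambda>x. N (f x)) F + L2_set (\<lambda>x. N (g x)) F"
      by (rule L2_set_triangle_ineq)
    also have "\<dots> \<le> N2 f + N2 g" using L2_set_le_N2 f g F by (simp add: add_mono)
    finally show ?thesis .
  qed
  have mem: "f \<oplus>\<^bsub>L2\<^esub> g \<in> X \<rightarrow>\<^sub>E carrier V" using L2_mem[OF f] L2_mem[OF g] by (simp add: L2_simps)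
  show "f \<oplus>\<^bsub>L2\<^esub> g \<in> carrier L2" by (rule L2I(1)[OF mem]) (rule le)
  show "N2 (f \<oplus>\<^bsub>L2\<^esub> g) \<le> N2 f + N2 g" by (rule L2I(2)[OF mem]) (rule le)
qed

lemma L2_smult:
  assumes f: "f \<in> carrier L2"
  shows "a \<odot>\<^bsub>L2\<^esub> f \<in> carrier L2" "N2 (a \<odot>\<^bsub>L2\<^esub> f) = \<bar>a\<bar> * N2 f"
proof -
  have eq: "(N ((a \<odot>\<^bsub>L2\<^esub> f) x))\<^sup>2 = a\<^sup>2 * (N (f x))\<^sup>2" if "x \<in> X" for x
    using that L2_mem[OF f that] by (simp add: L2_simps N_smult power_mult_distrib)
  have "(\<lambda>x. a\<^sup>2 * (N (f x))\<^sup>2) summable_on X"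
    using f by (intro summable_on_cmult_right) (simp add: L2_iff)
  then have "(\<lambda>x. (N ((a \<odot>\<^bsub>L2\<^esub> f) x))\<^sup>2) summable_on X"
    using summable_on_cong[of X, OF eq] by simp
  then show "a \<odot>\<^bsub>L2\<^esub> f \<in> carrier L2" using L2_mem[OF f] by (simp add: L2_iff) (simp add: L2_simps)
  show "N2 (a \<odot>\<^bsub>L2\<^esub> f) = \<bar>a\<bar> * N2 f"
  proof -
    have "(\<Sum>\<^sub>\<infinity>x\<in>X. (N ((a \<odot>\<^bsub>L2\<^esub> f) x))\<^sup>2) = (\<Sum>\<^sub>\<infinity>x\<in>X. a\<^sup>2 * (N (f x))\<^sup>2)"
      by (rule infsum_cong) (rule eq)
    then show ?thesis unfolding l2_norm_def by (simp add: infsum_cmult_right' real_sqrt_mult)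
  qed
qed

lemma L2_zero: "\<zero>\<^bsub>L2\<^esub> \<in> carrier L2"
  by (rule L2I(1)[of _ 0]) (auto simp: L2_simps L2_set_def subset_iff)

lemma real_space_L2: "real_space L2"
proof (rule real_spaceI)
  show "a \<odot>\<^bsub>L2\<^esub> f \<in> carrier L2" if "f \<in> carrier L2" for a f by (rule L2_smult(1)[OF that])
  show "f \<oplus>\<^bsub>L2\<^esub> g \<in> carrier L2" if "f \<in> carrier L2" "g \<in> carrier L2" for f g
    by (rule L2_add(1)[OF that])
  show "\<zero>\<^bsub>L2\<^esub> \<in> carrier L2" by (rule L2_zero)
  note [simp] = L2_simps L2_mem
  show "f \<oplus>\<^bsub>L2\<^esub> g \<oplus>\<^bsub>L2\<^esub> h = f \<oplus>\<^bsub>L2\<^esub> (g \<oplus>\<^bsub>L2\<^esub> h)"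
    if "f \<in> carrier L2" "g \<in> carrier L2" "h \<in> carrier L2" for f g h
    using that by (simp add: Mod.M.a_assoc cong: restrict_cong)
  show "f \<oplus>\<^bsub>L2\<^esub> g = g \<oplus>\<^bsub>L2\<^esub> f" if "f \<in> carrier L2" "g \<in> carrier L2" for f g
    using that by (simp add: Mod.M.a_comm cong: restrict_cong)
  have id: "(\<lambda>x\<in>X. f x) = f" if "f \<in> carrier L2" for f
    using that by (auto simp: L2_iff PiE_restrict)
  show "\<zero>\<^bsub>L2\<^esub> \<oplus>\<^bsub>L2\<^esub> f = f" if "f \<in> carrier L2" for f
    using that id[OF that] by (simp cong: restrict_cong)
  show "a \<odot>\<^bsub>L2\<^esub> (f \<oplus>\<^bsub>L2\<^esub> g) = a \<odot>\<^bsub>L2\<^esub> f \<oplus>\<^bsub>L2\<^esub> a \<odot>\<^bsub>L2\<^esub> g"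
    if "f \<in> carrier L2" "g \<in> carrier L2" for a f g
    using that by (simp add: smult_add cong: restrict_cong)
  show "(a + b) \<odot>\<^bsub>L2\<^esub> f = a \<odot>\<^bsub>L2\<^esub> f \<oplus>\<^bsub>L2\<^esub> b \<odot>\<^bsub>L2\<^esub> f" if "f \<in> carrier L2" for a b f
    using that by (simp add: add_smult cong: restrict_cong)
  show "(a * b) \<odot>\<^bsub>L2\<^esub> f = a \<odot>\<^bsub>L2\<^esub> (b \<odot>\<^bsub>L2\<^esub> f)" if "f \<in> carrier L2" for a b f
    using that by (simp add: smult_smult cong: restrict_cong)
  show "1 \<odot>\<^bsub>L2\<^esub> f = f" if "f \<in> carrier L2" for f
    using that id[OF that] by (simp cong: restrict_cong)
  show "0 \<odot>\<^bsub>L2\<^esub> f = \<zero>\<^bsub>L2\<^esub>" if "f \<in> carrier L2" for f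
    using that by (simp cong: restrict_cong)
qed

lemma L2_minus:
  assumes "f \<in> carrier L2" "g \<in> carrier L2"
  shows "f \<ominus>\<^bsub>L2\<^esub> g = (\<lambda>x\<in>X. f x \<ominus>\<^bsub>V\<^esub> g x)"
proof -
  interpret L: real_space L2 by (rule real_space_L2)
  show ?thesis
    using L2_mem[OF assms(1)] L2_mem[OF assms(2)]
    by (auto simp: L.minus_eq[OF assms] minus_eq L2_simps fun_eq_iff)
qed

lemma normed_space_L2: "normed_space L2 N2"
  unfolding normed_space_def
proof (intro conjI ballI allI)
  show "Module.module real_ring L2" by (rule real_space.module[OF real_space_L2])
  show "N2 f = 0 \<longleftrightarrow> f = \<zero>\<^bsub>L2\<^esub>" if f: "f \<in> carrier L2" for f
  proof
    assume 0: "N2 f = 0"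
    have "f x = \<zero>\<^bsub>V\<^esub>" if "x \<in> X" for x
    proof -
      have "N (f x) = 0" using N_le_N2[OF f that] 0 N_nonneg[OF L2_mem[OF f that]] by linarith
      then show ?thesis using N_zero_iff[OF L2_mem[OF f that]] by blast
    qed
    then show "f = \<zero>\<^bsub>L2\<^esub>" by (intro L2_ext[OF f L2_zero]) (simp add: L2_simps)
  next
    assume "f = \<zero>\<^bsub>L2\<^esub>"
    then have "(N (f x))\<^sup>2 = 0" if "x \<in> X" for x using that by (simp add: L2_simps)
    then show "N2 f = 0" unfolding l2_norm_def by (simp add: infsum_0)
  qed
qed (use L2_add L2_smult in auto)

text \<open>A Cauchy sequence converges pointwise. Its distance to the limit is controlled on each finite set by
  letting the second index tend to infinity there, and these bounds do not depend on the finite set.\<close>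

lemma banach_space_L2:
  assumes B: "banach_space V N"
  shows "banach_space L2 N2"
proof -
  interpret L: real_normed L2 N2 by (rule real_normedI[OF normed_space_L2])
  show ?thesis unfolding L.banach_iff
  proof (intro allI impI)
    fix \<sigma> :: "nat \<Rightarrow> 'x \<Rightarrow> 'v"
    assume "\<forall>n. \<sigma> n \<in> carrier L2"
    then have \<sigma>: "\<sigma> n \<in> carrier L2" for n by simp
    assume C: "\<forall>e>0. \<exists>k. \<forall>m n. k \<le> m \<longrightarrow> k \<le> n \<longrightarrow> N2 (\<sigma> m \<ominus>\<^bsub>L2\<^esub> \<sigma> n) < e"
    have \<sigma>x: "\<sigma> n x \<in> carrier V" if "x \<in> X" for n x using L2_mem[OF \<sigma> that] .
    have "\<exists>l\<in>carrier V. \<forall>e>0. \<exists>k. \<forall>n\<ge>k. N (\<sigma> n x \<ominus>\<^bsub>V\<^esub> l) < e" if x: "x \<in> X" for x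
    proof -
      have "N (\<sigma> m x \<ominus>\<^bsub>V\<^esub> \<sigma> n x) \<le> N2 (\<sigma> m \<ominus>\<^bsub>L2\<^esub> \<sigma> n)" for m n
        using N_le_N2[OF L.minus_closed[OF \<sigma> \<sigma>] x, of m n] x by (simp add: L2_minus[OF \<sigma> \<sigma>])
      then have "\<forall>e>0. \<exists>k. \<forall>m n. k \<le> m \<longrightarrow> k \<le> n \<longrightarrow> N (\<sigma> m x \<ominus>\<^bsub>V\<^esub> \<sigma> n x) < e"
        using C by (meson order_le_less_trans)
      then show ?thesis using B[unfolded banach_iff, rule_format, of "\<lambda>n. \<sigma> n x"] \<sigma>x[OF x] by blast
    qed
    then obtain l where l: "\<And>x. x \<in> X \<Longrightarrow> l x \<in> carrier V"
      and lim: "\<And>x e. x \<in> X \<Longrightarrow> e > 0 \<Longrightarrow> \<exists>k. \<forall>n\<ge>k. N (\<sigma> n x \<ominus>\<^bsub>V\<^esub> l x) < e"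
      by metis
    have tends: "(\<lambda>m. N (\<sigma> n x \<ominus>\<^bsub>V\<^esub> \<sigma> m x)) \<longlonglongrightarrow> N (\<sigma> n x \<ominus>\<^bsub>V\<^esub> l x)" if x: "x \<in> X" for n x
    proof (rule LIMSEQ_I)
      fix e :: real assume "e > 0"
      then obtain k where k: "\<And>m. m \<ge> k \<Longrightarrow> N (\<sigma> m x \<ominus>\<^bsub>V\<^esub> l x) < e" using lim[OF x] by blast
      have "norm (N (\<sigma> n x \<ominus>\<^bsub>V\<^esub> \<sigma> m x) - N (\<sigma> n x \<ominus>\<^bsub>V\<^esub> l x)) \<le> N (\<sigma> m x \<ominus>\<^bsub>V\<^esub> l x)" for m
        using N_minus_triangle[OF \<sigma>x[OF x, of n] \<sigma>x[OF x, of m] l[OF x]]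
          N_minus_triangle[OF \<sigma>x[OF x, of n] l[OF x] \<sigma>x[OF x, of m]] N_commute[OF \<sigma>x[OF x, of m] l[OF x]]
        by (simp add: abs_le_iff)
      then show "\<exists>k. \<forall>m\<ge>k. norm (N (\<sigma> n x \<ominus>\<^bsub>V\<^esub> \<sigma> m x) - N (\<sigma> n x \<ominus>\<^bsub>V\<^esub> l x)) < e"
        using k by (meson order_le_less_trans)
    qed
    define g where "g = restrict l X"
    let ?d = "\<lambda>n. \<lambda>x\<in>X. \<sigma> n x \<ominus>\<^bsub>V\<^esub> g x"
    have near: "?d n \<in> carrier L2" "N2 (?d n) \<le> e"
      if k: "\<And>m n. k \<le> m \<Longrightarrow> k \<le> n \<Longrightarrow> N2 (\<sigma> m \<ominus>\<^bsub>L2\<^esub> \<sigma> n) < e" and n: "k \<le> n" for k n e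
    proof -
      have le: "L2_set (\<lambda>x. N (?d n x)) F \<le> e" if F: "finite F" "F \<subseteq> X" for F
      proof -
        have "L2_set (\<lambda>x. N (\<sigma> n x \<ominus>\<^bsub>V\<^esub> \<sigma> m x)) F \<le> e" if "m \<ge> k" for m
        proof -
          have "L2_set (\<lambda>x. N (\<sigma> n x \<ominus>\<^bsub>V\<^esub> \<sigma> m x)) F = L2_set (\<lambda>x. N ((\<sigma> n \<ominus>\<^bsub>L2\<^esub> \<sigma> m) x)) F"
            using F by (intro L2_set_cong) (auto simp: L2_minus[OF \<sigma> \<sigma>])
          also have "\<dots> \<le> N2 (\<sigma> n \<ominus>\<^bsub>L2\<^esub> \<sigma> m)" by (rule L2_set_le_N2) (use \<sigma> F in auto)
          finally show ?thesis using k[OF n that] by simp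
        qed
        moreover have "(\<lambda>m. L2_set (\<lambda>x. N (\<sigma> n x \<ominus>\<^bsub>V\<^esub> \<sigma> m x)) F) \<longlonglongrightarrow> L2_set (\<lambda>x. N (\<sigma> n x \<ominus>\<^bsub>V\<^esub> l x)) F"
          unfolding L2_set_def using F tends by (intro tendsto_intros) auto
        ultimately have "L2_set (\<lambda>x. N (\<sigma> n x \<ominus>\<^bsub>V\<^esub> l x)) F \<le> e"
          by (intro LIMSEQ_le_const2) blast+
        moreover have "L2_set (\<lambda>x. N (?d n x)) F = L2_set (\<lambda>x. N (\<sigma> n x \<ominus>\<^bsub>V\<^esub> l x)) F"
          using F by (intro L2_set_cong) (auto simp: g_def)
        ultimately show ?thesis by simp
      qed
      have mem: "?d n \<in> X \<rightarrow>\<^sub>E carrier V" using l \<sigma>x by (auto simp: g_def)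
      show "?d n \<in> carrier L2" by (rule L2I(1)[OF mem]) (rule le)
      show "N2 (?d n) \<le> e" by (rule L2I(2)[OF mem]) (rule le)
    qed
    have g: "g \<in> carrier L2"
    proof -
      obtain k where k: "\<And>m n. k \<le> m \<Longrightarrow> k \<le> n \<Longrightarrow> N2 (\<sigma> m \<ominus>\<^bsub>L2\<^esub> \<sigma> n) < 1"
        using C[rule_format, of 1] by auto
      have d: "?d k \<in> carrier L2" by (rule near(1)[OF k order_refl])
      have eq: "g = \<sigma> k \<ominus>\<^bsub>L2\<^esub> ?d k"
        unfolding L2_minus[OF \<sigma> d]
        by (rule ext) (use l \<sigma>x in \<open>simp add: g_def\<close>)
      show ?thesis by (subst eq) (rule L.minus_closed[OF \<sigma> d])
    qed
    have "\<exists>k. \<forall>n\<ge>k. N2 (\<sigma> n \<ominus>\<^bsub>L2\<^esub> g) < e" if e: "e > 0" for e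
    proof -
      obtain k where k: "\<And>m n. k \<le> m \<Longrightarrow> k \<le> n \<Longrightarrow> N2 (\<sigma> m \<ominus>\<^bsub>L2\<^esub> \<sigma> n) < e / 2"
        using C e by (meson half_gt_zero)
      have "N2 (\<sigma> n \<ominus>\<^bsub>L2\<^esub> g) < e" if "n \<ge> k" for n
        using near(2)[OF k that] e by (simp add: L2_minus[OF \<sigma> g])
      then show ?thesis by blast
    qed
    then show "\<exists>g\<in>carrier L2. \<forall>e>0. \<exists>k. \<forall>n\<ge>k. N2 (\<sigma> n \<ominus>\<^bsub>L2\<^esub> g) < e" using g by blast
  qed
qed

end

end

section \<open>Hilbert spaces and reflexivity\<close>

locale real_inner_space = real_space V for V :: "(real, 'v, 'y) module_scheme" +
  fixes ip :: "'v \<Rightarrow> 'v \<Rightarrow> real"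
  assumes inner: "inner_product_space V ip"
begin

abbreviation "N \<equiv> inner_norm ip"

sublocale real_normed V N
  by (rule real_normedI[OF normed_space_inner_norm[OF inner]])

lemma ip_commute: "x \<in> carrier V \<Longrightarrow> y \<in> carrier V \<Longrightarrow> ip x y = ip y x"
  using inner unfolding inner_product_space_def by blast

lemma ip_add: "x \<in> carrier V \<Longrightarrow> y \<in> carrier V \<Longrightarrow> z \<in> carrier V \<Longrightarrow>
    ip (x \<oplus>\<^bsub>V\<^esub> y) z = ip x z + ip y z"
  using inner unfolding inner_product_space_def by blast

lemma ip_smult: "x \<in> carrier V \<Longrightarrow> y \<in> carrier V \<Longrightarrow> ip (a \<odot>\<^bsub>V\<^esub> x) y = a * ip x y"
  using inner unfolding inner_product_space_def by blast

lemma ip_add_right: "x \<in> carrier V \<Longrightarrow> y \<in> carrier V \<Longrightarrow> z \<in> carrier V \<Longrightarrow>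
    ip z (x \<oplus>\<^bsub>V\<^esub> y) = ip z x + ip z y"
  using ip_add[of x y z] ip_commute[of z] by simp

lemma ip_smult_right: "x \<in> carrier V \<Longrightarrow> y \<in> carrier V \<Longrightarrow> ip y (a \<odot>\<^bsub>V\<^esub> x) = a * ip y x"
  using ip_smult[of x y a] ip_commute[of y] by simp

lemma ip_zero [simp]: "x \<in> carrier V \<Longrightarrow> ip x \<zero>\<^bsub>V\<^esub> = 0" "x \<in> carrier V \<Longrightarrow> ip \<zero>\<^bsub>V\<^esub> x = 0"
  using ip_smult[of "\<zero>\<^bsub>V\<^esub>" x 0] ip_commute[of x "\<zero>\<^bsub>V\<^esub>"] by auto

lemma ip_pos: "x \<in> carrier V \<Longrightarrow> x \<noteq> \<zero>\<^bsub>V\<^esub> \<Longrightarrow> 0 < ip x x"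
  using inner unfolding inner_product_space_def by blast

lemma ip_self: "x \<in> carrier V \<Longrightarrow> ip x x = (N x)\<^sup>2"
  using ip_pos[of x] by (cases "x = \<zero>\<^bsub>V\<^esub>") (auto simp: inner_norm_def)

lemma N_add_sq: "x \<in> carrier V \<Longrightarrow> y \<in> carrier V \<Longrightarrow>
    (N (x \<oplus>\<^bsub>V\<^esub> y))\<^sup>2 = (N x)\<^sup>2 + 2 * ip x y + (N y)\<^sup>2"
  using ip_commute[of y x] by (simp flip: ip_self add: ip_add ip_add_right)

lemma N_minus_sq: "x \<in> carrier V \<Longrightarrow> y \<in> carrier V \<Longrightarrow>
    (N (x \<ominus>\<^bsub>V\<^esub> y))\<^sup>2 = (N x)\<^sup>2 - 2 * ip x y + (N y)\<^sup>2"
  using N_add_sq[of x "(-1) \<odot>\<^bsub>V\<^esub> y"] by (simp add: minus_eq ip_smult_right N_smult)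

lemma Cauchy_Schwarz: "x \<in> carrier V \<Longrightarrow> y \<in> carrier V \<Longrightarrow> \<bar>ip x y\<bar> \<le> N x * N y"
proof -
  have *: "ip x y \<le> N x * N y" if "x \<in> carrier V" "y \<in> carrier V" for x y
  proof -
    have "(N (x \<oplus>\<^bsub>V\<^esub> y))\<^sup>2 \<le> (N x + N y)\<^sup>2" using that N_triangle by (intro power_mono) auto
    then show ?thesis using that by (simp add: N_add_sq power2_sum)
  qed
  assume "x \<in> carrier V" "y \<in> carrier V"
  then show ?thesis using *[of x y] *[of "(-1) \<odot>\<^bsub>V\<^esub> x" y] by (simp add: ip_smult N_smult)
qed

text \<open>The representing vector minimises \<open>\<lambda>x. (N x)\<^sup>2 - 2 * f x\<close>. By the parallelogram law any two near-minimisers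
  are close to each other, so completeness gives a minimiser; its first variation vanishes.\<close>

lemma Riesz_representation:
  assumes B: "banach_space V N" and f: "f \<in> carrier (dual_space V N)"
  obtains z where "z \<in> carrier V" "\<And>x. x \<in> carrier V \<Longrightarrow> f x = ip x z"
proof -
  have f_add: "f (x \<oplus>\<^bsub>V\<^esub> y) = f x + f y" if "x \<in> carrier V" "y \<in> carrier V" for x y
    using f that by (simp add: dual_space_def)
  have f_smult: "f (a \<odot>\<^bsub>V\<^esub> x) = a * f x" if "x \<in> carrier V" for a x
    using f that by (simp add: dual_space_def)
  define C where "C = dual_norm V N f"
  have fC: "\<bar>f x\<bar> \<le> C * N x" if "x \<in> carrier V" for x
    unfolding C_def by (rule abs_le_dual_norm[OF normed f that])
  define J where "J x = (N x)\<^sup>2 - 2 * f x" for x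
  have J_ge: "J x \<ge> - C\<^sup>2" if "x \<in> carrier V" for x
  proof -
    have "0 \<le> (N x - C)\<^sup>2" by simp
    then show ?thesis using fC[OF that] by (simp add: J_def power2_diff algebra_simps)
  qed
  define m where "m = (INF x\<in>carrier V. J x)"
  have bdd: "bdd_below (J ` carrier V)" using J_ge by (auto intro!: bdd_belowI2)
  have m_le: "m \<le> J x" if "x \<in> carrier V" for x
    unfolding m_def by (rule cINF_lower[OF bdd that])
  have near: "\<exists>x\<in>carrier V. J x < m + e" if "e > 0" for e
  proof -
    have "carrier V \<noteq> {}" using Mod.M.zero_closed by blast
    then show ?thesis using cINF_less_iff[OF _ bdd, of "m + e"] that by (simp add: m_def)
  qed
  have close: "(N (x \<ominus>\<^bsub>V\<^esub> y))\<^sup>2 \<le> 2 * (J x - m) + 2 * (J y - m)"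
    if x: "x \<in> carrier V" and y: "y \<in> carrier V" for x y
  proof -
    (* the parallelogram law, with the midpoint bounded below by the infimum *)
    let ?h = "(1 / 2) \<odot>\<^bsub>V\<^esub> (x \<oplus>\<^bsub>V\<^esub> y)"
    have "J ?h = (N (x \<oplus>\<^bsub>V\<^esub> y))\<^sup>2 / 4 - (f x + f y)"
      using x y by (simp add: J_def N_smult f_smult f_add power_divide add_divide_distrib)
    moreover have "m \<le> J ?h" using m_le x y by simp
    ultimately show ?thesis using x y
      by (simp add: J_def N_add_sq N_minus_sq field_simps)
  qed
  have ex: "\<exists>x. x \<in> carrier V \<and> J x < m + 1 / Suc n" for n :: nat
  proof -
    have "0 < 1 / real (Suc n)" by simp
    from near[OF this] show ?thesis by blast
  qed
  define s where "s n = (SOME x. x \<in> carrier V \<and> J x < m + 1 / Suc n)" for n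
  have s: "s n \<in> carrier V" "J (s n) < m + 1 / Suc n" for n
    using someI_ex[OF ex[of n]] by (simp_all add: s_def)
  have small: "\<exists>k. \<forall>n\<ge>k. J (s n) < m + e" if e: "e > 0" for e
  proof -
    obtain k where k: "1 / Suc k < e" by (rule nat_approx_posE[OF e])
    have "J (s n) < m + e" if "n \<ge> k" for n
    proof -
      have "1 / real (Suc n) \<le> 1 / Suc k" using that by (simp add: frac_le)
      then show ?thesis using s(2)[of n] k by linarith
    qed
    then show ?thesis by blast
  qed
  have "\<exists>k. \<forall>i j. k \<le> i \<longrightarrow> k \<le> j \<longrightarrow> N (s i \<ominus>\<^bsub>V\<^esub> s j) < e" if e: "e > 0" for e
  proof -
    obtain k where k: "\<And>n. n \<ge> k \<Longrightarrow> J (s n) < m + e\<^sup>2 / 4" using small[of "e\<^sup>2 / 4"] e by auto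
    have "N (s i \<ominus>\<^bsub>V\<^esub> s j) < e" if "k \<le> i" "k \<le> j" for i j
    proof -
      have "(N (s i \<ominus>\<^bsub>V\<^esub> s j))\<^sup>2 < e\<^sup>2"
        using close[OF s(1) s(1), of i j] k[OF that(1)] k[OF that(2)] by argo
      then show ?thesis using e by (simp add: power2_less_imp_less)
    qed
    then show ?thesis by blast
  qed
  then obtain z where z: "z \<in> carrier V" and lim: "\<And>e. e > 0 \<Longrightarrow> \<exists>k. \<forall>n\<ge>k. N (s n \<ominus>\<^bsub>V\<^esub> z) < e"
    using B[unfolded banach_iff, rule_format, of s] s(1) by blast
  have "J z \<le> m"
  proof (rule LIMSEQ_le_const2)
    have 1: "(\<lambda>n. N (s n \<ominus>\<^bsub>V\<^esub> z)) \<longlonglongrightarrow> 0"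
      using lim s(1) z by (auto intro!: LIMSEQ_I)
    show "(\<lambda>n. J z - (2 * N z + 2 * C) * N (s n \<ominus>\<^bsub>V\<^esub> z) - 1 / Suc n) \<longlonglongrightarrow>
        J z"
    proof -
      have "(\<lambda>n. J z - (2 * N z + 2 * C) * N (s n \<ominus>\<^bsub>V\<^esub> z) - 1 / Suc n) \<longlonglongrightarrow>
          J z - (2 * N z + 2 * C) * 0 - 0"
        by (intro tendsto_intros 1 LIMSEQ_Suc[OF lim_1_over_n])
      then show ?thesis by simp
    qed
    have "J z - (2 * N z + 2 * C) * N (s n \<ominus>\<^bsub>V\<^esub> z) - 1 / Suc n \<le> m" for n
    proof -
      (* J z exceeds J (s n) by at most a multiple of their distance, so the limit is a minimiser *)
      let ?d = "s n \<ominus>\<^bsub>V\<^esub> z"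
      have d: "?d \<in> carrier V" using s(1) z by simp
      have sn: "s n = z \<oplus>\<^bsub>V\<^esub> ?d" using s(1) z d minus_add_cancel[of "s n" z] by (metis Mod.M.a_comm)
      have "J (s n) = (N z)\<^sup>2 + 2 * ip z ?d + (N ?d)\<^sup>2 - 2 * f z - 2 * f ?d"
        by (subst sn) (simp add: J_def N_add_sq f_add z d)
      then have "J z - J (s n) \<le> 2 * \<bar>ip z ?d\<bar> + 2 * \<bar>f ?d\<bar>"
        unfolding J_def[of z] using zero_le_power2[of "N ?d"] by linarith
      also have "\<dots> \<le> 2 * (N z * N ?d) + 2 * (C * N ?d)"
        using Cauchy_Schwarz[OF z d] fC[OF d] by linarith
      also have "\<dots> \<le> (2 * N z + 2 * C) * N ?d"
        using d by (simp add: algebra_simps)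
      finally show ?thesis using s(2)[of n] by linarith
    qed
    then show "\<exists>k. \<forall>n\<ge>k. J z - (2 * N z + 2 * C) * N (s n \<ominus>\<^bsub>V\<^esub> z) - 1 / Suc n \<le> m"
      by blast
  qed
  then have min: "J z \<le> J x" if "x \<in> carrier V" for x using m_le[OF that] by linarith
  have "f x = ip x z" if x: "x \<in> carrier V" for x
  proof -
    define c where "c = f x - ip x z"
    have le: "2 * t * c \<le> t\<^sup>2 * (N x)\<^sup>2" for t
      using min[of "z \<oplus>\<^bsub>V\<^esub> t \<odot>\<^bsub>V\<^esub> x"] x z ip_commute[OF x z]
      by (simp add: J_def N_add_sq f_add f_smult N_smult ip_smult_right c_def power_mult_distrib algebra_simps)
    have "c = 0"
    proof (cases "N x = 0")
      case True
      then show ?thesis using le[of 1] le[of "-1"] by simp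
    next
      case False
      (* the value of t for which the quadratic bound is tightest *)
      define n where "n = (N x)\<^sup>2"
      have "2 * (c / n) * c \<le> (c / n)\<^sup>2 * n" unfolding n_def by (rule le)
      moreover have "2 * (c / n) * c = 2 * (c\<^sup>2 / n)" "(c / n)\<^sup>2 * n = c\<^sup>2 / n"
        using False by (simp_all add: n_def power2_eq_square)
      ultimately have "c\<^sup>2 / n \<le> 0" by linarith
      then show ?thesis using False by (simp add: divide_le_0_iff n_def)
    qed
    then show ?thesis by (simp add: c_def)
  qed
  then show thesis using that z by blast
qed

text \<open>Pulling a functional on the dual back along \<open>y \<mapsto> ip _ y\<close> gives a functional on the
  space itself, whose representing vector evaluates correctly.\<close>

lemma reflexive_of_banach:
  assumes B: "banach_space V N"
  shows "reflexive_space V N"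
  unfolding reflexive_space_def
proof (intro subset_antisym subsetI)
  show "\<Phi> \<in> carrier (dual_space (dual_space V N) (dual_norm V N))" if "\<Phi> \<in> evaluation V N ` carrier V" for \<Phi>
    using that evaluation_in_bidual[OF normed] by blast
next
  fix \<Phi> assume \<Phi>: "\<Phi> \<in> carrier (dual_space (dual_space V N) (dual_norm V N))"
  let ?D = "dual_space V N"
  interpret D: real_normed ?D "dual_norm V N" by (rule real_normedI[OF normed_space_dual[OF normed]])
  have \<Phi>_add: "\<Phi> (f \<oplus>\<^bsub>?D\<^esub> g) = \<Phi> f + \<Phi> g" if "f \<in> carrier ?D" "g \<in> carrier ?D" for f g
    using \<Phi> that by (simp add: dual_space_def[of ?D])
  have \<Phi>_smult: "\<Phi> (a \<odot>\<^bsub>?D\<^esub> f) = a * \<Phi> f" if "f \<in> carrier ?D" for a f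
    using \<Phi> that by (simp add: dual_space_def[of ?D])
  have \<Phi>_out: "\<Phi> f = 0" if "f \<notin> carrier ?D" for f
    using \<Phi> that by (simp add: dual_space_def[of ?D])
  obtain C where C: "\<And>f. f \<in> carrier ?D \<Longrightarrow> \<bar>\<Phi> f\<bar> \<le> C * dual_norm V N f"
    using \<Phi> unfolding dual_space_def[of ?D] by simp blast
  define j where "j y = (\<lambda>x. if x \<in> carrier V then ip x y else 0)" for y
  have j: "j y \<in> carrier ?D" if y: "y \<in> carrier V" for y
    using y Cauchy_Schwarz[OF _ y]
    by (auto simp: dual_space_def j_def ip_add ip_smult mult.commute intro!: exI[of _ "N y"])
  have j_add: "j (x \<oplus>\<^bsub>V\<^esub> y) = j x \<oplus>\<^bsub>?D\<^esub> j y" if "x \<in> carrier V" "y \<in> carrier V" for x y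
    using that by (auto simp: j_def dual_space_def fun_eq_iff ip_add_right)
  have j_smult: "j (a \<odot>\<^bsub>V\<^esub> x) = a \<odot>\<^bsub>?D\<^esub> j x" if "x \<in> carrier V" for a x
    using that by (auto simp: j_def dual_space_def fun_eq_iff ip_smult_right)
  have j_norm: "dual_norm V N (j y) \<le> N y" if y: "y \<in> carrier V" for y
  proof (rule dual_norm_le[OF normed])
    fix x assume x: "x \<in> carrier V" "N x \<le> 1"
    have "\<bar>ip x y\<bar> \<le> N x * N y" using Cauchy_Schwarz x y by blast
    also have "\<dots> \<le> 1 * N y" using x y by (intro mult_right_mono) auto
    finally show "\<bar>j y x\<bar> \<le> N y" using x by (simp add: j_def)
  qed
  define \<psi> where "\<psi> y = (if y \<in> carrier V then \<Phi> (j y) else 0)" for y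
  have "\<psi> \<in> carrier ?D"
  proof -
    have "\<bar>\<psi> y\<bar> \<le> \<bar>C\<bar> * N y" if y: "y \<in> carrier V" for y
    proof -
      have "\<bar>\<psi> y\<bar> \<le> C * dual_norm V N (j y)" using C[OF j[OF y]] y by (simp add: \<psi>_def)
      also have "\<dots> \<le> \<bar>C\<bar> * N y"
        using j_norm[OF y] D.N_nonneg[OF j[OF y]] by (intro mult_mono) auto
      finally show ?thesis .
    qed
    then show ?thesis
      unfolding dual_space_def using j
      by (auto simp: \<psi>_def j_add j_smult \<Phi>_add \<Phi>_smult)
  qed
  then obtain z where z: "z \<in> carrier V" "\<And>y. y \<in> carrier V \<Longrightarrow> \<psi> y = ip y z"
    using Riesz_representation[OF B] by blast
  have "\<Phi> f = evaluation V N z f" for f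
  proof (cases "f \<in> carrier ?D")
    case True
    obtain y where y: "y \<in> carrier V" "\<And>x. x \<in> carrier V \<Longrightarrow> f x = ip x y"
      using Riesz_representation[OF B True] by blast
    have "f x = 0" if "x \<notin> carrier V" for x using True that by (simp add: dual_space_def)
    then have "f = j y" using y by (auto simp: j_def fun_eq_iff)
    then have "\<Phi> f = \<psi> y" using y by (simp add: \<psi>_def)
    also have "\<dots> = f z" using z y ip_commute by simp
    finally show ?thesis using True by (simp add: evaluation_def)
  qed (simp add: \<Phi>_out evaluation_def)
  then show "\<Phi> \<in> evaluation V N ` carrier V" using z(1) by (intro image_eqI[of _ _ z]) auto
qed

subsection \<open>Square-summable functions with values in a Hilbert space\<close>

definition (in -) l2_inner :: "'x set \<Rightarrow> ('v \<Rightarrow> 'v \<Rightarrow> real) \<Rightarrow> ('x \<Rightarrow> 'v) \<Rightarrow> ('x \<Rightarrow> 'v) \<Rightarrow> real"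
  where "l2_inner X ip f g = (\<Sum>\<^sub>\<infinity>x\<in>X. ip (f x) (g x))"

context
  fixes X :: "'x set"
begin

text \<open>Polarisation reduces summability of inner products to summability of squared norms.\<close>

lemma ip_summable:
  assumes f: "f \<in> carrier (L2 X)" and g: "g \<in> carrier (L2 X)"
  shows "(\<lambda>x. ip (f x) (g x)) summable_on X"
proof -
  have "(\<lambda>x. ((N ((f \<oplus>\<^bsub>L2 X\<^esub> g) x))\<^sup>2 + (-1) * ((N (f x))\<^sup>2 + (N (g x))\<^sup>2)) * (1 / 2)) summable_on X"
    by (intro summable_on_add summable_on_cmult_left summable_on_cmult_right)
      (use f g L2_add(1)[OF f g] in \<open>simp_all only: L2_iff\<close>)
  then show ?thesis
    by (rule summable_on_cong[THEN iffD1, rotated])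
      (use L2_mem[OF f] L2_mem[OF g] in \<open>simp add: L2_simps N_add_sq\<close>)
qed

lemma inner_norm_l2: "f \<in> carrier (L2 X) \<Longrightarrow> inner_norm (l2_inner X ip) f = l2_norm X N f"
  unfolding inner_norm_def[of "l2_inner X ip"] l2_inner_def l2_norm_def
  using infsum_cong[of X "\<lambda>x. ip (f x) (f x)" "\<lambda>x. (N (f x))\<^sup>2"] L2_mem[of f] ip_self by simp

lemma hilbert_space_L2:
  assumes B: "banach_space V N"
  shows "hilbert_space (L2 X) (l2_inner X ip)"
proof -
  interpret L: real_normed "L2 X" "N2 X" by (rule real_normedI[OF normed_space_L2])
  let ?L = "L2 X" and ?ip = "l2_inner X ip"
  have I: "inner_product_space ?L ?ip"
    unfolding inner_product_space_def
  proof (intro conjI ballI allI impI)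
    show "Module.module real_ring ?L" by (rule L.module)
    show "?ip f g = ?ip g f" if "f \<in> carrier ?L" "g \<in> carrier ?L" for f g
      unfolding l2_inner_def
      by (rule infsum_cong) (use L2_mem[OF that(1)] L2_mem[OF that(2)] ip_commute in simp)
    show "?ip (f \<oplus>\<^bsub>?L\<^esub> g) h = ?ip f h + ?ip g h"
      if "f \<in> carrier ?L" "g \<in> carrier ?L" "h \<in> carrier ?L" for f g h
    proof -
      have "?ip (f \<oplus>\<^bsub>?L\<^esub> g) h = (\<Sum>\<^sub>\<infinity>x\<in>X. ip (f x) (h x) + ip (g x) (h x))"
        unfolding l2_inner_def
        by (rule infsum_cong) (use L2_mem[OF that(1)] L2_mem[OF that(2)] L2_mem[OF that(3)] in \<open>simp add: L2_simps ip_add\<close>)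
      also have "\<dots> = ?ip f h + ?ip g h"
        unfolding l2_inner_def by (rule infsum_add) (use that ip_summable in auto)
      finally show ?thesis .
    qed
    show "?ip (a \<odot>\<^bsub>?L\<^esub> f) g = a * ?ip f g" if "f \<in> carrier ?L" "g \<in> carrier ?L" for a f g
    proof -
      have "?ip (a \<odot>\<^bsub>?L\<^esub> f) g = (\<Sum>\<^sub>\<infinity>x\<in>X. a * ip (f x) (g x))"
        unfolding l2_inner_def
        by (rule infsum_cong) (use L2_mem[OF that(1)] L2_mem[OF that(2)] in \<open>simp add: L2_simps ip_smult\<close>)
      then show ?thesis by (simp add: l2_inner_def infsum_cmult_right')
    qed
    show "0 < ?ip f f" if f: "f \<in> carrier ?L" "f \<noteq> \<zero>\<^bsub>?L\<^esub>" for f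
    proof -
      have "inner_norm ?ip f \<noteq> 0" using f L.N_zero_iff inner_norm_l2 by simp
      moreover have "0 \<le> ?ip f f"
        unfolding l2_inner_def by (rule infsum_nonneg) (use L2_mem[OF f(1)] ip_self in simp)
      ultimately show ?thesis by (simp add: inner_norm_def)
    qed
  qed
  interpret I: real_normed ?L "inner_norm ?ip" by (rule real_normedI[OF normed_space_inner_norm[OF I]])
  have "banach_space ?L (inner_norm ?ip) \<longleftrightarrow> banach_space ?L (N2 X)"
    unfolding L.banach_iff I.banach_iff
    by (intro all_cong imp_cong refl ex_cong1 bex_cong) (auto simp: inner_norm_l2)
  then show ?thesis using I banach_space_L2[OF B] by (simp add: hilbert_space_def)
qed

end

end

lemma real_inner_spaceI: "inner_product_space V ip \<Longrightarrow> real_inner_space V ip"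
  by (simp add: real_inner_space.intro real_space.intro real_inner_space_axioms.intro inner_product_space_def)

text \<open>The line, as the space of values whose square-summable functions form the usual sequence space.\<close>

definition real_line :: "(real, real) module"
  where "real_line = \<lparr>carrier = UNIV, monoid.mult = undefined, one = undefined,
     ring.zero = 0, add = (+), module.smult = (*)\<rparr>"

lemma real_line_simps [simp]:
  "carrier real_line = UNIV" "\<zero>\<^bsub>real_line\<^esub> = 0" "x \<oplus>\<^bsub>real_line\<^esub> y = x + y" "a \<odot>\<^bsub>real_line\<^esub> x = a * x"
  by (simp_all add: real_line_def)

lemma hilbert_space_real_line: "hilbert_space real_line (*)"
proof -
  have "real_space real_line" by (rule real_spaceI) (auto simp: algebra_simps)
  then have I: "inner_product_space real_line (*)"
    by (auto simp: inner_product_space_def real_space_def algebra_simps zero_less_mult_iff)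
  interpret real_inner_space real_line "(*)" by (rule real_inner_spaceI[OF I])
  have N: "inner_norm (*) x = \<bar>x\<bar>" for x :: real by (simp add: inner_norm_def)
  have "banach_space real_line (inner_norm (*))"
    unfolding banach_iff
  proof (intro allI impI)
    fix \<sigma> :: "nat \<Rightarrow> real"
    assume "\<forall>e>0. \<exists>k. \<forall>m n. k \<le> m \<longrightarrow> k \<le> n \<longrightarrow> inner_norm (*) (\<sigma> m \<ominus>\<^bsub>real_line\<^esub> \<sigma> n) < e"
    then have "Cauchy \<sigma>" unfolding Cauchy_iff by (simp add: N minus_eq) 
    then obtain l where "\<sigma> \<longlonglongrightarrow> l" using Cauchy_convergent convergent_def by blast
    then show "\<exists>x\<in>carrier real_line. \<forall>e>0. \<exists>k. \<forall>n\<ge>k. inner_norm (*) (\<sigma> n \<ominus>\<^bsub>real_line\<^esub> x) < e"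
      by (intro bexI[of _ l]) (auto simp: LIMSEQ_iff N minus_eq)
  qed
  then show ?thesis using I by (simp add: hilbert_space_def)
qed

section \<open>Transport of normed spaces\<close>

text \<open>The ring multiplication and unit of the record are left unspecified, as in \<^const>\<open>dual_space\<close>.\<close>

definition transport_module ::
  "('v \<Rightarrow> 'u) \<Rightarrow> (real, 'v, 'y) module_scheme \<Rightarrow> (real, 'u) module"
  where "transport_module f V =
    \<lparr>carrier = f ` carrier V, monoid.mult = undefined, one = undefined, ring.zero = f \<zero>\<^bsub>V\<^esub>,
     add = (\<lambda>x y. f (inv_into (carrier V) f x \<oplus>\<^bsub>V\<^esub> inv_into (carrier V) f y)),
     module.smult = (\<lambda>a x. f (a \<odot>\<^bsub>V\<^esub> inv_into (carrier V) f x))\<rparr>"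

context real_space
begin

context
  fixes f :: "'v \<Rightarrow> 'u"
  assumes f: "inj_on f (carrier V)"
begin

abbreviation "T \<equiv> transport_module f V"
abbreviation "i \<equiv> inv_into (carrier V) f"

lemma T_simps:
  "carrier T = f ` carrier V" "\<zero>\<^bsub>T\<^esub> = f \<zero>\<^bsub>V\<^esub>"
  "x \<in> carrier V \<Longrightarrow> y \<in> carrier V \<Longrightarrow> f x \<oplus>\<^bsub>T\<^esub> f y = f (x \<oplus>\<^bsub>V\<^esub> y)"
  "x \<in> carrier V \<Longrightarrow> a \<odot>\<^bsub>T\<^esub> f x = f (a \<odot>\<^bsub>V\<^esub> x)"
  using f by (auto simp: transport_module_def)

lemma T_inv: "x \<in> carrier V \<Longrightarrow> i (f x) = x" using f by simp

lemma real_space_T: "real_space T"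
proof (rule real_spaceI)
qed (auto simp: T_simps add_ac smult_add add_smult smult_smult)

lemma T_minus: "x \<in> carrier V \<Longrightarrow> y \<in> carrier V \<Longrightarrow> f x \<ominus>\<^bsub>T\<^esub> f y = f (x \<ominus>\<^bsub>V\<^esub> y)"
  using real_space.minus_eq[OF real_space_T, of "f x" "f y"] by (simp add: T_simps minus_eq)

lemma inner_product_space_T:
  assumes "inner_product_space V ip"
  shows "inner_product_space T (\<lambda>x y. ip (i x) (i y))"
proof -
  interpret I: real_inner_space V ip by (rule real_inner_spaceI[OF assms])
  show ?thesis
    unfolding inner_product_space_def
    using real_space.module[OF real_space_T] f
    by (simp add: T_simps inj_on_eq_iff I.ip_add_right I.ip_smult_right I.ip_pos I.ip_commute)
qed

lemma normed_space_T: "normed_space V N \<Longrightarrow> normed_space T (\<lambda>x. N (i x))"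
  using real_space.module[OF real_space_T] f
  by (simp add: normed_space_def T_simps inj_on_eq_iff)

lemma norm_dist_T: "x \<in> carrier V \<Longrightarrow> y \<in> carrier V \<Longrightarrow>
    norm_dist T (\<lambda>x. N (i x)) (f x) (f y) = norm_dist V N x y"
  by (simp add: norm_dist_def T_simps(1) T_minus T_inv)

lemma banach_space_T:
  assumes B: "banach_space V N"
  shows "banach_space T (\<lambda>x. N (i x))"
proof -
  have n: "normed_space V N" using B by (simp add: banach_space_def)
  interpret V: real_normed V N by (rule real_normedI[OF n])
  interpret T: real_normed T "\<lambda>x. N (i x)" by (rule real_normedI[OF normed_space_T[OF n]])
  show ?thesis unfolding T.banach_iff
  proof (intro allI impI)
    fix \<sigma> :: "nat \<Rightarrow> 'u"
    assume \<sigma>: "\<forall>n. \<sigma> n \<in> carrier T"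
      and C: "\<forall>e>0. \<exists>k. \<forall>m n. k \<le> m \<longrightarrow> k \<le> n \<longrightarrow> N (i (\<sigma> m \<ominus>\<^bsub>T\<^esub> \<sigma> n)) < e"
    have i: "i (\<sigma> n) \<in> carrier V" "f (i (\<sigma> n)) = \<sigma> n" for n
      using \<sigma> by (auto simp: T_simps(1) inv_into_into f_inv_into_f)
    have eq: "i (\<sigma> m \<ominus>\<^bsub>T\<^esub> f x) = i (\<sigma> m) \<ominus>\<^bsub>V\<^esub> x" if "x \<in> carrier V" for m x
      using T_minus[OF i(1)[of m] that] i that by (simp add: T_inv)
    have "i (\<sigma> m \<ominus>\<^bsub>T\<^esub> \<sigma> n) = i (\<sigma> m) \<ominus>\<^bsub>V\<^esub> i (\<sigma> n)" for m n
      using eq[OF i(1)[of n], of m] i(2)[of n] by simp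
    then obtain x where "x \<in> carrier V" "\<forall>e>0. \<exists>k. \<forall>n\<ge>k. N (i (\<sigma> n) \<ominus>\<^bsub>V\<^esub> x) < e"
      using B[unfolded V.banach_iff, rule_format, of "\<lambda>n. i (\<sigma> n)"] C i(1) by auto
    then show "\<exists>x\<in>carrier T. \<forall>e>0. \<exists>k. \<forall>n\<ge>k. N (i (\<sigma> n \<ominus>\<^bsub>T\<^esub> x)) < e"
      by (intro bexI[of _ "f x"]) (auto simp: eq T_simps(1))
  qed
qed

lemma affine_map_T:
  assumes "affine_map V g"
  shows "affine_map T (\<lambda>y\<in>f ` carrier V. f (g (i y)))"
  using assms unfolding affine_map_iff real_space.affine_map_iff[OF real_space_T]
  by (auto simp: T_simps T_inv)

lemma affine_isometric_action_T:
  assumes "affine_isometric_action K V N \<phi>"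
  shows "affine_isometric_action K T (\<lambda>x. N (i x)) (conj_action f (carrier V) \<phi>)"
  unfolding affine_isometric_action_def
proof
  show "isometric_action K (carrier T) (norm_dist T (\<lambda>x. N (i x))) (conj_action f (carrier V) \<phi>)"
    unfolding T_simps(1)
    by (rule isometric_action_conj[where d = "norm_dist V N"])
      (use assms f in \<open>simp_all add: affine_isometric_action_def norm_dist_T\<close>)
  show "\<forall>g\<in>carrier K. affine_map T (conj_action f (carrier V) \<phi> g)"
    using assms affine_map_T
    by (simp add: affine_isometric_action_def conj_action_def[abs_def] cong: restrict_cong)
qed

lemma bounded_orbits_T:
  assumes "normed_space V N" "affine_isometric_action K V N \<phi>"
    and "bounded_orbits K (carrier T) (norm_dist T (\<lambda>x. N (i x))) (conj_action f (carrier V) \<phi>)"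
  shows "bounded_orbits K (carrier V) (norm_dist V N) \<phi>"
  using assms Metric_space_norm_dist[OF normed_space_T[OF assms(1)]]
  by (intro bounded_orbits_conj[OF Metric_space_norm_dist[OF assms(1)], of f "norm_dist T (\<lambda>x. N (i x))"])
    (auto simp: T_simps(1) affine_isometric_action_def isometric_action_def norm_dist_T f)

end

end

lemma property_FH_transfer:
  fixes V :: "(real, 'v, 'y) module_scheme"
  assumes FH: "property_FH TYPE('u) K" and V: "carrier V \<lesssim> (UNIV :: 'u set)"
    and H: "hilbert_space V ip" and A: "affine_isometric_action K V (inner_norm ip) \<phi>"
  shows "bounded_orbits K (carrier V) (norm_dist V (inner_norm ip)) \<phi>"
proof -
  obtain f :: "'v \<Rightarrow> 'u" where f: "inj_on f (carrier V)" using V by (auto simp: lepoll_def)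
  have I: "inner_product_space V ip" and B: "banach_space V (inner_norm ip)"
    using H by (auto simp: hilbert_space_def)
  interpret real_inner_space V ip by (rule real_inner_spaceI[OF I])
  let ?i = "inv_into (carrier V) f"
  have n: "inner_norm (\<lambda>x y. ip (?i x) (?i y)) = (\<lambda>x. inner_norm ip (?i x))"
    by (simp add: inner_norm_def fun_eq_iff)
  show ?thesis
    by (rule bounded_orbits_T[OF f normed A])
      (use FH inner_product_space_T[OF f I] banach_space_T[OF f B] affine_isometric_action_T[OF f A]
       in \<open>simp add: property_FH_def hilbert_space_def n[symmetric]\<close>)
qed

section \<open>Reflexivity of finite powers\<close>

text \<open>A space assembled from finitely many copies of a reflexive space by linear contractions is
  reflexive: a functional on the dual restricts along each projection to a functional on the dual
  of the copy, hence to evaluation at a vector, and these vectors are the coordinates of the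
  vector sought. The case of one copy says that reflexivity is invariant under isometric
  isomorphism.\<close>

lemma reflexive_of_finite_family:
  fixes V :: "(real, 'v, 'y) module_scheme" and W :: "(real, 'w, 'z) module_scheme"
  assumes V: "normed_space V N" and W: "normed_space W M" and R: "reflexive_space V N"
    and X: "finite X"
    and p: "\<And>x w. x \<in> X \<Longrightarrow> w \<in> carrier W \<Longrightarrow> p x w \<in> carrier V"
    and p_add: "\<And>x w w'. x \<in> X \<Longrightarrow> w \<in> carrier W \<Longrightarrow> w' \<in> carrier W \<Longrightarrow>
      p x (w \<oplus>\<^bsub>W\<^esub> w') = p x w \<oplus>\<^bsub>V\<^esub> p x w'"
    and p_smult: "\<And>x a w. x \<in> X \<Longrightarrow> w \<in> carrier W \<Longrightarrow> p x (a \<odot>\<^bsub>W\<^esub> w) = a \<odot>\<^bsub>V\<^esub> p x w"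
    and p_le: "\<And>x w. x \<in> X \<Longrightarrow> w \<in> carrier W \<Longrightarrow> N (p x w) \<le> M w"
    and q: "\<And>x v. x \<in> X \<Longrightarrow> v \<in> carrier V \<Longrightarrow> q x v \<in> carrier W"
    and q_add: "\<And>x v v'. x \<in> X \<Longrightarrow> v \<in> carrier V \<Longrightarrow> v' \<in> carrier V \<Longrightarrow>
      q x (v \<oplus>\<^bsub>V\<^esub> v') = q x v \<oplus>\<^bsub>W\<^esub> q x v'"
    and q_smult: "\<And>x a v. x \<in> X \<Longrightarrow> v \<in> carrier V \<Longrightarrow> q x (a \<odot>\<^bsub>V\<^esub> v) = a \<odot>\<^bsub>W\<^esub> q x v"
    and q_le: "\<And>x v. x \<in> X \<Longrightarrow> v \<in> carrier V \<Longrightarrow> M (q x v) \<le> N v"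
    and tuple: "\<And>v. (\<And>x. x \<in> X \<Longrightarrow> v x \<in> carrier V) \<Longrightarrow> \<exists>w\<in>carrier W. \<forall>x\<in>X. p x w = v x"
    and decomp: "\<And>f w. f \<in> carrier (dual_space W M) \<Longrightarrow> w \<in> carrier W \<Longrightarrow> f w = (\<Sum>x\<in>X. f (q x (p x w)))"
  shows "reflexive_space W M"
  unfolding reflexive_space_def
proof (intro subset_antisym subsetI)
  show "\<Phi> \<in> carrier (dual_space (dual_space W M) (dual_norm W M))" if "\<Phi> \<in> evaluation W M ` carrier W" for \<Phi>
    using that evaluation_in_bidual[OF W] by blast
next
  interpret V: real_normed V N by (rule real_normedI[OF V])
  interpret W: real_normed W M by (rule real_normedI[OF W])
  let ?V = "dual_space V N" and ?W = "dual_space W M"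
  interpret DV: real_normed ?V "dual_norm V N" by (rule real_normedI[OF normed_space_dual[OF V]])
  interpret DW: real_normed ?W "dual_norm W M" by (rule real_normedI[OF normed_space_dual[OF W]])
  fix \<Phi> assume \<Phi>: "\<Phi> \<in> carrier (dual_space ?W (dual_norm W M))"
  have \<Phi>_add: "\<Phi> (f \<oplus>\<^bsub>?W\<^esub> g) = \<Phi> f + \<Phi> g" if "f \<in> carrier ?W" "g \<in> carrier ?W" for f g
    using \<Phi> that by (simp add: dual_space_def[of ?W])
  have \<Phi>_smult: "\<Phi> (a \<odot>\<^bsub>?W\<^esub> f) = a * \<Phi> f" if "f \<in> carrier ?W" for a f
    using \<Phi> that by (simp add: dual_space_def[of ?W])
  have \<Phi>_out: "\<Phi> f = 0" if "f \<notin> carrier ?W" for f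
    using \<Phi> that by (simp add: dual_space_def[of ?W])
  obtain C where C: "\<And>f. f \<in> carrier ?W \<Longrightarrow> \<bar>\<Phi> f\<bar> \<le> C * dual_norm W M f"
    using \<Phi> unfolding dual_space_def[of ?W] by simp blast
  have dual: "f x = 0" "y \<in> carrier V \<Longrightarrow> z \<in> carrier V \<Longrightarrow> f (y \<oplus>\<^bsub>V\<^esub> z) = f y + f z"
      "y \<in> carrier V \<Longrightarrow> f (a \<odot>\<^bsub>V\<^esub> y) = a * f y"
    if "f \<in> carrier ?V" "x \<notin> carrier V" for f x y z a
    using that by (auto simp: dual_space_def)
  have V_ops: "f \<oplus>\<^bsub>?V\<^esub> g = (\<lambda>x. f x + g x)" "a \<odot>\<^bsub>?V\<^esub> f = (\<lambda>x. a * f x)" for f g a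
    by (simp_all add: dual_space_def)
  have W_ops: "f \<oplus>\<^bsub>?W\<^esub> g = (\<lambda>x. f x + g x)" "a \<odot>\<^bsub>?W\<^esub> f = (\<lambda>x. a * f x)" for f g a
    by (simp_all add: dual_space_def)
  (* precomposition with the projections and with the injections *)
  define P where "P x f = (\<lambda>w. if w \<in> carrier W then f (p x w) else 0)" for x and f :: "'v \<Rightarrow> real"
  define Q where "Q x f = (\<lambda>v. if v \<in> carrier V then f (q x v) else 0)" for x and f :: "'w \<Rightarrow> real"
  have P_le: "\<bar>P x f w\<bar> \<le> dual_norm V N f * M w" if "x \<in> X" "f \<in> carrier ?V" "w \<in> carrier W" for x f w
  proof -
    have "\<bar>f (p x w)\<bar> \<le> dual_norm V N f * N (p x w)"
      using abs_le_dual_norm[OF V that(2) p[OF that(1,3)]] .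
    also have "\<dots> \<le> dual_norm V N f * M w"
      using p_le[OF that(1,3)] DV.N_nonneg[OF that(2)] by (intro mult_left_mono) auto
    finally show ?thesis using that by (simp add: P_def)
  qed
  have P: "P x f \<in> carrier ?W" if x: "x \<in> X" and f: "f \<in> carrier ?V" for x f
  proof -
    have "\<exists>C. \<forall>w\<in>carrier W. \<bar>P x f w\<bar> \<le> C * M w" using P_le[OF x f] by blast
    then show ?thesis
      unfolding dual_space_def using f x p
      by (auto simp: P_def p_add p_smult dual_space_def)
  qed
  have P_norm: "dual_norm W M (P x f) \<le> dual_norm V N f" if x: "x \<in> X" and f: "f \<in> carrier ?V" for x f
  proof (rule dual_norm_le[OF W])
    fix w assume w: "w \<in> carrier W" "M w \<le> 1"
    have "dual_norm V N f * M w \<le> dual_norm V N f * 1"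
      using w DV.N_nonneg[OF f] by (intro mult_left_mono) auto
    then show "\<bar>P x f w\<bar> \<le> dual_norm V N f" using P_le[OF x f w(1)] by simp
  qed
  have Q: "Q x f \<in> carrier ?V" if x: "x \<in> X" and f: "f \<in> carrier ?W" for x f
  proof -
    have "\<bar>Q x f v\<bar> \<le> dual_norm W M f * N v" if v: "v \<in> carrier V" for v
    proof -
      have "\<bar>f (q x v)\<bar> \<le> dual_norm W M f * M (q x v)" using abs_le_dual_norm[OF W f q[OF x v]] .
      also have "\<dots> \<le> dual_norm W M f * N v"
        using q_le[OF x v] DW.N_nonneg[OF f] by (intro mult_left_mono) auto
      finally show ?thesis using v by (simp add: Q_def)
    qed
    then have "\<exists>C. \<forall>v\<in>carrier V. \<bar>Q x f v\<bar> \<le> C * N v" by blast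
    then show ?thesis
      unfolding dual_space_def using f x q
      by (auto simp: Q_def q_add q_smult dual_space_def)
  qed
  have "\<exists>v\<in>carrier V. \<forall>f\<in>carrier ?V. \<Phi> (P x f) = f v" if x: "x \<in> X" for x
  proof -
    define \<Psi> where "\<Psi> f = (if f \<in> carrier ?V then \<Phi> (P x f) else 0)" for f
    have "\<bar>\<Psi> f\<bar> \<le> \<bar>C\<bar> * dual_norm V N f" if f: "f \<in> carrier ?V" for f
    proof -
      have "\<bar>\<Psi> f\<bar> \<le> C * dual_norm W M (P x f)" using C[OF P[OF x f]] f by (simp add: \<Psi>_def)
      also have "\<dots> \<le> \<bar>C\<bar> * dual_norm V N f"
        using P_norm[OF x f] DW.N_nonneg[OF P[OF x f]] by (intro mult_mono) auto
      finally show ?thesis .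
    qed
    moreover have "\<Psi> (f \<oplus>\<^bsub>?V\<^esub> g) = \<Psi> f + \<Psi> g" if f: "f \<in> carrier ?V" and g: "g \<in> carrier ?V" for f g
    proof -
      have "P x (f \<oplus>\<^bsub>?V\<^esub> g) = P x f \<oplus>\<^bsub>?W\<^esub> P x g" by (auto simp: P_def V_ops W_ops)
      moreover have "f \<oplus>\<^bsub>?V\<^esub> g \<in> carrier ?V" using f g by (rule DV.Mod.M.add.m_closed)
      ultimately show ?thesis using f g P[OF x] \<Phi>_add by (simp add: \<Psi>_def)
    qed
    moreover have "\<Psi> (a \<odot>\<^bsub>?V\<^esub> f) = a * \<Psi> f" if f: "f \<in> carrier ?V" for a f
    proof -
      have "P x (a \<odot>\<^bsub>?V\<^esub> f) = a \<odot>\<^bsub>?W\<^esub> P x f" by (auto simp: P_def V_ops W_ops)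
      then show ?thesis using f P[OF x] \<Phi>_smult DV.smult_closed[OF f] by (simp add: \<Psi>_def)
    qed
    moreover have "\<Psi> f = 0" if "f \<notin> carrier ?V" for f using that by (simp add: \<Psi>_def)
    ultimately have "\<Psi> \<in> carrier (dual_space ?V (dual_norm V N))"
      unfolding dual_space_def[of ?V] by auto
    then obtain v where "v \<in> carrier V" "\<Psi> = evaluation V N v"
      using R unfolding reflexive_space_def by blast
    then show ?thesis by (intro bexI[of _ v] ballI) (auto simp: \<Psi>_def evaluation_def fun_eq_iff split: if_splits)
  qed
  then obtain v where v: "\<And>x. x \<in> X \<Longrightarrow> v x \<in> carrier V"
    and \<Phi>v: "\<And>x f. x \<in> X \<Longrightarrow> f \<in> carrier ?V \<Longrightarrow> \<Phi> (P x f) = f (v x)"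
    by metis
  obtain w where w: "w \<in> carrier W" "\<And>x. x \<in> X \<Longrightarrow> p x w = v x" using tuple[of v] v by blast
  have sum: "(\<lambda>u. \<Sum>x\<in>S. P x (Q x f) u) \<in> carrier ?W \<and>
      \<Phi> (\<lambda>u. \<Sum>x\<in>S. P x (Q x f) u) = (\<Sum>x\<in>S. \<Phi> (P x (Q x f)))"
    if "finite S" "S \<subseteq> X" and f: "f \<in> carrier ?W" for S f
    using that(1,2)
  proof (induction S)
    case empty
    have "(\<lambda>_. 0) = 0 \<odot>\<^bsub>?W\<^esub> f" by (simp add: W_ops)
    then show ?case using \<Phi>_smult[OF f, of 0] DW.smult_closed[OF f, of 0] by simp
  next
    case (insert x S)
    let ?s = "\<lambda>u. \<Sum>x\<in>S. P x (Q x f) u"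
    have x: "x \<in> X" and IH: "?s \<in> carrier ?W" "\<Phi> ?s = (\<Sum>x\<in>S. \<Phi> (P x (Q x f)))" using insert by auto
    have Px: "P x (Q x f) \<in> carrier ?W" using P Q x f by blast
    have "(\<lambda>u. \<Sum>x\<in>insert x S. P x (Q x f) u) = P x (Q x f) \<oplus>\<^bsub>?W\<^esub> ?s"
      using insert.hyps by (simp add: W_ops)
    then show ?case
      using \<Phi>_add[OF Px IH(1)] DW.Mod.M.add.m_closed[OF Px IH(1)] IH(2) insert.hyps by simp
  qed
  have "\<Phi> f = evaluation W M w f" for f
  proof (cases "f \<in> carrier ?W")
    case f: True
    have "f = (\<lambda>u. \<Sum>x\<in>X. P x (Q x f) u)"
    proof
      fix u show "f u = (\<Sum>x\<in>X. P x (Q x f) u)"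
      proof (cases "u \<in> carrier W")
        case True
        then show ?thesis using decomp[OF f True] p by (simp add: P_def Q_def cong: sum.cong)
      next
        case False
        then show ?thesis using f by (simp add: P_def dual_space_def)
      qed
    qed
    then have "\<Phi> f = (\<Sum>x\<in>X. \<Phi> (P x (Q x f)))" using sum[OF X subset_refl f] by simp
    also have "\<dots> = (\<Sum>x\<in>X. f (q x (p x w)))"
      using \<Phi>v Q[OF _ f] v w(2) by (intro sum.cong) (auto simp: Q_def)
    also have "\<dots> = f w" using decomp[OF f w(1)] by simp
    finally show ?thesis using f by (simp add: evaluation_def)
  qed (simp add: \<Phi>_out evaluation_def)
  then show "\<Phi> \<in> evaluation W M ` carrier W" using w(1) by (intro image_eqI[of _ _ w]) auto
qed

context real_normed
begin

lemma reflexive_T: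
  assumes f: "inj_on f (carrier V)" and R: "reflexive_space V N"
  shows "reflexive_space (T f) (\<lambda>x. N (i f x))"
  by (rule reflexive_of_finite_family[OF normed normed_space_T[OF f normed] R,
        where X = "{()}" and p = "\<lambda>_. i f" and q = "\<lambda>_. f"])
    (use f in \<open>auto simp: T_simps[OF f]\<close>)

lemma reflexive_L2:
  fixes X :: "'x set"
  assumes X: "finite X" and R: "reflexive_space V N"
  shows "reflexive_space (L2 X) (N2 X)"
proof -
  interpret L: real_normed "L2 X" "N2 X" by (rule real_normedI[OF normed_space_L2])
  let ?q = "\<lambda>x v. \<lambda>y\<in>X. if y = x then v else \<zero>\<^bsub>V\<^esub>"
  have mem: "f \<in> carrier (L2 X)" if "f \<in> X \<rightarrow>\<^sub>E carrier V" for f using that X by (simp add: L2_iff)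
  have q: "?q x v \<in> carrier (L2 X)" if "v \<in> carrier V" for x v
    by (rule mem) (use that in auto)
  show ?thesis
  proof (rule reflexive_of_finite_family[OF normed normed_space_L2 R X,
        where p = "\<lambda>x f. f x" and q = ?q])
    show "N2 X (?q x v) \<le> N v" if x: "x \<in> X" and v: "v \<in> carrier V" for x v
    proof -
      have "(\<Sum>y\<in>X. (N (?q x v y))\<^sup>2) = (\<Sum>y\<in>X. if y = x then (N v)\<^sup>2 else 0)"
        by (rule sum.cong) auto
      also have "\<dots> = (N v)\<^sup>2" using X x by simp
      finally show ?thesis using X v by (simp add: l2_norm_def)
    qed
    show "\<exists>f\<in>carrier (L2 X). \<forall>x\<in>X. f x = v x" if "\<And>x. x \<in> X \<Longrightarrow> v x \<in> carrier V" for v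
      by (rule bexI[of _ "restrict v X"]) (use that in \<open>auto intro!: mem\<close>)
    show "F f = (\<Sum>x\<in>X. F (?q x (f x)))" if F: "F \<in> carrier (dual_space (L2 X) (N2 X))" and f: "f \<in> carrier (L2 X)" for F f
    proof -
      have F_add: "F (g \<oplus>\<^bsub>L2 X\<^esub> h) = F g + F h" if "g \<in> carrier (L2 X)" "h \<in> carrier (L2 X)" for g h
        using F that by (simp add: dual_space_def)
      have F_smult: "F (a \<odot>\<^bsub>L2 X\<^esub> g) = a * F g" if "g \<in> carrier (L2 X)" for a g
        using F that by (simp add: dual_space_def)
      note fV = L2_mem[OF f]
      have "F (\<lambda>y\<in>X. if y \<in> S then f y else \<zero>\<^bsub>V\<^esub>) = (\<Sum>x\<in>S. F (?q x (f x)))" if "finite S" "S \<subseteq> X" for S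
        using that
      proof (induction S)
        case empty
        have "(\<lambda>y\<in>X. if y \<in> {} then f y else \<zero>\<^bsub>V\<^esub>) = 0 \<odot>\<^bsub>L2 X\<^esub> f"
          using fV by (auto simp: L2_simps fun_eq_iff)
        then show ?case using F_smult[OF f, of 0] by simp
      next
        case (insert x S)
        let ?g = "\<lambda>y\<in>X. if y \<in> S then f y else \<zero>\<^bsub>V\<^esub>"
        have "?g \<in> carrier (L2 X)" by (rule mem) (use fV in auto)
        moreover have "?q x (f x) \<in> carrier (L2 X)" using q fV insert.prems by simp
        moreover have eq: "(\<lambda>y\<in>X. if y \<in> insert x S then f y else \<zero>\<^bsub>V\<^esub>) = ?q x (f x) \<oplus>\<^bsub>L2 X\<^esub> ?g"
          using fV insert by (auto simp: L2_simps fun_eq_iff)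
        ultimately have "F (?q x (f x) \<oplus>\<^bsub>L2 X\<^esub> ?g) = F (?q x (f x)) + F ?g" by (intro F_add)
        moreover have "F ?g = (\<Sum>x\<in>S. F (?q x (f x)))" using insert.prems by (intro insert.IH) simp
        ultimately show ?case unfolding eq sum.insert[OF insert.hyps] by (simp only:)
      qed
      moreover have "(\<lambda>y\<in>X. if y \<in> X then f y else \<zero>\<^bsub>V\<^esub>) = f"
        using f by (auto simp: L2_iff PiE_iff extensional_def fun_eq_iff)
      ultimately show ?thesis using X by (metis (no_types, lifting) subset_refl)
    qed
  qed (use L2_mem q N_le_N2 in \<open>auto simp: L2_simps fun_eq_iff\<close>)
qed

end

lemma property_FBr_transfer:
  fixes V :: "(real, 'v, 'y) module_scheme"
  assumes FBr: "property_FBr TYPE('u) K" and V: "carrier V \<lesssim> (UNIV :: 'u set)"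
    and B: "banach_space V N" and R: "reflexive_space V N" and A: "affine_isometric_action K V N \<phi>"
  shows "bounded_orbits K (carrier V) (norm_dist V N) \<phi>"
proof -
  obtain f :: "'v \<Rightarrow> 'u" where f: "inj_on f (carrier V)" using V by (auto simp: lepoll_def)
  have n: "normed_space V N" using B by (simp add: banach_space_def)
  interpret real_normed V N by (rule real_normedI[OF n])
  show ?thesis
    by (rule bounded_orbits_T[OF f normed A])
      (use FBr banach_space_T[OF f B] reflexive_T[OF f R] affine_isometric_action_T[OF f A]
       in \<open>simp add: property_FBr_def\<close>)
qed

lemma property_FBr_imp_FH:
  assumes "property_FBr TYPE('u) K" shows "property_FH TYPE('u) K"
  unfolding property_FH_def
proof (intro allI impI)
  fix V :: "(real, 'u) module" and ip \<phi>
  assume *: "hilbert_space V ip \<and> affine_isometric_action K V (inner_norm ip) \<phi>"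
  then have B: "banach_space V (inner_norm ip)" and I: "inner_product_space V ip"
    by (auto simp: hilbert_space_def)
  have "reflexive_space V (inner_norm ip)"
    by (rule real_inner_space.reflexive_of_banach[OF real_inner_spaceI[OF I] B])
  then show "bounded_orbits K (carrier V) (norm_dist V (inner_norm ip)) \<phi>"
    using assms * B by (simp add: property_FBr_def)
qed

lemma bergman_imp_FW:
  assumes "bergman_property TYPE('u) K" shows "property_FW TYPE('u) K"
  using assms Metric_space_graph_dist graph_action_isometric
  unfolding property_FW_def bergman_property_def median_graph_iff by blast

section \<open>Affine actions on square-summable functions\<close>

text \<open>A square-summable function vanishes off a countable set.\<close>

lemma (in real_normed) l2_lepoll:
  assumes "(UNIV :: (nat \<Rightarrow> 'u) set) \<lesssim> (UNIV :: 'u set)"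
    and "carrier V \<lesssim> (UNIV :: 'u set)" "X \<lesssim> (UNIV :: 'u set)"
  shows "carrier (L2 X) \<lesssim> (UNIV :: 'u set)"
proof (rule lepoll_trans[OF subset_imp_lepoll countable_support_lepoll[OF assms, of "\<zero>\<^bsub>V\<^esub>"]])
  show "carrier (L2 X) \<subseteq> {f \<in> X \<rightarrow>\<^sub>E carrier V. countable {x \<in> X. f x \<noteq> \<zero>\<^bsub>V\<^esub>}}"
  proof clarify
    fix f assume f: "f \<in> carrier (L2 X)"
    have "countable {x \<in> X. (N (f x))\<^sup>2 \<noteq> 0}"
      using f by (intro summable_countable_real) (simp add: L2_iff)
    moreover have "{x \<in> X. (N (f x))\<^sup>2 \<noteq> 0} = {x \<in> X. f x \<noteq> \<zero>\<^bsub>V\<^esub>}"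
      using L2_mem[OF f] N_zero_iff by auto
    ultimately show "f \<in> X \<rightarrow>\<^sub>E carrier V \<and> countable {x \<in> X. f x \<noteq> \<zero>\<^bsub>V\<^esub>}"
      using f by (simp add: L2_iff)
  qed
qed

locale wreath_affine = wreath G H X \<theta> + real_normed V N
  for G :: "('g, 'a) monoid_scheme" and H :: "('h, 'b) monoid_scheme"
    and X :: "'x set" and \<theta> :: "'h \<Rightarrow> 'x \<Rightarrow> 'x"
    and V :: "(real, 'v, 'y) module_scheme" and N +
  fixes \<phi> :: "'g \<Rightarrow> 'v \<Rightarrow> 'v"
  assumes \<phi>: "affine_isometric_action G V N \<phi>"
begin

abbreviation "E \<equiv> l2_space X V N"

lemma \<phi>_action: "group_action G (carrier V) \<phi>"
  using \<phi> by (simp add: affine_isometric_action_def isometric_action_def)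

lemma \<phi>_isometry: "g \<in> carrier G \<Longrightarrow> u \<in> carrier V \<Longrightarrow> v \<in> carrier V \<Longrightarrow>
    N (\<phi> g u \<ominus>\<^bsub>V\<^esub> \<phi> g v) = N (u \<ominus>\<^bsub>V\<^esub> v)"
  using \<phi> group_action_closed[OF \<phi>_action, of g]
  unfolding affine_isometric_action_def isometric_action_def by (metis dist_eq)

text \<open>Only finitely many lamps act, and elsewhere the function is merely permuted.\<close>

lemma act_E:
  assumes w: "w \<in> carrier W" and f: "f \<in> carrier E"
  shows "act \<phi> w f \<in> carrier E"
proof -
  obtain n h where w': "w = (n, h)" by (cases w)
  have h: "h \<in> carrier H" and fin: "finite {x \<in> X. n x \<noteq> \<one>\<^bsub>G\<^esub>}" using w by (auto simp: w' carrier_W)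
  let ?S = "{x \<in> X. n x \<noteq> \<one>\<^bsub>G\<^esub>}" and ?s = "\<theta> (inv\<^bsub>H\<^esub> h)"
  have "(\<lambda>x. (N (f (?s x)))\<^sup>2) summable_on X"
    using summable_on_reindex_bij_betw[OF theta_bij[OF h], of "\<lambda>x. (N (f x))\<^sup>2"] f by (simp add: L2_iff)
  then have "(\<lambda>x. (N (f (?s x)))\<^sup>2) summable_on (X - ?S)" by (rule summable_on_subset) auto
  moreover have "(N (act \<phi> w f x))\<^sup>2 = (N (f (?s x)))\<^sup>2" if "x \<in> X - ?S" for x
    using that h group_action_one[OF \<phi>_action] L2_mem[OF f] by (simp add: wreath_action_def w')
  ultimately have "(\<lambda>x. (N (act \<phi> w f x))\<^sup>2) summable_on (X - ?S)"
    using summable_on_cong[of "X - ?S"] by (metis (no_types, lifting))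
  then have "(\<lambda>x. (N (act \<phi> w f x))\<^sup>2) summable_on (X - ?S \<union> ?S)"
    using fin by (intro summable_on_union) auto
  moreover have "X - ?S \<union> ?S = X" by auto
  moreover have "f \<in> X \<rightarrow>\<^sub>E carrier V" using f by (simp add: L2_iff)
  ultimately show ?thesis using act_closed[OF \<phi>_action w] by (simp add: L2_iff)
qed

text \<open>In each coordinate the action is a permutation followed by an affine isometry of \<open>V\<close>; sums of
  squares do not see the permutation.\<close>

lemma affine_isometric_action_E:
  "affine_isometric_action W E (l2_norm X N) (\<lambda>w. restrict (act \<phi> w) (carrier E))"
proof -
  interpret L: real_normed E "l2_norm X N" by (rule real_normedI[OF normed_space_L2])
  have ga: "group_action W (carrier E) (\<lambda>w. restrict (act \<phi> w) (carrier E))"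
    by (rule group_action_wreath[OF \<phi>_action _ act_E]) (auto simp: L2_iff)
  have "norm_dist E (l2_norm X N) (act \<phi> w f) (act \<phi> w f') = norm_dist E (l2_norm X N) f f'"
    if w: "w \<in> carrier W" and f: "f \<in> carrier E" and f': "f' \<in> carrier E" for w f f'
  proof -
    obtain n h where w': "w = (n, h)" by (cases w)
    have h: "h \<in> carrier H" and n: "\<And>x. x \<in> X \<Longrightarrow> n x \<in> carrier G" using w by (auto simp: w' carrier_W)
    let ?s = "\<theta> (inv\<^bsub>H\<^esub> h)"
    have "(N ((act \<phi> w f \<ominus>\<^bsub>E\<^esub> act \<phi> w f') x))\<^sup>2 = (N ((f \<ominus>\<^bsub>E\<^esub> f') (?s x)))\<^sup>2" if x: "x \<in> X" for x
      using x n h \<phi>_isometry L2_mem[OF f] L2_mem[OF f']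
      by (simp add: L2_minus[OF f f'] L2_minus[OF act_E[OF w f] act_E[OF w f']]) (simp add: wreath_action_def w')
    then have "(\<Sum>\<^sub>\<infinity>x\<in>X. (N ((act \<phi> w f \<ominus>\<^bsub>E\<^esub> act \<phi> w f') x))\<^sup>2) =
        (\<Sum>\<^sub>\<infinity>x\<in>X. (N ((f \<ominus>\<^bsub>E\<^esub> f') (?s x)))\<^sup>2)"
      by (rule infsum_cong)
    also have "\<dots> = (\<Sum>\<^sub>\<infinity>x\<in>X. (N ((f \<ominus>\<^bsub>E\<^esub> f') x))\<^sup>2)"
      by (rule infsum_reindex_bij_betw[OF theta_bij[OF h]])
    finally show ?thesis
      using act_E[OF w f] act_E[OF w f'] f f' by (simp add: norm_dist_def l2_norm_def)
  qed
  moreover have "affine_map E (restrict (act \<phi> w) (carrier E))" if w: "w \<in> carrier W" for w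
  proof -
    obtain n h where w': "w = (n, h)" by (cases w)
    have h: "h \<in> carrier H" and n: "\<And>x. x \<in> X \<Longrightarrow> n x \<in> carrier G" using w by (auto simp: w' carrier_W)
    have aff: "affine_map V (\<phi> (n x))" if "x \<in> X" for x
      using \<phi> n[OF that] by (simp add: affine_isometric_action_def)
    show ?thesis unfolding L.affine_map_iff
    proof (intro conjI ballI allI)
      show "restrict (act \<phi> w) (carrier E) f \<in> carrier E" if "f \<in> carrier E" for f
        using that act_E[OF w] by simp
      show "restrict (act \<phi> w) (carrier E) (f \<oplus>\<^bsub>E\<^esub> f') \<oplus>\<^bsub>E\<^esub> restrict (act \<phi> w) (carrier E) \<zero>\<^bsub>E\<^esub> =
          restrict (act \<phi> w) (carrier E) f \<oplus>\<^bsub>E\<^esub> restrict (act \<phi> w) (carrier E) f'"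
        if f: "f \<in> carrier E" and f': "f' \<in> carrier E" for f f'
        using f f' L2_add(1)[OF f f'] L2_zero aff h L2_mem[OF f] L2_mem[OF f']
        by (auto simp: L2_simps wreath_action_def w' affine_map_iff fun_eq_iff)
      show "restrict (act \<phi> w) (carrier E) (a \<odot>\<^bsub>E\<^esub> f) \<oplus>\<^bsub>E\<^esub> a \<odot>\<^bsub>E\<^esub> restrict (act \<phi> w) (carrier E) \<zero>\<^bsub>E\<^esub> =
          a \<odot>\<^bsub>E\<^esub> restrict (act \<phi> w) (carrier E) f \<oplus>\<^bsub>E\<^esub> restrict (act \<phi> w) (carrier E) \<zero>\<^bsub>E\<^esub>"
        if f: "f \<in> carrier E" for a f
        using f L2_smult(1)[OF f] L2_zero aff h L2_mem[OF f]
        by (auto simp: L2_simps wreath_action_def w' affine_map_iff fun_eq_iff)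
    qed
  qed
  ultimately show ?thesis using ga
    by (simp add: affine_isometric_action_def isometric_action_def)
qed

text \<open>The constant function is square-summable if there are finitely many points or if the
  constant is \<open>0\<close>. Lamps switched on at \<open>S\<close> move it by \<open>sqrt (card S)\<close> times what one lamp moves
  its value.\<close>

lemma lamps_displacement_E:
  assumes v: "v \<in> carrier V" and c: "finite X \<or> v = \<zero>\<^bsub>V\<^esub>"
    and S: "finite S" "S \<subseteq> X" and g: "g \<in> carrier G"
  shows "(\<lambda>x\<in>X. v) \<in> carrier E"
    "norm_dist E (l2_norm X N) (\<lambda>x\<in>X. v) (act \<phi> (lamps G X S g, \<one>\<^bsub>H\<^esub>) (\<lambda>x\<in>X. v)) =
      sqrt (card S) * norm_dist V N v (\<phi> g v)"
proof -
  show f: "(\<lambda>x\<in>X. v) \<in> carrier E"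
  proof (cases "finite X")
    case True
    then show ?thesis using v by (simp add: L2_iff)
  next
    case False
    then show ?thesis using c L2_zero[of X] by (simp add: L2_simps)
  qed
  let ?w = "(lamps G X S g, \<one>\<^bsub>H\<^esub>)" and ?f = "\<lambda>x\<in>X. v"
  have w: "?w \<in> carrier W" using lamps_in_W[OF S(1) g] .
  have gv: "\<phi> g v \<in> carrier V" using group_action_closed[OF \<phi>_action g v] .
  have "(N ((?f \<ominus>\<^bsub>E\<^esub> act \<phi> ?w ?f) x))\<^sup>2 = (if x \<in> S then (N (v \<ominus>\<^bsub>V\<^esub> \<phi> g v))\<^sup>2 else 0)" if "x \<in> X" for x
    using that v by (simp add: L2_minus[OF f act_E[OF w f]] act_lamps_const[OF \<phi>_action v])
  then have "(\<Sum>\<^sub>\<infinity>x\<in>X. (N ((?f \<ominus>\<^bsub>E\<^esub> act \<phi> ?w ?f) x))\<^sup>2) =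
      (\<Sum>\<^sub>\<infinity>x\<in>X. if x \<in> S then (N (v \<ominus>\<^bsub>V\<^esub> \<phi> g v))\<^sup>2 else 0)"
    by (rule infsum_cong)
  also have "\<dots> = (\<Sum>\<^sub>\<infinity>x\<in>S. (N (v \<ominus>\<^bsub>V\<^esub> \<phi> g v))\<^sup>2)"
    by (rule infsum_cong_neutral) (use S in auto)
  also have "\<dots> = card S * (N (v \<ominus>\<^bsub>V\<^esub> \<phi> g v))\<^sup>2" using S by simp
  finally show "norm_dist E (l2_norm X N) ?f (act \<phi> ?w ?f) = sqrt (card S) * norm_dist V N v (\<phi> g v)"
    using f act_E[OF w f] v gv by (simp add: norm_dist_def l2_norm_def real_sqrt_mult)
qed

lemma bounded_displacement_of_E:
  assumes b: "bounded_orbits W (carrier E) (norm_dist E (l2_norm X N)) (\<lambda>w. restrict (act \<phi> w) (carrier E))"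
    and v: "v \<in> carrier V" "finite X \<or> v = \<zero>\<^bsub>V\<^esub>"
  shows "\<exists>B. \<forall>S g. finite S \<longrightarrow> S \<subseteq> X \<longrightarrow> g \<in> carrier G \<longrightarrow>
    sqrt (card S) * norm_dist V N v (\<phi> g v) \<le> B"
proof -
  interpret L: real_normed E "l2_norm X N" by (rule real_normedI[OF normed_space_L2])
  have ga: "group_action W (carrier E) (\<lambda>w. restrict (act \<phi> w) (carrier E))"
    using affine_isometric_action_E by (simp add: affine_isometric_action_def isometric_action_def)
  have f: "(\<lambda>x\<in>X. v) \<in> carrier E"
    using lamps_displacement_E(1)[OF v, of "{}" "\<one>\<^bsub>G\<^esub>"] by simp
  obtain B where B: "\<forall>w\<in>carrier W.
      norm_dist E (l2_norm X N) (\<lambda>x\<in>X. v) (restrict (act \<phi> w) (carrier E) (\<lambda>x\<in>X. v)) \<le> B"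
    using b f unfolding bounded_orbits_iff[OF L.Metric_space_axioms ga] by blast
  have "sqrt (card S) * norm_dist V N v (\<phi> g v) \<le> B"
    if S: "finite S" "S \<subseteq> X" and g: "g \<in> carrier G" for S g
    using B[rule_format, OF lamps_in_W[OF S(1) g]] lamps_displacement_E(2)[OF v S g] f by simp
  then show ?thesis by blast
qed

lemma bounded_orbits_of_E:
  assumes b: "bounded_orbits W (carrier E) (norm_dist E (l2_norm X N)) (\<lambda>w. restrict (act \<phi> w) (carrier E))"
    and X: "finite X" "X \<noteq> {}"
  shows "bounded_orbits G (carrier V) (norm_dist V N) \<phi>"
  unfolding bounded_orbits_iff[OF Metric_space_axioms \<phi>_action]
proof
  fix v assume v: "v \<in> carrier V"
  obtain B where B: "\<And>S g. finite S \<Longrightarrow> S \<subseteq> X \<Longrightarrow> g \<in> carrier G \<Longrightarrow>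
      sqrt (card S) * norm_dist V N v (\<phi> g v) \<le> B"
    using bounded_displacement_of_E[OF b v] X by blast
  obtain x where "x \<in> X" using X by blast
  then have "norm_dist V N v (\<phi> g v) \<le> B" if "g \<in> carrier G" for g
    using B[of "{x}" g] that by simp
  then show "\<exists>B. \<forall>g\<in>carrier G. norm_dist V N v (\<phi> g v) \<le> B" by blast
qed

text \<open>The square root of the number of lamps is unbounded when there are infinitely many points.\<close>

lemma finite_of_bounded_orbits_E:
  assumes b: "bounded_orbits W (carrier E) (norm_dist E (l2_norm X N)) (\<lambda>w. restrict (act \<phi> w) (carrier E))"
    and g: "g \<in> carrier G" "\<phi> g \<zero>\<^bsub>V\<^esub> \<noteq> \<zero>\<^bsub>V\<^esub>"
  shows "finite X"
proof (rule ccontr)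
  assume inf: "infinite X"
  let ?c = "norm_dist V N \<zero>\<^bsub>V\<^esub> (\<phi> g \<zero>\<^bsub>V\<^esub>)"
  obtain B where B: "\<And>S g. finite S \<Longrightarrow> S \<subseteq> X \<Longrightarrow> g \<in> carrier G \<Longrightarrow>
      sqrt (card S) * norm_dist V N \<zero>\<^bsub>V\<^esub> (\<phi> g \<zero>\<^bsub>V\<^esub>) \<le> B"
    using bounded_displacement_of_E[OF b, of "\<zero>\<^bsub>V\<^esub>"] by blast
  have c: "?c > 0"
    using g group_action_closed[OF \<phi>_action g(1)] by (simp add: mdist_pos_less)
  obtain k :: nat where k: "(B / ?c)\<^sup>2 < k" using reals_Archimedean2 by blast
  obtain S where S: "finite S" "card S = k" "S \<subseteq> X" using infinite_arbitrarily_large[OF inf] by blast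
  have "B / ?c < sqrt k" using k by (simp add: real_less_rsqrt)
  then have "B < sqrt k * ?c" using c by (simp add: pos_divide_less_eq)
  then show False using B[OF S(1,3) g(1)] S(2) by simp
qed

end

text \<open>The regular representation conjugated by the translation that takes the origin to the
  indicator of \<open>1\<close>: an affine isometric action on a Hilbert space for which only the identity
  fixes the origin.\<close>

definition regular_affine :: "('g, 'a) monoid_scheme \<Rightarrow> 'g \<Rightarrow> ('g \<Rightarrow> real) \<Rightarrow> 'g \<Rightarrow> real"
  where "regular_affine G g f =
    (\<lambda>k\<in>carrier G. f (inv\<^bsub>G\<^esub> g \<otimes>\<^bsub>G\<^esub> k) + of_bool (k = g) - of_bool (k = \<one>\<^bsub>G\<^esub>))"

lemma regular_affine_action:
  fixes G :: "('g, 'a) monoid_scheme"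
  assumes G: "group G"
  defines "E \<equiv> l2_space (carrier G) real_line (inner_norm (*))"
  shows "affine_isometric_action G E (l2_norm (carrier G) (inner_norm (*)))
      (\<lambda>g. restrict (regular_affine G g) (carrier E))"
    and "g \<in> carrier G \<Longrightarrow> g \<noteq> \<one>\<^bsub>G\<^esub> \<Longrightarrow>
      restrict (regular_affine G g) (carrier E) \<zero>\<^bsub>E\<^esub> \<noteq> \<zero>\<^bsub>E\<^esub>"
proof -
  interpret G: group G by fact
  interpret R: real_inner_space real_line "(*)"
    using hilbert_space_real_line by (intro real_inner_spaceI) (simp add: hilbert_space_def)
  let ?N = "l2_norm (carrier G) (inner_norm (*)) :: ('g \<Rightarrow> real) \<Rightarrow> real"
  interpret L: real_normed E ?N unfolding E_def by (rule real_normedI[OF R.normed_space_L2])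
  have N: "(inner_norm (*) x)\<^sup>2 = x\<^sup>2" for x :: real by (simp add: inner_norm_def)
  have E: "f \<in> carrier E \<longleftrightarrow> f \<in> extensional (carrier G) \<and> (\<lambda>k. (f k)\<^sup>2) summable_on carrier G" for f
    unfolding E_def R.L2_iff by (simp add: N PiE_iff)
  note ops = R.L2_simps[where X = "carrier G", folded E_def]
  have minus: "f \<ominus>\<^bsub>E\<^esub> f' = (\<lambda>k\<in>carrier G. f k - f' k)" if "f \<in> carrier E" "f' \<in> carrier E" for f f'
    using R.L2_minus[of f "carrier G" f'] that by (simp add: E_def R.minus_eq)
  have bij: "bij_betw (\<lambda>k. inv\<^bsub>G\<^esub> g \<otimes>\<^bsub>G\<^esub> k) (carrier G) (carrier G)" if "g \<in> carrier G" for g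
    by (rule bij_betw_byWitness[of _ "\<lambda>k. g \<otimes>\<^bsub>G\<^esub> k"])
      (use that in \<open>auto simp: G.m_assoc[symmetric]\<close>)
  have cl: "regular_affine G g f \<in> carrier E" if g: "g \<in> carrier G" and f: "f \<in> carrier E" for g f
  proof -
    let ?S = "{g, \<one>\<^bsub>G\<^esub>}"
    have "(\<lambda>k. (f (inv\<^bsub>G\<^esub> g \<otimes>\<^bsub>G\<^esub> k))\<^sup>2) summable_on carrier G"
      using summable_on_reindex_bij_betw[OF bij[OF g], of "\<lambda>k. (f k)\<^sup>2"] f by (simp add: E)
    then have "(\<lambda>k. (f (inv\<^bsub>G\<^esub> g \<otimes>\<^bsub>G\<^esub> k))\<^sup>2) summable_on (carrier G - ?S)"
      by (rule summable_on_subset) auto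
    then have "(\<lambda>k. (regular_affine G g f k)\<^sup>2) summable_on (carrier G - ?S)"
      by (rule summable_on_cong[THEN iffD1, rotated]) (simp add: regular_affine_def)
    then have "(\<lambda>k. (regular_affine G g f k)\<^sup>2) summable_on (carrier G - ?S \<union> ?S)"
      by (intro summable_on_union) auto
    moreover have "carrier G - ?S \<union> ?S = carrier G" using g by auto
    ultimately show ?thesis by (simp add: E regular_affine_def)
  qed
  have inv_eq: "inv\<^bsub>G\<^esub> g \<otimes>\<^bsub>G\<^esub> k = h \<longleftrightarrow> k = g \<otimes>\<^bsub>G\<^esub> h"
    if "g \<in> carrier G" "k \<in> carrier G" "h \<in> carrier G" for g k h
    using that by (metis G.inv_solve_left G.inv_closed G.inv_inv)
  have ga: "group_action G (carrier E) (\<lambda>g. restrict (regular_affine G g) (carrier E))"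
  proof (rule group_actionI)
    show "restrict (regular_affine G \<one>\<^bsub>G\<^esub>) (carrier E) f = f" if "f \<in> carrier E" for f
      using that by (auto simp: regular_affine_def E extensional_def fun_eq_iff)
    show "restrict (regular_affine G (g \<otimes>\<^bsub>G\<^esub> h)) (carrier E) f =
        restrict (regular_affine G g) (carrier E) (restrict (regular_affine G h) (carrier E) f)"
      if gh: "g \<in> carrier G" "h \<in> carrier G" and f: "f \<in> carrier E" for g h f
    proof -
      have "regular_affine G (g \<otimes>\<^bsub>G\<^esub> h) f = regular_affine G g (regular_affine G h f)"
        using gh by (auto simp: regular_affine_def fun_eq_iff G.inv_mult_group G.m_assoc inv_eq)
      then show ?thesis using f cl gh by simp
    qed
  qed (use G cl in auto)
  have "norm_dist E ?N (regular_affine G g f) (regular_affine G g f') = norm_dist E ?N f f'"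
    if g: "g \<in> carrier G" and f: "f \<in> carrier E" and f': "f' \<in> carrier E" for g f f'
  proof -
    have "(\<Sum>\<^sub>\<infinity>k\<in>carrier G. ((regular_affine G g f \<ominus>\<^bsub>E\<^esub> regular_affine G g f') k)\<^sup>2) =
        (\<Sum>\<^sub>\<infinity>k\<in>carrier G. ((f \<ominus>\<^bsub>E\<^esub> f') (inv\<^bsub>G\<^esub> g \<otimes>\<^bsub>G\<^esub> k))\<^sup>2)"
      by (rule infsum_cong) (use g G.m_closed in \<open>simp add: minus cl f f', simp add: regular_affine_def\<close>)
    also have "\<dots> = (\<Sum>\<^sub>\<infinity>k\<in>carrier G. ((f \<ominus>\<^bsub>E\<^esub> f') k)\<^sup>2)"
      by (rule infsum_reindex_bij_betw[OF bij[OF g]])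
    finally show ?thesis using cl[OF g f] cl[OF g f'] f f'
      by (simp add: norm_dist_def l2_norm_def N)
  qed
  moreover have "affine_map E (restrict (regular_affine G g) (carrier E))" if g: "g \<in> carrier G" for g
    unfolding L.affine_map_iff
    by (intro conjI ballI allI, simp_all add: cl[OF g])
      (auto simp: ops regular_affine_def fun_eq_iff algebra_simps g)
  ultimately show "affine_isometric_action G E ?N (\<lambda>g. restrict (regular_affine G g) (carrier E))"
    using ga by (simp add: affine_isometric_action_def isometric_action_def)
  show "restrict (regular_affine G g) (carrier E) \<zero>\<^bsub>E\<^esub> \<noteq> \<zero>\<^bsub>E\<^esub>" if g: "g \<in> carrier G" "g \<noteq> \<one>\<^bsub>G\<^esub>"
  proof
    assume "restrict (regular_affine G g) (carrier E) \<zero>\<^bsub>E\<^esub> = \<zero>\<^bsub>E\<^esub>"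
    then have "regular_affine G g \<zero>\<^bsub>E\<^esub> g = \<zero>\<^bsub>E\<^esub> g" by simp
    then show False using g by (simp add: regular_affine_def ops)
  qed
qed

section \<open>Inheritance by the wreath product, its quotient and its factors\<close>

lemma graph_action_pullback:
  assumes "graph_action K V E \<phi>" "group L" "f \<in> hom L K"
  shows "graph_action L V E (\<lambda>g. \<phi> (f g))"
  using assms group_action_pullback[OF _ assms(2,3)] hom_in_carrier[OF assms(3)]
  unfolding graph_action_def by blast

lemma affine_isometric_action_pullback:
  assumes "affine_isometric_action K V N \<phi>" "group L" "f \<in> hom L K"
  shows "affine_isometric_action L V N (\<lambda>g. \<phi> (f g))"
  using assms isometric_action_pullback[OF _ assms(2,3)] hom_in_carrier[OF assms(3)]
  unfolding affine_isometric_action_def by blast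

lemma bergman_transfer:
  fixes M :: "'v set"
  assumes P: "bergman_property TYPE('u) K" and le: "M \<lesssim> (UNIV :: 'u set)"
    and M: "Metric_space M d" and A: "isometric_action K M d \<phi>"
  shows "bounded_orbits K M d \<phi>"
proof -
  obtain f :: "'v \<Rightarrow> 'u" where f: "inj_on f M" using le by (auto simp: lepoll_def)
  interpret Metric_space M d by fact
  define d' where "d' a b = (if a \<in> f ` M \<and> b \<in> f ` M then d (inv_into M f a) (inv_into M f b) else 0)" for a b
  have d': "d' (f x) (f y) = d x y" if "x \<in> M" "y \<in> M" for x y using that f by (simp add: d'_def)
  have M': "Metric_space (f ` M) d'"
    by unfold_locales (use f commute triangle in \<open>auto simp: d'_def inj_on_eq_iff\<close>)
  have "bounded_orbits K (f ` M) d' (conj_action f M \<phi>)"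
    using P M' isometric_action_conj[OF A f, of d'] d' unfolding bergman_property_def by blast
  then show ?thesis
    using A f d' by (intro bounded_orbits_conj[OF M M' _ f, of K \<phi>]) (auto simp: isometric_action_def)
qed

context wreath
begin

lemma bergman_quotient:
  assumes "bergman_property TYPE('u) W" shows "bergman_property TYPE('u) H"
  unfolding bergman_property_def
proof (intro allI impI)
  fix M :: "'u set" and d \<phi>
  assume A: "Metric_space M d \<and> isometric_action H M d \<phi>"
  have "isometric_action W M d (\<lambda>w. \<phi> (snd w))"
    by (rule isometric_action_pullback[OF _ W.group_axioms snd_hom]) (simp add: A)
  then have "bounded_orbits W M d (\<lambda>w. \<phi> (snd w))"
    using assms A by (simp add: bergman_property_def)
  then show "bounded_orbits H M d \<phi>" by (rule bounded_orbits_surj_pullback[OF snd_surj])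
qed

lemma FW_quotient:
  assumes "property_FW TYPE('u) W" shows "property_FW TYPE('u) H"
  unfolding property_FW_def
proof (intro allI impI)
  fix V :: "'u set" and E \<phi>
  assume A: "median_graph V E \<and> graph_action H V E \<phi>"
  have "graph_action W V E (\<lambda>w. \<phi> (snd w))"
    by (rule graph_action_pullback[OF _ W.group_axioms snd_hom]) (simp add: A)
  then have "bounded_orbits W V (\<lambda>u v. real (graph_dist V E u v)) (\<lambda>w. \<phi> (snd w))"
    using assms A by (simp add: property_FW_def)
  then show "bounded_orbits H V (\<lambda>u v. real (graph_dist V E u v)) \<phi>"
    by (rule bounded_orbits_surj_pullback[OF snd_surj])
qed

lemma affine_bounded_orbits_quotient:
  assumes A: "affine_isometric_action H V N \<phi>"
    and W: "\<And>\<psi>. affine_isometric_action W V N \<psi> \<Longrightarrow> bounded_orbits W (carrier V) (norm_dist V N) \<psi>"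
  shows "bounded_orbits H (carrier V) (norm_dist V N) \<phi>"
  by (rule bounded_orbits_surj_pullback[OF snd_surj W])
    (rule affine_isometric_action_pullback[OF A W.group_axioms snd_hom])

lemma FBr_quotient: "property_FBr TYPE('u) W \<Longrightarrow> property_FBr TYPE('u) H"
  using affine_bounded_orbits_quotient unfolding property_FBr_def by metis

lemma FH_quotient: "property_FH TYPE('u) W \<Longrightarrow> property_FH TYPE('u) H"
  using affine_bounded_orbits_quotient unfolding property_FH_def by metis

lemma bergman_wreath:
  assumes X: "finite X" and "bergman_property TYPE('u) G" "bergman_property TYPE('u) H"
  shows "bergman_property TYPE('u) W"
  unfolding bergman_property_def
proof (intro allI impI)
  fix M :: "'u set" and d \<psi>
  assume A: "Metric_space M d \<and> isometric_action W M d \<psi>"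
  show "bounded_orbits W M d \<psi>"
  proof (rule bounded_orbits_wreath[OF _ _ X])
    show "bounded_orbits G M d (\<lambda>g. \<psi> (lamps G X {x} g, \<one>\<^bsub>H\<^esub>))" for x
      using assms(2) A isometric_action_pullback[OF _ G lamps_hom[of "{x}"], of M d \<psi>]
      by (simp add: bergman_property_def)
    show "bounded_orbits H M d (\<lambda>h. \<psi> (\<lambda>x\<in>X. \<one>\<^bsub>G\<^esub>, h))"
      using assms(3) A isometric_action_pullback[OF _ H base_hom, of M d \<psi>]
      by (simp add: bergman_property_def)
  qed (use A in auto)
qed

lemma FW_wreath:
  assumes X: "finite X" and "property_FW TYPE('u) G" "property_FW TYPE('u) H"
  shows "property_FW TYPE('u) W"
  unfolding property_FW_def
proof (intro allI impI)
  fix V :: "'u set" and E \<psi>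
  assume A: "median_graph V E \<and> graph_action W V E \<psi>"
  then have C: "connected_graph V E" by (simp add: median_graph_iff)
  show "bounded_orbits W V (\<lambda>u v. real (graph_dist V E u v)) \<psi>"
  proof (rule bounded_orbits_wreath[OF Metric_space_graph_dist[OF C] graph_action_isometric[OF C] X])
    show "graph_action W V E \<psi>" using A by simp
    show "bounded_orbits G V (\<lambda>u v. real (graph_dist V E u v)) (\<lambda>g. \<psi> (lamps G X {x} g, \<one>\<^bsub>H\<^esub>))" for x
      using assms(2) A graph_action_pullback[OF _ G lamps_hom[of "{x}"], of V E \<psi>]
      by (simp add: property_FW_def)
    show "bounded_orbits H V (\<lambda>u v. real (graph_dist V E u v)) (\<lambda>h. \<psi> (\<lambda>x\<in>X. \<one>\<^bsub>G\<^esub>, h))"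
      using assms(3) A graph_action_pullback[OF _ H base_hom, of V E \<psi>]
      by (simp add: property_FW_def)
  qed
qed

lemma affine_bounded_orbits_wreath:
  assumes X: "finite X" and V: "normed_space V N" and A: "affine_isometric_action W V N \<psi>"
    and bG: "\<And>\<phi>. affine_isometric_action G V N \<phi> \<Longrightarrow> bounded_orbits G (carrier V) (norm_dist V N) \<phi>"
    and bH: "\<And>\<phi>. affine_isometric_action H V N \<phi> \<Longrightarrow> bounded_orbits H (carrier V) (norm_dist V N) \<phi>"
  shows "bounded_orbits W (carrier V) (norm_dist V N) \<psi>"
proof (rule bounded_orbits_wreath[OF Metric_space_norm_dist[OF V] _ X])
  show "isometric_action W (carrier V) (norm_dist V N) \<psi>"
    using A by (simp add: affine_isometric_action_def)
  show "bounded_orbits G (carrier V) (norm_dist V N) (\<lambda>g. \<psi> (lamps G X {x} g, \<one>\<^bsub>H\<^esub>))" for x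
    by (rule bG[OF affine_isometric_action_pullback[OF A G lamps_hom]]) simp
  show "bounded_orbits H (carrier V) (norm_dist V N) (\<lambda>h. \<psi> (\<lambda>x\<in>X. \<one>\<^bsub>G\<^esub>, h))"
    by (rule bH[OF affine_isometric_action_pullback[OF A H base_hom]])
qed

lemma FBr_wreath:
  assumes "finite X" and "property_FBr TYPE('u) G" "property_FBr TYPE('u) H"
  shows "property_FBr TYPE('u) W"
  unfolding property_FBr_def
proof (intro allI impI; elim conjE)
  fix V :: "(real, 'u) module" and N \<psi>
  assume B: "banach_space V N" and R: "reflexive_space V N" and A: "affine_isometric_action W V N \<psi>"
  show "bounded_orbits W (carrier V) (norm_dist V N) \<psi>"
    by (rule affine_bounded_orbits_wreath[OF assms(1) _ A])
      (use assms(2,3) B R in \<open>simp_all add: property_FBr_def banach_space_def\<close>)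
qed

lemma FH_wreath:
  assumes "finite X" and "property_FH TYPE('u) G" "property_FH TYPE('u) H"
  shows "property_FH TYPE('u) W"
  unfolding property_FH_def
proof (intro allI impI; elim conjE)
  fix V :: "(real, 'u) module" and ip \<psi>
  assume I: "hilbert_space V ip" and A: "affine_isometric_action W V (inner_norm ip) \<psi>"
  show "bounded_orbits W (carrier V) (norm_dist V (inner_norm ip)) \<psi>"
    by (rule affine_bounded_orbits_wreath[OF assms(1) _ A])
      (use assms(2,3) I in \<open>auto simp: property_FH_def hilbert_space_def banach_space_def\<close>)
qed

end

text \<open>The parameter \<open>U\<close> makes the type of the universe a parameter of the locale.\<close>

locale wreath_universe = wreath G H X \<theta>
  for G :: "('g, 'a) monoid_scheme" and H :: "('h, 'b) monoid_scheme"
    and X :: "'x set" and \<theta> :: "'h \<Rightarrow> 'x \<Rightarrow> 'x" +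
  fixes U :: "'u itself"
  assumes inf: "infinite (UNIV :: 'u set)"
    and seq: "(UNIV :: (nat \<Rightarrow> 'u) set) \<lesssim> (UNIV :: 'u set)"
    and G_le: "carrier G \<lesssim> (UNIV :: 'u set)" and X_le: "X \<lesssim> (UNIV :: 'u set)"
begin

text \<open>Here the finiteness of \<open>X\<close> is available, and the whole power carries the sum metric.\<close>

lemma bergman_factor:
  assumes P: "bergman_property TYPE('u) W" and X: "finite X" "X \<noteq> {}"
  shows "bergman_property TYPE('u) G"
  unfolding bergman_property_def
proof (intro allI impI)
  fix M :: "'u set" and d \<phi>
  assume "Metric_space M d \<and> isometric_action G M d \<phi>"
  then have M: "Metric_space M d" and A: "isometric_action G M d \<phi>" by auto
  interpret Metric_space M d by (rule M)
  have ga: "group_action G M \<phi>" using A by (simp add: isometric_action_def)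
  let ?F = "X \<rightarrow>\<^sub>E M" and ?d = "\<lambda>f g. \<Sum>x\<in>X. d (f x) (g x)" and ?\<psi> = "\<lambda>w. restrict (act \<phi> w) (X \<rightarrow>\<^sub>E M)"
  have F: "?F \<lesssim> (UNIV :: 'u set)"
    using weak_power_lepoll[OF seq _ X_le, of M undefined] X(1)
    by (simp add: weak_power_def subset_imp_lepoll)
  have MF: "Metric_space ?F ?d"
  proof
    show "?d f g = 0 \<longleftrightarrow> f = g" if f: "f \<in> ?F" and g: "g \<in> ?F" for f g
    proof -
      have "?d f g = 0 \<longleftrightarrow> (\<forall>x\<in>X. d (f x) (g x) = 0)"
        using X(1) by (simp add: sum_nonneg_eq_0_iff)
      also have "\<dots> \<longleftrightarrow> (\<forall>x\<in>X. f x = g x)"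
        using PiE_mem[OF f] PiE_mem[OF g] by simp
      also have "\<dots> \<longleftrightarrow> f = g" using PiE_ext[OF f g] by blast
      finally show ?thesis .
    qed
    show "?d f h \<le> ?d f g + ?d g h" if "f \<in> ?F" "g \<in> ?F" "h \<in> ?F" for f g h
      unfolding sum.distrib[symmetric] by (intro sum_mono triangle) (use that in \<open>auto simp: PiE_mem\<close>)
  qed (simp_all add: sum_nonneg commute)
  have gaF: "group_action W ?F ?\<psi>"
    by (rule group_action_wreath[OF ga subset_refl]) (rule act_closed[OF ga])
  have "?d (act \<phi> w f) (act \<phi> w g) = ?d f g" if w: "w \<in> carrier W" and f: "f \<in> ?F" and g: "g \<in> ?F" for w f g
  proof -
    obtain n h where w': "w = (n, h)" by (cases w)
    have h: "h \<in> carrier H" and n: "\<And>x. x \<in> X \<Longrightarrow> n x \<in> carrier G" using w by (auto simp: w' carrier_W)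
    let ?s = "\<theta> (inv\<^bsub>H\<^esub> h)"
    have "?d (act \<phi> w f) (act \<phi> w g) = (\<Sum>x\<in>X. d (f (?s x)) (g (?s x)))"
    proof (rule sum.cong)
      fix x assume x: "x \<in> X"
      then have "?s x \<in> X" using h by simp
      then have "f (?s x) \<in> M" "g (?s x) \<in> M" using f g by auto
      then show "d (act \<phi> w f x) (act \<phi> w g x) = d (f (?s x)) (g (?s x))"
        using A x n[OF x] by (simp add: wreath_action_def w' isometric_action_def)
    qed simp
    also have "\<dots> = ?d f g" by (rule sum.reindex_bij_betw[OF theta_bij[OF h]])
    finally show ?thesis .
  qed
  then have "isometric_action W ?F ?d ?\<psi>" using gaF by (simp add: isometric_action_def)
  then have b: "bounded_orbits W ?F ?d ?\<psi>" by (rule bergman_transfer[OF P F MF])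
  show "bounded_orbits G M d \<phi>" unfolding bounded_orbits_iff[OF M ga]
  proof
    fix v assume v: "v \<in> M"
    let ?f = "\<lambda>x\<in>X. v"
    have f: "?f \<in> ?F" using v by simp
    then obtain B where B: "\<And>w. w \<in> carrier W \<Longrightarrow> ?d ?f (?\<psi> w ?f) \<le> B"
      using b unfolding bounded_orbits_iff[OF MF gaF] by blast
    obtain x where x: "x \<in> X" using X by blast
    have "d v (\<phi> g v) \<le> B" if g: "g \<in> carrier G" for g
    proof -
      let ?w = "(lamps G X {x} g, \<one>\<^bsub>H\<^esub>)"
      have "d (?f y) (?\<psi> ?w ?f y) = (if y = x then d v (\<phi> g v) else 0)" if "y \<in> X" for y
        using that f v by (simp add: act_lamps_const[OF ga v])
      then have "?d ?f (?\<psi> ?w ?f) = (\<Sum>y\<in>X. if y = x then d v (\<phi> g v) else 0)"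
        by (rule sum.cong[OF refl])
      also have "\<dots> = d v (\<phi> g v)" using X x by simp
      finally show ?thesis using B[OF lamps_in_W[OF _ g, of "{x}"]] by simp
    qed
    then show "\<exists>B. \<forall>g\<in>carrier G. d v (\<phi> g v) \<le> B" by blast
  qed
qed

text \<open>One estimate serves both purposes: for one lamp it bounds the orbit of \<open>v\<close>, and for
  many lamps it bounds the number of points.\<close>

lemma FW_displacement:
  fixes V :: "'v set"
  assumes P: "property_FW TYPE('u) W" and med: "median_graph V E" and A: "graph_action G V E \<phi>"
    and le: "V \<lesssim> (UNIV :: 'u set)" and v: "v \<in> V"
  shows "\<exists>B. \<forall>S g. finite S \<longrightarrow> S \<subseteq> X \<longrightarrow> g \<in> carrier G \<longrightarrow>
    card S * real (graph_dist V E v (\<phi> g v)) \<le> B"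
proof -
  have "connected_graph V E" using med by (simp add: median_graph_iff)
  then interpret conn_graph V E by unfold_locales
  have ga: "group_action G V \<phi>"
    and adj: "\<And>g u v. g \<in> carrier G \<Longrightarrow> u \<in> V \<Longrightarrow> v \<in> V \<Longrightarrow> (\<phi> g u, \<phi> g v) \<in> E \<longleftrightarrow> (u, v) \<in> E"
    using A by (auto simp: graph_action_def)
  let ?P = "weak_power X V v" and ?E = "weak_power_edges X V E v"
  let ?\<psi> = "\<lambda>w. restrict (act \<phi> w) ?P" and ?f = "\<lambda>x\<in>X. v"
  have cl: "act \<phi> w f \<in> ?P" if "w \<in> carrier W" "f \<in> ?P" for w f
    using that act_closed[OF ga] finite_act_neq[OF ga that(1) _ v] by (simp add: weak_power_def)
  have gaP: "group_action W ?P ?\<psi>"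
    by (rule group_action_wreath[OF ga _ cl]) (auto simp: weak_power_def)
  have "graph_action W ?P ?E ?\<psi>"
  proof (rule graph_actionI[OF gaP])
    fix w f g assume w: "w \<in> carrier W" and f: "f \<in> ?P" and g: "g \<in> ?P" and e: "(f, g) \<in> ?E"
    obtain n h where w': "w = (n, h)" by (cases w)
    have h: "h \<in> carrier H" and n: "\<And>x. x \<in> X \<Longrightarrow> n x \<in> carrier G" using w by (auto simp: w' carrier_W)
    let ?s = "\<theta> (inv\<^bsub>H\<^esub> h)"
    obtain x where x: "x \<in> X" "(f x, g x) \<in> E" and eq: "\<And>y. y \<in> X \<Longrightarrow> y \<noteq> x \<Longrightarrow> f y = g y"
      using e by (auto simp: weak_power_edges_def)
    have hx: "\<theta> h x \<in> X" "?s (\<theta> h x) = x" using group_action_inv(1)[OF \<theta> h x(1)] h x(1) by auto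
    have "(act \<phi> w f (\<theta> h x), act \<phi> w g (\<theta> h x)) \<in> E"
      using hx x n adj E_sub by (auto simp: wreath_action_def w')
    moreover have "act \<phi> w f y = act \<phi> w g y" if y: "y \<in> X - {\<theta> h x}" for y
    proof -
      have "?s y \<noteq> x" using group_action_inv(2)[OF \<theta> h, of y] y by auto
      then show ?thesis using eq[of "?s y"] y h by (simp add: wreath_action_def w')
    qed
    ultimately have "(act \<phi> w f, act \<phi> w g) \<in> ?E"
      using cl[OF w f] cl[OF w g] hx(1) unfolding weak_power_edges_def by blast
    then show "(?\<psi> w f, ?\<psi> w g) \<in> ?E" using f g by simp
  qed
  then have b: "bounded_orbits W ?P (\<lambda>u v. real (graph_dist ?P ?E u v)) ?\<psi>"
    by (rule property_FW_transfer[OF P weak_power_lepoll[OF seq le X_le] median_weak_power(1)[OF v med]])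
  have M: "Metric_space ?P (\<lambda>u v. real (graph_dist ?P ?E u v))"
    using median_weak_power(1)[OF v med, of X] by (intro Metric_space_graph_dist) (simp add: median_graph_iff)
  have f: "?f \<in> ?P" using v by (simp add: weak_power_def)
  obtain B where B: "\<And>w. w \<in> carrier W \<Longrightarrow> real (graph_dist ?P ?E ?f (?\<psi> w ?f)) \<le> B"
    using b f unfolding bounded_orbits_iff[OF M gaP] by blast
  have "card S * real (D v (\<phi> g v)) \<le> B" if S: "finite S" "S \<subseteq> X" and g: "g \<in> carrier G" for S g
  proof -
    let ?w = "(lamps G X S g, \<one>\<^bsub>H\<^esub>)"
    have w: "?w \<in> carrier W" using lamps_in_W[OF S(1) g] .
    have val: "act \<phi> ?w ?f x = (if x \<in> S then \<phi> g v else v)" if "x \<in> X" for x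
      using act_lamps_const[OF ga v that] .
    have "graph_dist ?P ?E ?f (act \<phi> ?w ?f) = sum_dist X D ?f (act \<phi> ?w ?f)"
      by (rule median_weak_power(2)[OF v med f cl[OF w f]])
    also have "\<dots> = (\<Sum>x\<in>S. D (?f x) (act \<phi> ?w ?f x))"
      by (rule DP_eq[OF v f S(1) _ S(2)]) (auto simp: val)
    also have "\<dots> = (\<Sum>x\<in>S. D v (\<phi> g v))" using S(2) by (intro sum.cong) (auto simp: val)
    also have "\<dots> = card S * D v (\<phi> g v)" by simp
    finally show ?thesis using B[OF w] f by simp
  qed
  then show ?thesis by blast
qed

lemma FW_factor:
  assumes P: "property_FW TYPE('u) W" and X: "X \<noteq> {}"
  shows "property_FW TYPE('u) G"
  unfolding property_FW_def
proof (intro allI impI)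
  fix V :: "'u set" and E \<phi>
  assume A: "median_graph V E \<and> graph_action G V E \<phi>"
  then have "connected_graph V E" and ga: "group_action G V \<phi>"
    by (auto simp: median_graph_iff graph_action_def)
  then have M: "Metric_space V (\<lambda>u v. real (graph_dist V E u v))" by (intro Metric_space_graph_dist)
  show "bounded_orbits G V (\<lambda>u v. real (graph_dist V E u v)) \<phi>"
    unfolding bounded_orbits_iff[OF M ga]
  proof
    fix v assume v: "v \<in> V"
    obtain B where B: "\<And>S g. finite S \<Longrightarrow> S \<subseteq> X \<Longrightarrow> g \<in> carrier G \<Longrightarrow>
        card S * real (graph_dist V E v (\<phi> g v)) \<le> B"
      using FW_displacement[OF P _ _ _ v, of E \<phi>] A subset_imp_lepoll[OF subset_UNIV] by blast
    obtain x where "x \<in> X" using X by blast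
    then have "real (graph_dist V E v (\<phi> g v)) \<le> B" if "g \<in> carrier G" for g
      using B[of "{x}" g] that by simp
    then show "\<exists>B. \<forall>g\<in>carrier G. real (graph_dist V E v (\<phi> g v)) \<le> B" by blast
  qed
qed

lemma FW_finite:
  assumes P: "property_FW TYPE('u) W" and G1: "carrier G \<noteq> {\<one>\<^bsub>G\<^esub>}"
  shows "finite X"
proof (rule ccontr)
  assume inf_X: "infinite X"
  obtain g where g: "g \<in> carrier G" "g \<noteq> \<one>\<^bsub>G\<^esub>" using G1 G.one_closed by blast
  let ?V = "star (carrier G)" and ?E = "star_edges (carrier G)"
  let ?\<phi> = "\<lambda>g. \<lambda>u\<in>?V. map_option (\<lambda>a. g \<otimes>\<^bsub>G\<^esub> a) u" and ?v = "Some \<one>\<^bsub>G\<^esub>"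
  have v: "?v \<in> ?V" "Some g \<in> ?V" using g by (auto simp: star_def)
  obtain B where B: "\<And>S g. finite S \<Longrightarrow> S \<subseteq> X \<Longrightarrow> g \<in> carrier G \<Longrightarrow>
      card S * real (graph_dist ?V ?E ?v (?\<phi> g ?v)) \<le> B"
    using FW_displacement[OF P median_star graph_action_star[OF G] star_lepoll[OF inf G_le] v(1)] by blast
  have "graph_dist ?V ?E ?v (Some g) \<noteq> 0" using star_dist[OF v] g by simp
  moreover have "?\<phi> g ?v = Some g" using g v by simp
  ultimately have d: "1 \<le> real (graph_dist ?V ?E ?v (?\<phi> g ?v))" by simp
  obtain k :: nat where k: "B < k" using reals_Archimedean2 by blast
  obtain S where S: "finite S" "card S = k" "S \<subseteq> X" using infinite_arbitrarily_large[OF inf_X] by blast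
  have "real k * 1 \<le> real k * real (graph_dist ?V ?E ?v (?\<phi> g ?v))" using d by (intro mult_left_mono) auto
  then show False using B[OF S(1,3) g(1)] S(2) k by simp
qed

lemma FH_l2:
  fixes V :: "(real, 'v, 'y) module_scheme"
  assumes P: "property_FH TYPE('u) W" and H: "hilbert_space V ip" and le: "carrier V \<lesssim> (UNIV :: 'u set)"
    and A: "affine_isometric_action G V (inner_norm ip) \<phi>"
  shows "bounded_orbits W (carrier (l2_space X V (inner_norm ip)))
    (norm_dist (l2_space X V (inner_norm ip)) (l2_norm X (inner_norm ip)))
    (\<lambda>w. restrict (act \<phi> w) (carrier (l2_space X V (inner_norm ip))))"
proof -
  have I: "inner_product_space V ip" and B: "banach_space V (inner_norm ip)"
    using H by (auto simp: hilbert_space_def)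
  interpret I: real_inner_space V ip by (rule real_inner_spaceI[OF I])
  interpret wreath_affine G H X \<theta> V "inner_norm ip" \<phi> by unfold_locales (rule A)
  let ?ip = "l2_inner X ip"
  have n: "norm_dist E (inner_norm ?ip) = norm_dist E (l2_norm X (inner_norm ip))"
    using real_space.minus_closed[OF I.real_space_L2[of X]] I.inner_norm_l2
    by (auto simp: norm_dist_def fun_eq_iff)
  have "affine_isometric_action W E (inner_norm ?ip) (\<lambda>w. restrict (act \<phi> w) (carrier E))"
    using affine_isometric_action_E by (simp add: affine_isometric_action_def n)
  then have "bounded_orbits W (carrier E) (norm_dist E (inner_norm ?ip)) (\<lambda>w. restrict (act \<phi> w) (carrier E))"
    by (rule property_FH_transfer[OF P I.l2_lepoll[OF seq le X_le] I.hilbert_space_L2[OF B]])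
  then show ?thesis by (simp add: n)
qed

lemma FH_factor:
  assumes P: "property_FH TYPE('u) W" and X: "finite X" "X \<noteq> {}"
  shows "property_FH TYPE('u) G"
  unfolding property_FH_def
proof (intro allI impI)
  fix V :: "(real, 'u) module" and ip \<phi>
  assume *: "hilbert_space V ip \<and> affine_isometric_action G V (inner_norm ip) \<phi>"
  then have "normed_space V (inner_norm ip)" by (simp add: hilbert_space_def banach_space_def)
  then interpret N: real_normed V "inner_norm ip" by (rule real_normedI)
  interpret wreath_affine G H X \<theta> V "inner_norm ip" \<phi> by unfold_locales (use * in simp)
  show "bounded_orbits G (carrier V) (norm_dist V (inner_norm ip)) \<phi>"
    using FH_l2[OF P, of V ip \<phi>] * subset_imp_lepoll[OF subset_UNIV] X
    by (intro bounded_orbits_of_E) auto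
qed

text \<open>Two elements suffice to encode the subsets of \<open>\<nat>\<close>, hence the reals, as sequences.\<close>

lemma reals_lepoll: "(UNIV :: real set) \<lesssim> (UNIV :: 'u set)"
proof -
  obtain a b :: 'u where ab: "a \<noteq> b" using inf by (metis finite.intros UNIV_eq_I insertI1 singletonD ex_new_if_finite)
  have "inj (\<lambda>(A :: nat set) n. if n \<in> A then a else b)"
    using ab by (auto simp: inj_on_def fun_eq_iff split: if_splits)
  then have "(UNIV :: nat set set) \<lesssim> (UNIV :: (nat \<Rightarrow> 'u) set)" by (auto simp: lepoll_def)
  then show ?thesis
    using nat_sets_eqpoll_reals seq by (meson eqpoll_imp_lepoll eqpoll_sym lepoll_trans)
qed

text \<open>The base point is the origin: it is the only constant that is square-summable over an infinite
  \<open>X\<close>, and the affine regular representation moves it.\<close>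

lemma FH_finite:
  assumes P: "property_FH TYPE('u) W" and G1: "carrier G \<noteq> {\<one>\<^bsub>G\<^esub>}"
  shows "finite X"
proof -
  obtain g where g: "g \<in> carrier G" "g \<noteq> \<one>\<^bsub>G\<^esub>" using G1 G.one_closed by blast
  have B: "banach_space real_line (inner_norm (*))"
    using hilbert_space_real_line by (simp add: hilbert_space_def)
  interpret R: real_inner_space real_line "(*)"
    using hilbert_space_real_line by (intro real_inner_spaceI) (simp add: hilbert_space_def)
  let ?V = "l2_space (carrier G) real_line (inner_norm (*))" and ?ip = "l2_inner (carrier G) (*) :: ('g \<Rightarrow> real) \<Rightarrow> _"
  let ?\<phi> = "\<lambda>g. restrict (regular_affine G g) (carrier ?V)"
  have hV: "hilbert_space ?V ?ip" by (rule R.hilbert_space_L2[OF B])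
  then have "normed_space ?V (inner_norm ?ip)" by (simp add: hilbert_space_def banach_space_def)
  then interpret N: real_normed ?V "inner_norm ?ip" by (rule real_normedI)
  have n: "norm_dist ?V (inner_norm ?ip) = norm_dist ?V (l2_norm (carrier G) (inner_norm (*)))"
    using R.inner_norm_l2[OF N.minus_closed] by (auto simp: norm_dist_def fun_eq_iff)
  have A: "affine_isometric_action G ?V (inner_norm ?ip) ?\<phi>"
    using regular_affine_action(1)[OF G] by (simp add: affine_isometric_action_def n)
  interpret wreath_affine G H X \<theta> ?V "inner_norm ?ip" ?\<phi> by unfold_locales (rule A)
  have le: "carrier ?V \<lesssim> (UNIV :: 'u set)"
    by (rule R.l2_lepoll[OF seq _ G_le]) (simp add: reals_lepoll)
  show ?thesis
    by (rule finite_of_bounded_orbits_E[OF FH_l2[OF P hV le A] g(1) regular_affine_action(2)[OF G g]])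
qed

lemma FBr_factor:
  assumes P: "property_FBr TYPE('u) W" and X: "finite X" "X \<noteq> {}"
  shows "property_FBr TYPE('u) G"
  unfolding property_FBr_def
proof (intro allI impI)
  fix V :: "(real, 'u) module" and N \<phi>
  assume *: "banach_space V N \<and> reflexive_space V N \<and> affine_isometric_action G V N \<phi>"
  then have "normed_space V N" by (simp add: banach_space_def)
  then interpret N: real_normed V N by (rule real_normedI)
  interpret wreath_affine G H X \<theta> V N \<phi> by unfold_locales (use * in simp)
  have "bounded_orbits W (carrier E) (norm_dist E (l2_norm X N)) (\<lambda>w. restrict (act \<phi> w) (carrier E))"
    using * X(1) N.l2_lepoll[OF seq _ X_le] subset_imp_lepoll[OF subset_UNIV]
    by (intro property_FBr_transfer[OF P] N.banach_space_L2 N.reflexive_L2 affine_isometric_action_E) auto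
  then show "bounded_orbits G (carrier V) (norm_dist V N) \<phi>"
    using X by (rule bounded_orbits_of_E)
qed

end

theorem theorem1:
  fixes G :: "('g, 'a) monoid_scheme" and H :: "('h, 'b) monoid_scheme"
    and X :: "'x set" and \<theta> :: "'h \<Rightarrow> 'x \<Rightarrow> 'x"
  assumes "group G" and "group H" and "carrier G \<noteq> {\<one>\<^bsub>G\<^esub>}"
    and "group_action H X \<theta>" and "X \<noteq> {}"
    and "infinite (UNIV :: 'u set)" and "(UNIV :: (nat \<Rightarrow> 'u) set) \<lesssim> (UNIV :: 'u set)"
    and "carrier G \<lesssim> (UNIV :: 'u set)" and "carrier H \<lesssim> (UNIV :: 'u set)"
    and "X \<lesssim> (UNIV :: 'u set)"
  shows "(bergman_property TYPE('u) (wreath_product G H X \<theta>) \<longleftrightarrow>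
            bergman_property TYPE('u) G \<and> bergman_property TYPE('u) H \<and> finite X) \<and>
         (property_FBr TYPE('u) (wreath_product G H X \<theta>) \<longleftrightarrow>
            property_FBr TYPE('u) G \<and> property_FBr TYPE('u) H \<and> finite X) \<and>
         (property_FH TYPE('u) (wreath_product G H X \<theta>) \<longleftrightarrow>
            property_FH TYPE('u) G \<and> property_FH TYPE('u) H \<and> finite X) \<and>
         (property_FW TYPE('u) (wreath_product G H X \<theta>) \<longleftrightarrow>
            property_FW TYPE('u) G \<and> property_FW TYPE('u) H \<and> finite X)"
proof -
  interpret wreath_universe G H X \<theta> "TYPE('u)"
    by (intro wreath_universe.intro wreath.intro wreath_universe_axioms.intro) (use assms in auto)
  have "bergman_property TYPE('u) W \<longleftrightarrow>
      bergman_property TYPE('u) G \<and> bergman_property TYPE('u) H \<and> finite X"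
    using bergman_wreath bergman_quotient bergman_factor[OF _ _ assms(5)]
      FW_finite[OF bergman_imp_FW assms(3)] by blast
  moreover have "property_FBr TYPE('u) W \<longleftrightarrow>
      property_FBr TYPE('u) G \<and> property_FBr TYPE('u) H \<and> finite X"
    using FBr_wreath FBr_quotient FBr_factor[OF _ _ assms(5)]
      FH_finite[OF property_FBr_imp_FH assms(3)] by blast
  moreover have "property_FH TYPE('u) W \<longleftrightarrow>
      property_FH TYPE('u) G \<and> property_FH TYPE('u) H \<and> finite X"
    using FH_wreath FH_quotient FH_factor[OF _ _ assms(5)] FH_finite[OF _ assms(3)] by blast
  moreover have "property_FW TYPE('u) W \<longleftrightarrow>
      property_FW TYPE('u) G \<and> property_FW TYPE('u) H \<and> finite X"
    using FW_wreath FW_quotient FW_factor[OF _ assms(5)] FW_finite[OF _ assms(3)] by blast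
  ultimately show ?thesis by blast
qed

end
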